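(* I) (Unimodular networks) Let $(G_n,\circ)$ be a sequence of unimodular networks such that $(G_n,\circ)\to(G,\circ)$ locally. Suppose that $\rho(G)<\infty$. Let $(T_G,\circ)$ be the universal cover of $(G,\circ)$. Let $\mu_n$ denote the spectral measure of $(G_n,\circ)$ and let $\mu_{T_G}$ denote the spectral measure of $(T_G,\circ)$. For every $\epsilon>0$, there is a constant $c(\epsilon,\rho(G),\rho(T_G))>0$ such that $$\liminf_{n\to\infty}\ \mu_n\big(\{|x|>\rho(T_G)-\epsilon\}\big)\ \ge\ c(\epsilon,\rho(G),\rho(T_G)).$$ II) (Finite graphs) Let $G_n$ be a sequence of finite, connected graphs with vertex degrees bounded by $\Delta$ and $|G_n|\to\infty$. Let $\sigma_j(G_n)$ be the $j$-th largest eigenvalue in absolute value of the adjacency matrix of $G_n$, counted with multiplicity (these are the singular values of $G_n$). Let $d_{\mathrm{av}}(G_n)$ denote the average degree of $G_n$. For every $j\ge 1$, $$\liminf_{n\to\infty}\ \sigma_j(G_n)\ \ge\ \liminf_{n\to\infty}\ 2\sqrt{d_{\mathrm{av}}(G_n)-1}.$$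
   Context: $|G|$ is the number of vertices of $G$. A rooted graph $(G,x)$ is a connected, locally finite graph $G$ with countably many vertices and a distinguished vertex $x$, the root. $\mathcal{G}^*$ is the set of isomorphism classes of rooted graphs (isomorphisms preserve the root), with the Polish topology in which $(G_n,x_n)\to(G,x)$ iff for every $r$ the $r$-neighbourhoods $B_r(G_n,x_n)$ and $B_r(G,x)$ of the roots are isomorphic as rooted graphs for all large $n$. A random rooted graph is a $\mathcal{G}^*$-valued random variable $(G,\circ)$. It is a unimodular network if $$\mathbf{E}\Big[\sum_{x\in V(G)}f(G,\circ,x)\Big]=\mathbf{E}\Big[\sum_{x\in V(G)}f(G,x,\circ)\Big]$$ for every non-negative measurable function $f$ on the set of isomorphism classes of doubly rooted graphs $(G,x,y)$. Unimodular networks $(G_n,\circ)$ converge locally to $(G,\circ)$ if $\mathbf{E}[f(G_n,\circ)]\to\mathbf{E}[f(G,\circ)]$ for every bounded continuous $f:\mathcal{G}^*\to\mathbb{R}$; the limit is again a unimodular network. $W_k(G,x)$ is the set of closed walks of length $k$ in $G$ starting from $x$. The spectral radius of a unimodular network $(G,\circ)$ is $\rho(G)=\lim_{k\to\infty}\mathbf{E}[|W_{2k}(G,\circ)|]^{1/(2k)}$. The spectral measure of a unimodular network $(G,\circ)$ is the Borel probability measure $\mu_G(B)=\mathbf{E}\big[\mu^{\delta_\circ}_{A_G}(B)\big]$ on $\mathbb{R}$, where $\mu^{\delta_\circ}_{A_G}$ is the spectral measure at the function $\delta_\circ$ of the adjacency operator $A_G$ of $G$ acting on $\ell^2(G)$.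 Its $k$-th moment is $\mathbf{E}[|W_k(G,\circ)|]$, and $\rho(G)=\sup\{|x|:x\in\mathrm{support}(\mu_G)\}$. For a finite graph with uniform random root it is the empirical measure of the eigenvalues of the adjacency matrix. The universal cover $T_G$ of a connected, locally finite graph $G$ is the unique tree admitting a surjective graph homomorphism $\pi:T_G\to G$ that is an isomorphism on the 1-neighbourhood of every vertex, in the sense that it maps the neighbours of each vertex $v$ bijectively onto the neighbours of $\pi(v)$. For a unimodular network $(G,\circ)$, $(T_G,\circ)$ denotes the universal cover of each sample of $G$, rooted at any vertex $\hat\circ$ with $\pi(\hat\circ)=\circ$ (the rooted isomorphism class does not depend on the choice); it is again a unimodular network.
   Formalization: In Part I the constant c depends on ε and the limit network (G,∘), uniformly over sequences G_n → G, not only on ε, ρ(G), ρ(T_G); a constant in those three numbers alone is impossible (mix a d-regular tree with probability p and a bi-infinite path, p → 0). *)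

theory Defs
  imports "HOL-Probability.Probability" "Jordan_Normal_Form.Char_Poly"
begin

section \<open>Simple graphs\<close>

record 'v ugraph =
  verts :: "'v set"
  adj :: "('v \<times> 'v) set"

definition simple_graph :: "'v ugraph \<Rightarrow> bool" where
  "simple_graph G \<longleftrightarrow> adj G \<subseteq> verts G \<times> verts G \<and> sym (adj G) \<and> irrefl (adj G)"

definition nbrs :: "'v ugraph \<Rightarrow> 'v \<Rightarrow> 'v set" where
  "nbrs G v = adj G `` {v}"

definition locally_finite_graph :: "'v ugraph \<Rightarrow> bool" where
  "locally_finite_graph G \<longleftrightarrow> (\<forall>v\<in>verts G. finite (nbrs G v))"

definition connected_graph :: "'v ugraph \<Rightarrow> bool" where
  "connected_graph G \<longleftrightarrow> verts G \<noteq> {} \<and> (\<forall>u\<in>verts G. \<forall>v\<in>verts G. (u, v) \<in> (adj G)\<^sup>*)"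

definition is_cycle :: "'v ugraph \<Rightarrow> 'v list \<Rightarrow> bool" where
  "is_cycle G c \<longleftrightarrow> length c \<ge> 3 \<and> distinct c \<and>
     (\<forall>i. Suc i < length c \<longrightarrow> (c ! i, c ! Suc i) \<in> adj G) \<and> (last c, hd c) \<in> adj G"

definition tree_graph :: "'v ugraph \<Rightarrow> bool" where
  "tree_graph G \<longleftrightarrow> simple_graph G \<and> connected_graph G \<and> (\<nexists>c. is_cycle G c)"

definition induced_subgraph :: "'v ugraph \<Rightarrow> 'v set \<Rightarrow> 'v ugraph" where
  "induced_subgraph G S = \<lparr>verts = verts G \<inter> S, adj = adj G \<inter> S \<times> S\<rparr>"

text \<open>The vertices at graph distance at most \<open>r\<close> from \<open>x\<close>.\<close>

definition graph_ball :: "'v ugraph \<Rightarrow> 'v \<Rightarrow> nat \<Rightarrow> 'v set" where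
  "graph_ball G x r = {v. \<exists>k\<le>r. (x, v) \<in> adj G ^^ k}"

text \<open>Closed walks of length \<open>k\<close> from \<open>x\<close>, as lists of the \<open>k + 1\<close> visited vertices.\<close>

definition closed_walks :: "nat \<Rightarrow> 'v ugraph \<Rightarrow> 'v \<Rightarrow> 'v list set" where
  "closed_walks k G x = {w. length w = Suc k \<and> set w \<subseteq> verts G \<and> hd w = x \<and> last w = x \<and>
     (\<forall>i<k. (w ! i, w ! Suc i) \<in> adj G)}"

definition covering_map :: "'w ugraph \<Rightarrow> 'v ugraph \<Rightarrow> ('w \<Rightarrow> 'v) \<Rightarrow> bool" where
  "covering_map H G \<pi> \<longleftrightarrow> \<pi> ` verts H = verts G \<and>
     (\<forall>(u, v)\<in>adj H. (\<pi> u, \<pi> v) \<in> adj G) \<and>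
     (\<forall>v\<in>verts H. bij_betw \<pi> (nbrs H v) (nbrs G (\<pi> v)))"


section \<open>Isomorphism classes of rooted and doubly rooted graphs\<close>

text \<open>
  Rooted and doubly rooted graphs are treated uniformly: a marked graph carries distinguished
  vertices indexed by a type \<open>'r\<close>, which is \<open>unit\<close> for one root and \<open>bool\<close> for
  two.  The vertices are countably many, so they may be taken to form a subset of \<open>nat\<close>.
\<close>

definition valid_marked :: "'v ugraph \<times> ('r \<Rightarrow> 'v) \<Rightarrow> bool" where
  "valid_marked = (\<lambda>(G, p). simple_graph G \<and> locally_finite_graph G \<and> connected_graph G \<and>
     range p \<subseteq> verts G)"

definition marked_isomorphic ::
  "'v ugraph \<times> ('r \<Rightarrow> 'v) \<Rightarrow> 'w ugraph \<times> ('r \<Rightarrow> 'w) \<Rightarrow> bool" where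
  "marked_isomorphic = (\<lambda>(G, p) (H, q). \<exists>\<phi>. bij_betw \<phi> (verts G) (verts H) \<and>
     (\<forall>i. \<phi> (p i) = q i) \<and>
     (\<forall>u\<in>verts G. \<forall>v\<in>verts G. (u, v) \<in> adj G \<longleftrightarrow> (\<phi> u, \<phi> v) \<in> adj H))"

definition marked_equiv ::
  "nat ugraph \<times> ('r \<Rightarrow> nat) \<Rightarrow> nat ugraph \<times> ('r \<Rightarrow> nat) \<Rightarrow> bool" where
  "marked_equiv x y \<longleftrightarrow> valid_marked x \<and> valid_marked y \<and> marked_isomorphic x y"

lemma marked_isomorphic_refl: "marked_isomorphic x x"
  unfolding marked_isomorphic_def by (cases x) (auto intro!: exI[of _ id])

lemma marked_isomorphic_sym:
  assumes "valid_marked x" "marked_isomorphic x y"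
  shows "marked_isomorphic y x"
proof -
  obtain G p H q where xy: "x = (G, p)" "y = (H, q)" by fastforce
  with assms obtain \<phi> where bij: "bij_betw \<phi> (verts G) (verts H)"
    and roots: "\<And>i. \<phi> (p i) = q i"
    and adj: "\<And>u v. u \<in> verts G \<Longrightarrow> v \<in> verts G \<Longrightarrow> (u, v) \<in> adj G \<longleftrightarrow> (\<phi> u, \<phi> v) \<in> adj H"
    unfolding marked_isomorphic_def by auto
  have p: "p i \<in> verts G" for i using assms(1) xy by (auto simp: valid_marked_def)
  let ?\<psi> = "inv_into (verts G) \<phi>"
  have "bij_betw ?\<psi> (verts H) (verts G)" using bij by (rule bij_betw_inv_into)
  moreover have "?\<psi> (q i) = p i" for i
    using bij_betw_inv_into_left[OF bij p] roots by simp
  moreover have "(u, v) \<in> adj H \<longleftrightarrow> (?\<psi> u, ?\<psi> v) \<in> adj G" if "u \<in> verts H" "v \<in> verts H" for u v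
    using adj[of "?\<psi> u" "?\<psi> v"] bij_betw_inv_into_right[OF bij] that
      bij_betw_apply[OF bij_betw_inv_into[OF bij]] by simp
  ultimately show ?thesis unfolding xy marked_isomorphic_def prod.case by blast
qed

lemma marked_isomorphic_trans:
  assumes "marked_isomorphic x y" "marked_isomorphic y z"
  shows "marked_isomorphic x z"
proof -
  obtain G p H q K s where xyz: "x = (G, p)" "y = (H, q)" "z = (K, s)" by (metis surj_pair)
  obtain \<phi> where \<phi>: "bij_betw \<phi> (verts G) (verts H)" "\<And>i. \<phi> (p i) = q i"
    "\<And>u v. u \<in> verts G \<Longrightarrow> v \<in> verts G \<Longrightarrow> (u, v) \<in> adj G \<longleftrightarrow> (\<phi> u, \<phi> v) \<in> adj H"
    using assms(1) unfolding xyz marked_isomorphic_def by auto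
  obtain \<psi> where \<psi>: "bij_betw \<psi> (verts H) (verts K)" "\<And>i. \<psi> (q i) = s i"
    "\<And>u v. u \<in> verts H \<Longrightarrow> v \<in> verts H \<Longrightarrow> (u, v) \<in> adj H \<longleftrightarrow> (\<psi> u, \<psi> v) \<in> adj K"
    using assms(2) unfolding xyz marked_isomorphic_def by auto
  have "bij_betw (\<psi> \<circ> \<phi>) (verts G) (verts K)" using \<phi>(1) \<psi>(1) by (rule bij_betw_trans)
  moreover have "(u, v) \<in> adj G \<longleftrightarrow> ((\<psi> \<circ> \<phi>) u, (\<psi> \<circ> \<phi>) v) \<in> adj K"
    if "u \<in> verts G" "v \<in> verts G" for u v
    using \<phi>(3)[of u v] \<psi>(3)[of "\<phi> u" "\<phi> v"] that bij_betw_apply[OF \<phi>(1)] by simp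
  ultimately show ?thesis
    unfolding xyz marked_isomorphic_def prod.case using \<phi>(2) \<psi>(2)
    by (intro exI[of _ "\<psi> \<circ> \<phi>"] conjI) simp_all
qed

quotient_type 'r marked_graph = "nat ugraph \<times> ('r \<Rightarrow> nat)" / partial: marked_equiv
proof (rule part_equivpI)
  have "marked_equiv (\<lparr>verts = {0}, adj = {}\<rparr>, \<lambda>_. 0) (\<lparr>verts = {0}, adj = {}\<rparr>, \<lambda>_. 0)"
    by (auto simp: marked_equiv_def marked_isomorphic_refl valid_marked_def simple_graph_def
        locally_finite_graph_def connected_graph_def nbrs_def sym_def irrefl_def)
  then show "\<exists>x :: nat ugraph \<times> ('r \<Rightarrow> nat). marked_equiv x x" by blast
  show "symp (marked_equiv :: nat ugraph \<times> ('r \<Rightarrow> nat) \<Rightarrow> _)"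
    by (auto simp: symp_def marked_equiv_def intro: marked_isomorphic_sym)
  show "transp (marked_equiv :: nat ugraph \<times> ('r \<Rightarrow> nat) \<Rightarrow> _)"
    unfolding transp_def marked_equiv_def by (blast intro: marked_isomorphic_trans)
qed

type_synonym rooted_graph = "unit marked_graph"
type_synonym birooted_graph = "bool marked_graph"

text \<open>
  A chosen representative of an isomorphism class.  All notions below that are expressed through
  \<open>graph\<close>, \<open>roots\<close> and \<open>origin\<close> are invariant under isomorphism.
\<close>

definition graph :: "'r marked_graph \<Rightarrow> nat ugraph" where
  "graph g = fst (rep_marked_graph g)"

definition roots :: "'r marked_graph \<Rightarrow> 'r \<Rightarrow> nat" where
  "roots g = snd (rep_marked_graph g)"

definition origin :: "rooted_graph \<Rightarrow> nat" where
  "origin g = roots g ()"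

definition birooted :: "nat ugraph \<Rightarrow> nat \<Rightarrow> nat \<Rightarrow> birooted_graph" where
  "birooted G x y = abs_marked_graph (G, \<lambda>b. if b then y else x)"

text \<open>
  The \<open>r\<close>-neighbourhood of the roots; with several roots it is spanned by the union of
  the balls around them.
\<close>

definition root_nbhd :: "nat \<Rightarrow> 'r marked_graph \<Rightarrow> nat ugraph \<times> ('r \<Rightarrow> nat)" where
  "root_nbhd r g = (induced_subgraph (graph g) (\<Union>i. graph_ball (graph g) (roots g i) r), roots g)"

instantiation marked_graph :: (type) topological_space
begin

text \<open>
  Under this topology \<open>h\<^sub>n\<close> tends to \<open>g\<close> iff for each \<open>r\<close> the
  \<open>r\<close>-neighbourhoods of \<open>h\<^sub>n\<close> and \<open>g\<close> are eventually isomorphic.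
\<close>

definition open_marked_graph :: "'a marked_graph set \<Rightarrow> bool" where
  "open_marked_graph =
     generate_topology {U. \<exists>r g. U = {h. marked_isomorphic (root_nbhd r h) (root_nbhd r g)}}"

instance
proof
qed (unfold open_marked_graph_def, (rule generate_topology.intros; blast)+)

end


section \<open>Unimodular networks and local convergence\<close>

text \<open>A random rooted graph is represented by its law, a Borel probability measure.\<close>

definition random_rooted_graph :: "rooted_graph measure \<Rightarrow> bool" where
  "random_rooted_graph M \<longleftrightarrow> prob_space M \<and> sets M = sets borel"

definition unimodular_network :: "rooted_graph measure \<Rightarrow> bool" where
  "unimodular_network M \<longleftrightarrow> random_rooted_graph M \<and>
     (\<forall>f :: birooted_graph \<Rightarrow> ennreal. f \<in> borel_measurable borel \<longrightarrow>
        (\<integral>\<^sup>+ g. (\<integral>\<^sup>+ x. f (birooted (graph g) (origin g) x) \<partial>count_space (verts (graph g))) \<partial>M) =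
        (\<integral>\<^sup>+ g. (\<integral>\<^sup>+ x. f (birooted (graph g) x (origin g)) \<partial>count_space (verts (graph g))) \<partial>M))"

definition local_convergence ::
  "(nat \<Rightarrow> rooted_graph measure) \<Rightarrow> rooted_graph measure \<Rightarrow> bool" where
  "local_convergence Mn M \<longleftrightarrow>
     (\<forall>f :: rooted_graph \<Rightarrow> real. continuous_on UNIV f \<and> bounded (range f) \<longrightarrow>
        (\<lambda>n. \<integral>g. f g \<partial>Mn n) \<longlonglongrightarrow> (\<integral>g. f g \<partial>M))"

definition expected_closed_walks :: "rooted_graph measure \<Rightarrow> nat \<Rightarrow> ennreal" where
  "expected_closed_walks M k = (\<integral>\<^sup>+ g. of_nat (card (closed_walks k (graph g) (origin g))) \<partial>M)"

definition spectral_radius :: "rooted_graph measure \<Rightarrow> ereal" where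
  "spectral_radius M = lim (\<lambda>k.
     if expected_closed_walks M (2 * k) = \<infinity> then \<infinity>
     else ereal (root (2 * k) (enn2real (expected_closed_walks M (2 * k)))))"

text \<open>
  The class of the tree covering \<open>g\<close>, rooted above the root of \<open>g\<close>; it is
  unique up to rooted isomorphism.
\<close>

definition universal_cover :: "rooted_graph \<Rightarrow> rooted_graph" where
  "universal_cover g = (THE t. tree_graph (graph t) \<and>
     (\<exists>\<pi>. covering_map (graph t) (graph g) \<pi> \<and> \<pi> (origin t) = origin g))"

definition universal_cover_network :: "rooted_graph measure \<Rightarrow> rooted_graph measure" where
  "universal_cover_network M = distr M borel universal_cover"


section \<open>Spectral measures\<close>

text \<open>
  The complex Hilbert space of square-summable functions on \<open>V\<close>, realised as functions
  vanishing off \<open>V\<close>.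
\<close>

definition ell2 :: "'v set \<Rightarrow> ('v \<Rightarrow> complex) set" where
  "ell2 V = {f. (\<forall>v. v \<notin> V \<longrightarrow> f v = 0) \<and> (\<lambda>v. (cmod (f v))\<^sup>2) summable_on V}"

definition ell2_inner :: "'v set \<Rightarrow> ('v \<Rightarrow> complex) \<Rightarrow> ('v \<Rightarrow> complex) \<Rightarrow> complex" where
  "ell2_inner V f g = (\<Sum>\<^sub>\<infinity>v\<in>V. f v * cnj (g v))"

definition orthogonal_projection :: "'v set \<Rightarrow> (('v \<Rightarrow> complex) \<Rightarrow> ('v \<Rightarrow> complex)) \<Rightarrow> bool" where
  "orthogonal_projection V P \<longleftrightarrow>
     (\<forall>f\<in>ell2 V. P f \<in> ell2 V \<and> P (P f) = P f) \<and>
     (\<forall>f\<in>ell2 V. \<forall>g\<in>ell2 V. P (\<lambda>v. f v + g v) = (\<lambda>v. P f v + P g v)) \<and>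
     (\<forall>f\<in>ell2 V. \<forall>c. P (\<lambda>v. c * f v) = (\<lambda>v. c * P f v)) \<and>
     (\<forall>f\<in>ell2 V. \<forall>g\<in>ell2 V. ell2_inner V (P f) g = ell2_inner V f (P g))"

definition projection_valued_measure ::
  "'v set \<Rightarrow> (real set \<Rightarrow> ('v \<Rightarrow> complex) \<Rightarrow> ('v \<Rightarrow> complex)) \<Rightarrow> bool" where
  "projection_valued_measure V E \<longleftrightarrow>
     (\<forall>B\<in>sets borel. orthogonal_projection V (E B)) \<and>
     (\<forall>f\<in>ell2 V. E UNIV f = f) \<and>
     (\<forall>B\<in>sets borel. \<forall>C\<in>sets borel. \<forall>f\<in>ell2 V. E (B \<inter> C) f = E B (E C f)) \<and>
     (\<forall>f\<in>ell2 V. \<forall>B :: nat \<Rightarrow> real set. range B \<subseteq> sets borel \<and> disjoint_family B \<longrightarrow>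
        (\<lambda>i. ell2_inner V (E (B i) f) f) sums ell2_inner V (E (\<Union>i. B i) f) f)"

definition pvm_measure ::
  "'v set \<Rightarrow> (real set \<Rightarrow> ('v \<Rightarrow> complex) \<Rightarrow> ('v \<Rightarrow> complex)) \<Rightarrow> ('v \<Rightarrow> complex) \<Rightarrow> real measure" where
  "pvm_measure V E f = measure_of UNIV (sets borel) (\<lambda>B. ennreal (Re (ell2_inner V (E B f) f)))"

text \<open>
  The adjacency operator with its natural maximal domain, which is the domain of the adjoint of
  the adjacency operator on finitely supported functions.  It is all of \<open>ell2\<close> for
  bounded degrees; in general the operator is self-adjoint exactly when the adjacency operator on
  finitely supported functions is essentially self-adjoint.
\<close>

definition adjacency_op :: "'v ugraph \<Rightarrow> ('v \<Rightarrow> complex) \<Rightarrow> ('v \<Rightarrow> complex)" where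
  "adjacency_op G f = (\<lambda>v. \<Sum>u\<in>nbrs G v. f u)"

definition adjacency_dom :: "'v ugraph \<Rightarrow> ('v \<Rightarrow> complex) set" where
  "adjacency_dom G = {f \<in> ell2 (verts G). adjacency_op G f \<in> ell2 (verts G)}"

text \<open>
  \<open>A = \<integral> x dE(x)\<close> as an identity of unbounded operators, domains included.  Agreement of
  the quadratic forms on the common domain gives agreement of the operators by polarisation.
\<close>

definition spectral_resolution ::
  "'v ugraph \<Rightarrow> (real set \<Rightarrow> ('v \<Rightarrow> complex) \<Rightarrow> ('v \<Rightarrow> complex)) \<Rightarrow> bool" where
  "spectral_resolution G E \<longleftrightarrow> projection_valued_measure (verts G) E \<and>
     adjacency_dom G = {f \<in> ell2 (verts G). integrable (pvm_measure (verts G) E f) (\<lambda>x. x\<^sup>2)} \<and>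
     (\<forall>f\<in>adjacency_dom G. ell2_inner (verts G) (adjacency_op G f) f =
        complex_of_real (\<integral>x. x \<partial>pvm_measure (verts G) E f))"

definition spectral_measure_at :: "'v ugraph \<Rightarrow> ('v \<Rightarrow> complex) \<Rightarrow> real measure \<Rightarrow> bool" where
  "spectral_measure_at G f \<mu> \<longleftrightarrow>
     (\<exists>E. spectral_resolution G E \<and> \<mu> = pvm_measure (verts G) E f)"

text \<open>
  \<open>\<mu>(B)\<close> is the expectation of \<open>\<kappa> g B\<close>, where \<open>\<kappa> g\<close> is the spectral
  measure of the sample \<open>g\<close> at the indicator of its root.
\<close>

definition network_spectral_measure :: "rooted_graph measure \<Rightarrow> real measure \<Rightarrow> bool" where
  "network_spectral_measure M \<mu> \<longleftrightarrow> (\<exists>\<kappa>. \<kappa> \<in> M \<rightarrow>\<^sub>M prob_algebra borel \<and>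
     (AE g in M. spectral_measure_at (graph g) (indicator {origin g}) (\<kappa> g)) \<and>
     sets \<mu> = sets borel \<and>
     (\<forall>B\<in>sets borel. emeasure \<mu> B = (\<integral>\<^sup>+ g. emeasure (\<kappa> g) B \<partial>M)))"


section \<open>Finite graphs\<close>

definition average_degree :: "'v ugraph \<Rightarrow> real" where
  "average_degree G = (\<Sum>v\<in>verts G. real (card (nbrs G v))) / real (card (verts G))"

text \<open>The enumeration of the vertices is arbitrary; it does not affect the spectrum.\<close>

definition adjacency_matrix :: "'v ugraph \<Rightarrow> complex mat" where
  "adjacency_matrix G = (let vs = (SOME vs. distinct vs \<and> set vs = verts G) in
     mat (card (verts G)) (card (verts G)) (\<lambda>(i, j). if (vs ! i, vs ! j) \<in> adj G then 1 else 0))"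

text \<open>
  The \<open>j\<close>-th largest absolute value of an eigenvalue, with multiplicity; meaningful for
  \<open>1 \<le> j \<le> card (verts G)\<close>.
\<close>

definition graph_singular_value :: "nat \<Rightarrow> 'v ugraph \<Rightarrow> real" where
  "graph_singular_value j G =
     rev (sorted_list_of_multiset (image_mset cmod (proots (char_poly (adjacency_matrix G))))) ! (j - 1)"

end

theory Submission
  imports Defs "Jordan_Normal_Form.Schur_Decomposition" "HOL-Library.Sublist"
begin

text \<open>
  For networks, only a bound for the fixed limit \<open>G\<close> is needed.  The covering map sends closed walks of
  \<open>T\<^sub>G\<close> injectively to closed walks of \<open>G\<close>, so if \<open>t < \<rho>(T\<^sub>G)\<close> there is \<open>k\<close> such that with positive
  probability the root of \<open>G\<close> has more than \<open>t\<^bsup>2k\<^esup>\<close> closed walks of length \<open>2k\<close>.  The numbers of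
  closed walks of lengths \<open>2k\<close> and \<open>4k\<close> are moments of the spectral measure at the root and depend only
  on a finite ball, so the event that they take two given values has a convergent probability, and on this
  event a Paley--Zygmund estimate bounds the mass of \<open>{\<bar>x\<bar> > t}\<close> from below.

  For finite graphs, walks that backtrack completely in the universal cover are counted by a recursion over
  directed edges.  By Jensen's inequality and the stationarity of the non-backtracking walk under the uniform
  distribution on directed edges, their number is on average at least \<open>C\<^sub>k (d - 1)\<^sup>k\<close> with
  the Catalan number \<open>C\<^sub>k\<close>, provided all degrees are at least two; passing to a suitable induced
  subgraph removes this restriction when \<open>d > 2\<close> by a margin, and geodesics handle the remaining case.  The
  trace of the \<open>2k\<close>-th power of the adjacency matrix then bounds the \<open>j\<close>-th singular value, since the
  first \<open>j\<close> of them contribute only a bounded amount.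
\<close>

section \<open>Closed walks and non-backtracking branches\<close>

text \<open>The 2 in 2 sqrt (d - 1) is the square root of the growth rate 4 of the Catalan numbers:
  where every edge has \<open>D\<close> continuations, the branch counts are exactly
  \<open>catalan k * D ^ k\<close>. In an irregular graph the recursion multiplies counts at
  neighbouring edges, and an average of products is not a product of averages. Logarithms leave only
  linear averages over directed edges, which stationarity evaluates; minimum degree two keeps the
  counts positive. Branches stay on one side of an edge because the first-return decomposition
  closes up on them. For networks the obstacle is that the spectral measure comes from an arbitrary
  resolution \<open>E\<close> of a possibly unbounded operator, known only through its domain and
  quadratic form. Its even moments are accessible once \<open>E\<close> is shown to commute with the
  operator. The cover is realised as the tree of non-backtracking walks, so that its balls can be
  read off from balls of the base graph; this makes the passage to the cover continuous, hence
  measurable.\<close>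

primrec walk_count :: "('v \<Rightarrow> 'v set) \<Rightarrow> nat \<Rightarrow> 'v \<Rightarrow> 'v \<Rightarrow> nat" where
  "walk_count N 0 x y = of_bool (x = y)"
| "walk_count N (Suc t) x y = (\<Sum>z\<in>N x. walk_count N t z y)"

text \<open>
  Closed walks of length \<open>2k\<close> in the universal cover that start at the head of a lift of the directed edge
  \<open>(u, v)\<close> and never visit its tail, decomposed at the first return.
\<close>

function branch_count :: "('v \<Rightarrow> 'v set) \<Rightarrow> nat \<Rightarrow> 'v \<Rightarrow> 'v \<Rightarrow> nat" where
  "branch_count N 0 u v = 1"
| "branch_count N (Suc k) u v =
     (\<Sum>i\<le>k. (\<Sum>w\<in>N v - {u}. branch_count N i v w) * branch_count N (k - i) u v)"
  by pat_completeness auto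
termination by (relation "Wellfounded.measure (\<lambda>(N, k, u, v). k)") auto

text \<open>Equals \<open>branch_count\<close> when every vertex offers a single continuation, as on
  a two-way infinite path.\<close>

fun catalan :: "nat \<Rightarrow> nat" where
  "catalan 0 = 1"
| "catalan (Suc k) = (\<Sum>i\<le>k. catalan i * catalan (k - i))"

text \<open>
  A stack, read from its last to its first entry, is a non-backtracking walk, i.e. a vertex of the universal
  cover; moving to \<open>y\<close> pops the stack when it undoes the last step.
\<close>

definition stack_move :: "'v list \<Rightarrow> 'v \<Rightarrow> 'v list" where
  "stack_move s y = (if tl s \<noteq> [] \<and> y = hd (tl s) then tl s else y # s)"

text \<open>Walks in the cover from the stack \<open>s\<close> to a fixed target \<open>b\<close>;
  the position in the base graph is the head of the stack.\<close>

primrec stack_walks :: "('v \<Rightarrow> 'v set) \<Rightarrow> 'v list \<Rightarrow> nat \<Rightarrow> 'v list \<Rightarrow> nat" where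
  "stack_walks N b 0 s = of_bool (s = b)"
| "stack_walks N b (Suc t) s = (\<Sum>y\<in>N (hd s). stack_walks N b t (stack_move s y))"

text \<open>Whether a move pops or pushes, the new head is the chosen \<open>y\<close>, so a stack
  walk is determined by its projection; ending in the stack \<open>b\<close> forces ending at
  \<open>hd b\<close>.\<close>

lemma stack_walks_le_walk_count: "stack_walks N b t s \<le> walk_count N t (hd s) (hd b)"
proof (induction t arbitrary: s)
  case (Suc t)
  have "hd (stack_move s y) = y" for y by (auto simp: stack_move_def)
  with Suc[of "stack_move s y" for y] show ?case by (auto intro!: sum_mono)
qed auto

text \<open>Sorts walks by the time \<open>2 * i + 1\<close> at which the top entry \<open>w\<close>
  is popped for the first time: an excursion above \<open>w\<close>, counted by
  \<open>branch_count N i v w\<close>, then the pop, then any walk from \<open>v # r\<close>. The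
  range \<open>i < Suc t div 2\<close> says \<open>2 * i + 1 \<le> t\<close>.\<close>

lemma stack_walks_pop:
  assumes fin: "\<And>x. finite (N x)" and sym: "\<And>x y. x \<in> N y \<Longrightarrow> y \<in> N x"
  shows "v \<in> N w \<Longrightarrow>
    (\<Sum>i<Suc t div 2. branch_count N i v w * stack_walks N b (t - 2 * i - 1) (v # r))
      \<le> stack_walks N b t (w # v # r)"
proof (induction t arbitrary: v w r rule: less_induct)
  case (less t)
  show ?case
  proof (cases t)
    case 0
    then show ?thesis by simp
  next
    case (Suc t')
    let ?M = "\<lambda>j. stack_walks N b j (v # r)"
    let ?n = "t' div 2"
    \<comment> \<open>Excursions of length \<open>2 * i\<close> above some child \<open>y\<close> of
      \<open>w\<close>.\<close>
    define \<phi> where "\<phi> i = (\<Sum>y\<in>N w - {v}. branch_count N i w y)" for i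
    \<comment> \<open>Once the child is popped the stack is \<open>w # v # r\<close> again with
      \<open>t' - 2 * i - 1\<close> steps left, and the induction hypothesis applies to the
      rest.\<close>
    have inner: "(\<Sum>j<?n - i. branch_count N j v w * ?M (t' - 2 * (i + j) - 2))
        \<le> stack_walks N b (t' - 2 * i - 1) (w # v # r)" if "i < ?n" for i
    proof -
      have "Suc (t' - 2 * i - 1) div 2 = ?n - i" using that by simp
      moreover have "t' - 2 * i - 1 - 2 * j - 1 = t' - 2 * (i + j) - 2" for j by simp
      ultimately show ?thesis
        using less.IH[of "t' - 2 * i - 1" v w r] less.prems Suc by (simp only: less_Suc_eq_le)
    qed
    have 1: "(\<Sum>i<Suc t' div 2. branch_count N i w y * stack_walks N b (t' - 2 * i - 1) (w # v # r))
        \<le> stack_walks N b t' (y # w # v # r)" if "y \<in> N w - {v}" for y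
      using less.IH[of t' w y "v # r"] that sym Suc by auto
    \<comment> \<open>A nonempty excursion above \<open>w\<close> splits at its first return to
      \<open>w\<close>. Unfolding the recursion gives a triangular double sum, which is reordered so
      that the part above the child comes outermost.\<close>
    have "(\<Sum>k<?n. branch_count N (Suc k) v w * ?M (t' - 2 * k - 2)) =
        (\<Sum>k<?n. \<Sum>i\<le>k. \<phi> i * branch_count N (k - i) v w * ?M (t' - 2 * (i + (k - i)) - 2))"
      by (auto simp: \<phi>_def sum_distrib_right intro!: sum.cong)
    also have "\<dots> = (\<Sum>(i, j)\<in>{(i, j). i + j < ?n}. \<phi> i * branch_count N j v w * ?M (t' - 2 * (i + j) - 2))"
      by (rule sum.triangle_reindex[symmetric])
    also have "{(i, j). i + j < ?n} = Sigma {..<?n} (\<lambda>i. {..<?n - i})" by auto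
    also have "(\<Sum>(i, j)\<in>Sigma {..<?n} (\<lambda>i. {..<?n - i}). \<phi> i * branch_count N j v w * ?M (t' - 2 * (i + j) - 2))
        = (\<Sum>i<?n. \<phi> i * (\<Sum>j<?n - i. branch_count N j v w * ?M (t' - 2 * (i + j) - 2)))"
      by (subst sum.Sigma[symmetric]) (auto simp: sum_distrib_left mult.assoc)
    also have "\<dots> \<le> (\<Sum>i<?n. \<phi> i * stack_walks N b (t' - 2 * i - 1) (w # v # r))"
      by (intro sum_mono mult_left_mono inner) auto
    also have "\<dots> \<le> (\<Sum>i<Suc t' div 2. \<phi> i * stack_walks N b (t' - 2 * i - 1) (w # v # r))"
      by (intro sum_mono2) auto
    also have "\<dots> = (\<Sum>y\<in>N w - {v}. \<Sum>i<Suc t' div 2.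
        branch_count N i w y * stack_walks N b (t' - 2 * i - 1) (w # v # r))"
      unfolding \<phi>_def sum_distrib_right by (rule sum.swap)
    also have "\<dots> \<le> (\<Sum>y\<in>N w - {v}. stack_walks N b t' (y # w # v # r))"
      by (intro sum_mono 1)
    finally have 2: "(\<Sum>k<?n. branch_count N (Suc k) v w * ?M (t' - 2 * k - 2))
        \<le> (\<Sum>y\<in>N w - {v}. stack_walks N b t' (y # w # v # r))" .
    have "(\<Sum>i<Suc t div 2. branch_count N i v w * ?M (t - 2 * i - 1)) =
        (\<Sum>i<Suc ?n. branch_count N i v w * ?M (t - 2 * i - 1))"
      using Suc by simp
    \<comment> \<open>The term \<open>i = 0\<close> is the immediate pop; all others begin with a
      push.\<close>
    also have "\<dots> = ?M t' + (\<Sum>k<?n. branch_count N (Suc k) v w * ?M (t' - 2 * k - 2))"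
      unfolding sum.lessThan_Suc_shift using Suc by (simp del: branch_count.simps(2))
    also have "\<dots> \<le> ?M t' + (\<Sum>y\<in>N w - {v}. stack_walks N b t' (y # w # v # r))"
      using 2 by simp
    also have "\<dots> = stack_walks N b t (w # v # r)"
    proof -
      have "(\<Sum>y\<in>N w. stack_walks N b t' (stack_move (w # v # r) y)) = 
        stack_walks N b t' (stack_move (w # v # r) v) +
        (\<Sum>y\<in>N w - {v}. stack_walks N b t' (stack_move (w # v # r) y))"
        using less.prems fin by (simp add: sum.remove)
      also have "(\<Sum>y\<in>N w - {v}. stack_walks N b t' (stack_move (w # v # r) y)) =
        (\<Sum>y\<in>N w - {v}. stack_walks N b t' (y # w # v # r))"
        by (intro sum.cong) (auto simp: stack_move_def)
      finally show ?thesis using Suc by (simp add: stack_move_def)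
    qed
    finally show ?thesis .
  qed
qed

text \<open>The first step pushes some \<open>w\<close> other than \<open>u\<close>, and
  \<open>stack_walks_pop\<close> handles the return to \<open>[v, u]\<close>. It is only an
  inequality, since stack walks may also descend to \<open>[u]\<close> and come back.\<close>

lemma branch_count_le_stack_walks:
  assumes fin: "\<And>x. finite (N x)" and sym: "\<And>x y. x \<in> N y \<Longrightarrow> y \<in> N x"
  shows "branch_count N k u v \<le> stack_walks N [v, u] (2 * k) [v, u]"
proof (induction k rule: less_induct)
  case (less k)
  show ?case
  proof (cases k)
    case 0
    then show ?thesis by simp
  next
    case (Suc k')
    let ?M = "stack_walks N [v, u]"
    have "branch_count N k u v = (\<Sum>w\<in>N v - {u}. \<Sum>i\<le>k'. branch_count N i v w * branch_count N (k' - i) u v)"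
      unfolding Suc branch_count.simps sum_distrib_right by (rule sum.swap)
    also have "\<dots> \<le> (\<Sum>w\<in>N v - {u}. ?M (Suc (2 * k')) [w, v, u])"
    proof (rule sum_mono)
      fix w assume w: "w \<in> N v - {u}"
      have "(\<Sum>i\<le>k'. branch_count N i v w * branch_count N (k' - i) u v) \<le>
        (\<Sum>i<Suc (Suc (2 * k')) div 2. branch_count N i v w * ?M (Suc (2 * k') - 2 * i - 1) [v, u])"
      proof -
        have "branch_count N (k' - i) u v \<le> ?M (Suc (2 * k') - 2 * i - 1) [v, u]" for i
          using less[of "k' - i"] Suc by (auto simp: diff_mult_distrib2)
        then show ?thesis
          by (auto intro!: sum_mono mult_left_mono simp flip: lessThan_Suc_atMost)
      qed
      also have "\<dots> \<le> ?M (Suc (2 * k')) [w, v, u]"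
        using stack_walks_pop[of N v w "[v, u]" "Suc (2 * k')" "[u]"] w fin sym by auto
      finally show "(\<Sum>i\<le>k'. branch_count N i v w * branch_count N (k' - i) u v)
        \<le> ?M (Suc (2 * k')) [w, v, u]" .
    qed
    also have "\<dots> = (\<Sum>w\<in>N v - {u}. ?M (Suc (2 * k')) (stack_move [v, u] w))"
      by (intro sum.cong) (auto simp: stack_move_def)
    also have "\<dots> \<le> (\<Sum>w\<in>N v. ?M (Suc (2 * k')) (stack_move [v, u] w))"
      by (intro sum_mono2 fin) auto
    finally show ?thesis using Suc by simp
  qed
qed

lemma branch_count_le_walk_count:
  assumes "\<And>x. finite (N x)" "\<And>x y. x \<in> N y \<Longrightarrow> y \<in> N x"
  shows "branch_count N k u v \<le> walk_count N (2 * k) v v"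
  using branch_count_le_stack_walks[of N k u v, OF assms] 
    stack_walks_le_walk_count[of N "[v, u]" "2 * k" "[v, u]"] by simp

lemma branch_count_mono:
  assumes "\<And>x. finite (N' x)" "\<And>x. N x \<subseteq> N' x"
  shows "branch_count N k u v \<le> branch_count N' k u v"
proof (induction k arbitrary: u v rule: less_induct)
  case (less k)
  show ?case
  proof (cases k)
    case (Suc k')
    have "(\<Sum>w\<in>N v - {u}. branch_count N i v w) \<le> (\<Sum>w\<in>N' v - {u}. branch_count N' i v w)"
      if "i \<le> k'" for i
    proof -
      have "(\<Sum>w\<in>N v - {u}. branch_count N i v w) \<le> (\<Sum>w\<in>N v - {u}. branch_count N' i v w)"
        using less[of i] Suc that by (auto intro!: sum_mono)
      also have "\<dots> \<le> (\<Sum>w\<in>N' v - {u}. branch_count N' i v w)"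
        using assms by (intro sum_mono2) auto
      finally show ?thesis .
    qed
    then show ?thesis using less Suc by (auto intro!: sum_mono mult_mono)
  qed auto
qed

section \<open>Growth of the Catalan numbers\<close>

lemma catalan_pos: "catalan k > 0"
proof (induction k rule: less_induct)
  case (less k)
  show ?case
  proof (cases k)
    case (Suc k')
    have "0 < catalan k'" using less Suc by auto
    also have "catalan k' = catalan 0 * catalan (k' - 0)" by simp
    also have "\<dots> \<le> (\<Sum>i\<le>k'. catalan i * catalan (k' - i))"
      by (rule member_le_sum[where f = "\<lambda>i. catalan i * catalan (k' - i)"]) auto
    finally show ?thesis using Suc by simp
  qed auto
qed

text \<open>If \<open>c\<^sub>k < K q\<^sup>k\<close> for all \<open>k\<close> with \<open>q < 4\<close>, the generating function \<open>f\<close> converges at some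
  \<open>z > 1/4\<close>, where \<open>f = 1 + z f\<^sup>2\<close> has no real solution.\<close>

lemma catalan_growth:
  fixes K q :: real
  assumes "0 < q" "q < 4"
  shows "\<exists>k. real (catalan k) \<ge> K * q ^ k"
proof (rule ccontr)
  assume "\<not> ?thesis"
  then have less: "real (catalan k) < K * q ^ k" for k by (auto simp: not_le)
  define z where "z = (1 / 4 + 1 / q) / 2"
  have z: "1 / 4 < z" "z < 1 / q" "z > 0" using assms by (auto simp: z_def field_simps add_pos_pos)
  have zq: "0 < q * z" "q * z < 1" using z assms by (auto simp: field_simps)
  let ?a = "\<lambda>k. real (catalan k) * z ^ k"
  have "summable (\<lambda>k. K * (q * z) ^ k)" using zq by (intro summable_mult summable_geometric) auto
  moreover have "norm (?a k) \<le> K * (q * z) ^ k" for k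
    using less[of k] z by (auto simp: power_mult_distrib abs_mult intro!: mult_right_mono)
  ultimately have sn: "summable (\<lambda>k. norm (?a k))"
    by (intro summable_comparison_test'[of "\<lambda>k. K * (q * z) ^ k" 0 "\<lambda>k. norm (?a k)"]) auto
  then have s: "summable ?a" by (rule summable_norm_cancel)
  define f where "f = suminf ?a"
  have "(\<lambda>k. \<Sum>i\<le>k. ?a i * ?a (k - i)) sums (f * f)"
    unfolding f_def by (rule Cauchy_product_sums[OF sn sn])
  moreover have "(\<Sum>i\<le>k. ?a i * ?a (k - i)) = real (catalan (Suc k)) * z ^ k" for k
  proof -
    have "?a i * ?a (k - i) = real (catalan i * catalan (k - i)) * z ^ k" if "i \<le> k" for i
      using that power_add[of z i "k - i"] by (simp add: algebra_simps)
    then have "(\<Sum>i\<le>k. ?a i * ?a (k - i)) = (\<Sum>i\<le>k. real (catalan i * catalan (k - i)) * z ^ k)"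
      by (intro sum.cong) auto
    then show ?thesis by (simp add: sum_distrib_right)
  qed
  ultimately have "(\<lambda>k. real (catalan (Suc k)) * z ^ k) sums (f * f)" by simp
  then have "(\<lambda>k. z * (real (catalan (Suc k)) * z ^ k)) sums (z * (f * f))" by (rule sums_mult)
  then have "(\<lambda>k. ?a (Suc k)) sums (z * (f * f))" by (simp add: algebra_simps)
  moreover have "(\<lambda>k. ?a (Suc k)) sums (f - ?a 0)"
    using summable_sums[OF s] unfolding f_def by (subst sums_Suc_iff) auto
  ultimately have "f - 1 = z * (f * f)" using sums_unique2 by fastforce
  moreover have "f > 0"
    unfolding f_def using z catalan_pos by (intro suminf_pos s) auto
  \<comment> \<open>The quadratic \<open>z f^2 - f + 1\<close>, which should vanish, equals
    \<open>(z - 1/4) f^2 + (f/2 - 1)^2\<close>.\<close>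
  then have "(z - 1 / 4) * (f * f) > 0" using z by auto
  moreover have "(f / 2 - 1)\<^sup>2 \<ge> 0" by simp
  ultimately show False by (simp add: power2_eq_square algebra_simps)
qed

section \<open>Branch counts under minimum degree two\<close>

text \<open>Jensen's inequality for \<open>ln\<close>: the tangent bound
  \<open>ln x \<le> x - 1\<close> is applied to the ratios of the \<open>y i\<close> to their mean
  \<open>Y\<close>, where the right-hand sides average to zero.\<close>

lemma weighted_ln_le_ln_sum:
  fixes w y :: "'i \<Rightarrow> real"
  assumes "finite I" "\<And>i. i \<in> I \<Longrightarrow> w i \<ge> 0" "sum w I = 1" "\<And>i. i \<in> I \<Longrightarrow> y i > 0"
  shows "(\<Sum>i\<in>I. w i * ln (y i)) \<le> ln (\<Sum>i\<in>I. w i * y i)"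
proof -
  define Y where "Y = (\<Sum>i\<in>I. w i * y i)"
  have "Y > 0"
  proof -
    obtain i where "i \<in> I" "w i > 0" using assms(2,3)
      by (metis less_eq_real_def sum.neutral zero_neq_one)
    then show ?thesis unfolding Y_def using assms
      by (intro sum_pos2[of I i]) (auto simp: less_imp_le)
  qed
  have "(\<Sum>i\<in>I. w i * ln (y i)) - ln Y = (\<Sum>i\<in>I. w i * ln (y i / Y))"
  proof -
    have "ln (y i / Y) = ln (y i) - ln Y" if "i \<in> I" for i
      using assms(4)[OF that] \<open>Y > 0\<close> by (simp add: ln_div)
    then have "(\<Sum>i\<in>I. w i * ln (y i / Y)) = (\<Sum>i\<in>I. w i * (ln (y i) - ln Y))" by simp
    also have "\<dots> = (\<Sum>i\<in>I. w i * ln (y i)) - (\<Sum>i\<in>I. w i) * ln Y"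
      by (simp add: right_diff_distrib sum_subtractf sum_distrib_right)
    finally show ?thesis using assms by simp
  qed
  also have "\<dots> \<le> (\<Sum>i\<in>I. w i * (y i / Y - 1))"
    using assms \<open>Y > 0\<close> by (intro sum_mono mult_left_mono ln_le_minus_one) auto
  also have "\<dots> = (\<Sum>i\<in>I. w i * y i) / Y - 1"
    using assms by (simp add: right_diff_distrib sum_subtractf sum_divide_distrib)
  also have "\<dots> = 0" using \<open>Y > 0\<close> by (simp flip: Y_def)
  finally show ?thesis by (simp add: Y_def)
qed

text \<open>The second derivative changes sign at 2, so convexity is available precisely in the
  range of degrees of a graph of minimum degree two.\<close>

lemma convex_on_times_ln_minus_one: "convex_on {2..} (\<lambda>x :: real. x * ln (x - 1))"
proof (rule f''_ge0_imp_convex)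
  fix x :: real assume x: "x \<in> {2..}"
  show "((\<lambda>x. x * ln (x - 1)) has_real_derivative (ln (x - 1) + x / (x - 1))) (at x)"
    using x by (auto intro!: derivative_eq_intros)
  show "((\<lambda>x. ln (x - 1) + x / (x - 1)) has_real_derivative ((x - 2) / (x - 1)\<^sup>2)) (at x)"
    using x by (auto intro!: derivative_eq_intros simp: power2_eq_square) (simp add: divide_simps)
  show "0 \<le> (x - 2) / (x - 1)\<^sup>2" using x by simp
qed simp

locale min_degree_two =
  fixes S :: "'v set" and N :: "'v \<Rightarrow> 'v set"
  assumes finS: "finite S" and ne: "S \<noteq> {}" and subN: "\<And>v. v \<in> S \<Longrightarrow> N v \<subseteq> S"
    and symN: "\<And>u v. u \<in> N v \<Longrightarrow> v \<in> N u" 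
    and deg2: "\<And>v. v \<in> S \<Longrightarrow> card (N v) \<ge> 2"
begin

text \<open>The number of directed edges.\<close>

definition "m = (\<Sum>v\<in>S. real (card (N v)))"

lemma finN: "v \<in> S \<Longrightarrow> finite (N v)"
  using subN finS finite_subset by blast

lemma edge_sum_swap:
  fixes f :: "'v \<Rightarrow> 'v \<Rightarrow> real"
  shows "(\<Sum>u\<in>S. \<Sum>v\<in>N u. f u v) = (\<Sum>v\<in>S. \<Sum>u\<in>N v. f u v)"
proof -
  have eq: "N u = {v \<in> S. v \<in> N u}" "N u = {v \<in> S. u \<in> N v}" if "u \<in> S" for u
    using subN that symN by blast+
  have "(\<Sum>u\<in>S. \<Sum>v\<in>N u. f u v) = (\<Sum>u\<in>S. \<Sum>v | v \<in> S \<and> v \<in> N u. f u v)"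
    by (intro sum.cong refl) (use eq in blast)
  also have "\<dots> = (\<Sum>v\<in>S. \<Sum>u | u \<in> S \<and> v \<in> N u. f u v)"
    using finS by (rule sum.swap_restrict[OF finS])
  also have "\<dots> = (\<Sum>v\<in>S. \<Sum>u\<in>N v. f u v)"
    by (intro sum.cong refl) (use eq in blast)
  finally show ?thesis .
qed

text \<open>The edge \<open>(v, w)\<close> is entered from the \<open>card (N v) - 1\<close> edges
  \<open>(u, v)\<close> with \<open>u\<close> different from \<open>w\<close>, each time with
  probability \<open>1 / (card (N v) - 1)\<close>; its total weight stays 1.\<close>

lemma nonbacktracking_stationary:
  fixes \<phi> :: "'v \<Rightarrow> 'v \<Rightarrow> real"
  shows "(\<Sum>u\<in>S. \<Sum>v\<in>N u. (\<Sum>w\<in>N v - {u}. \<phi> v w) / (real (card (N v)) - 1)) = 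
    (\<Sum>u\<in>S. \<Sum>v\<in>N u. \<phi> u v)"
proof -
  have "(\<Sum>u\<in>N v. (\<Sum>w\<in>N v - {u}. \<phi> v w) / (real (card (N v)) - 1)) = (\<Sum>w\<in>N v. \<phi> v w)" if "v \<in> S" for v
  proof -
    have "(\<Sum>u\<in>N v. \<Sum>w\<in>N v - {u}. \<phi> v w) = (\<Sum>u\<in>N v. (\<Sum>w\<in>N v. \<phi> v w) - \<phi> v u)"
      using finN[OF that] by (intro sum.cong) (auto simp: sum_diff1)
    also have "\<dots> = (real (card (N v)) - 1) * (\<Sum>w\<in>N v. \<phi> v w)"
      by (simp add: sum_subtractf algebra_simps)
    finally show ?thesis using deg2[OF that] by (simp flip: sum_divide_distrib)
  qed
  then show ?thesis by (subst edge_sum_swap) (auto intro: sum.cong)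
qed

lemma branch_count_pos: "v \<in> S \<Longrightarrow> branch_count N k u v > 0"
proof (induction k arbitrary: u v rule: less_induct)
  case (less k)
  show ?case
  proof (cases k)
    case (Suc k')
    have ne: "N v - {u} \<noteq> {}"
    proof
      assume "N v - {u} = {}"
      then have "card (N v) \<le> card {u}" by (intro card_mono) auto
      then show False using deg2[OF less.prems] by simp
    qed
    have "(\<Sum>w\<in>N v - {u}. branch_count N i v w) > 0" if "i \<le> k'" for i
    proof (rule sum_pos)
      show "0 < branch_count N i v w" if "w \<in> N v - {u}" for w
        using less.IH[of i w v] less.prems Suc that \<open>i \<le> k'\<close> subN[OF less.prems] by auto
    qed (use finN less.prems ne in auto)
    then show ?thesis using less Suc by (auto intro!: sum_pos)
  qed auto
qed

text \<open>The logarithm of the number of continuations of a directed edge, summed over all edges: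
  \<open>m\<close> times the entropy per step of the non-backtracking walk.\<close>

definition "L = (\<Sum>u\<in>S. \<Sum>v\<in>N u. ln (real (card (N v)) - 1))"

definition "T k = (\<Sum>u\<in>S. \<Sum>v\<in>N u. ln (real (branch_count N k u v)))"

text \<open>The recursion for \<open>branch_count\<close> in logarithmic form. Two uses of Jensen
  bound each logarithm by a linear expression in earlier ones; summed over all directed edges, that
  expression involves only \<open>T i\<close> and \<open>T (k' - i)\<close>, so the induction
  closes.\<close>

lemma T_ge: "m * ln (catalan k) + k * L \<le> T k"
proof (induction k rule: less_induct)
  case (less k)
  show ?case
  proof (cases k)
    case 0
    then show ?thesis by (simp add: T_def)
  next
    case (Suc k')
    define c where "c i = real (catalan i)" for i
    have c: "c i > 0" for i using catalan_pos by (simp add: c_def)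
    \<comment> \<open>The proportions in which the Catalan recursion splits. With these weights both
      uses of Jensen are equalities on a regular graph.\<close>
    define w where "w i = c i * c (k' - i) / c (Suc k')" for i
    have w: "w i > 0" for i by (simp add: w_def c)
    have w1: "(\<Sum>i\<le>k'. w i) = 1"
    proof -
      have "c (Suc k') = (\<Sum>i\<le>k'. c i * c (k' - i))" by (simp add: c_def)
      then show ?thesis using c[of "Suc k'"] by (simp add: w_def flip: sum_divide_distrib)
    qed
    let ?F = "\<lambda>i u v. real (branch_count N i u v)"
    define B where "B i u v = (\<Sum>x\<in>N v - {u}. ?F i v x)" for i u v
    \<comment> \<open>Jensen over the splitting index with weights \<open>w\<close>, and inside it
      Jensen over a uniform continuation \<open>x\<close> of the edge, which yields the term
      \<open>ln (card (N v) - 1)\<close>.\<close>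
    have step: "(\<Sum>i\<le>k'. w i * (ln (real (card (N v)) - 1) + 
        (\<Sum>x\<in>N v - {u}. ln (?F i v x)) / (real (card (N v)) - 1) + ln (?F (k' - i) u v) - ln (w i)))
        \<le> ln (?F k u v)" if uv: "u \<in> S" "v \<in> N u" for u v
    proof -
      have v: "v \<in> S" and u: "u \<in> N v" using uv subN symN by auto
      let ?d = "real (card (N v)) - 1"
      have d: "?d > 0" "real (card (N v - {u})) = ?d" using deg2[OF v] u finN[OF v] by auto
      have B: "ln ?d + (\<Sum>x\<in>N v - {u}. ln (?F i v x)) / ?d \<le> ln (B i u v)" "B i u v > 0" for i
      proof -
        have ne: "N v - {u} \<noteq> {}" using d by (metis card.empty less_irrefl of_nat_0)
        have pos: "?F i v x > 0" if "x \<in> N v - {u}" for x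
          using branch_count_pos[of x i v] that subN[OF v] by auto
        show "B i u v > 0" unfolding B_def 
          using finN[OF v] ne pos by (intro sum_pos) auto
        have "(\<Sum>x\<in>N v - {u}. 1 / ?d * ln (?F i v x)) \<le> ln (\<Sum>x\<in>N v - {u}. 1 / ?d * ?F i v x)"
          using d finN[OF v] pos by (intro weighted_ln_le_ln_sum) auto
        also have "(\<Sum>x\<in>N v - {u}. 1 / ?d * ?F i v x) = B i u v / ?d"
          by (simp add: B_def sum_divide_distrib)
        also have "ln \<dots> = ln (B i u v) - ln ?d" using d \<open>B i u v > 0\<close> by (simp add: ln_div)
        finally show "ln ?d + (\<Sum>x\<in>N v - {u}. ln (?F i v x)) / ?d \<le> ln (B i u v)"
          by (simp add: sum_divide_distrib)
      qed
      have Fp: "?F i u v > 0" for i using branch_count_pos[OF v] by simp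
      have "(\<Sum>i\<le>k'. w i * (ln ?d + (\<Sum>x\<in>N v - {u}. ln (?F i v x)) / ?d + ln (?F (k' - i) u v) - ln (w i)))
        \<le> (\<Sum>i\<le>k'. w i * ln (B i u v * ?F (k' - i) u v / w i))"
      proof (intro sum_mono mult_left_mono)
        fix i
        show "ln ?d + (\<Sum>x\<in>N v - {u}. ln (?F i v x)) / ?d + ln (?F (k' - i) u v) - ln (w i)
          \<le> ln (B i u v * ?F (k' - i) u v / w i)"
          using B[of i] Fp[of "k' - i"] w[of i] by (simp add: ln_div ln_mult)
      qed (use w less_imp_le in auto)
      also have "\<dots> \<le> ln (\<Sum>i\<le>k'. w i * (B i u v * ?F (k' - i) u v / w i))"
        using w w1 B(2) Fp by (intro weighted_ln_le_ln_sum) (auto intro: less_imp_le)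
      also have "(\<Sum>i\<le>k'. w i * (B i u v * ?F (k' - i) u v / w i)) = (\<Sum>i\<le>k'. B i u v * ?F (k' - i) u v)"
        using w by (intro sum.cong) (auto simp: less_imp_neq[OF w, symmetric])
      also have "\<dots> = ?F k u v" by (simp add: Suc B_def)
      finally show ?thesis .
    qed
    have "m * ln (c k) + k * L = (\<Sum>i\<le>k'. w i * (m * ln (c k) + k * L))"
      using w1 by (simp flip: sum_distrib_right)
    also have "\<dots> \<le> (\<Sum>i\<le>k'. w i * (L + T i + T (k' - i) - m * ln (w i)))"
    proof (intro sum_mono mult_left_mono)
      fix i assume "i \<in> {..k'}"
      then have i: "i \<le> k'" by simp
      have "m * ln (c i) + i * L \<le> T i" "m * ln (c (k' - i)) + (k' - i) * L \<le> T (k' - i)"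
        using less[of i] less[of "k' - i"] Suc i by (auto simp: c_def)
      \<comment> \<open>The logarithm of the weight cancels the Catalan terms of the two induction
        hypotheses and leaves \<open>ln (catalan k)\<close>.\<close>
      moreover have "m * ln (w i) = m * ln (c i) + m * ln (c (k' - i)) - m * ln (c k)"
        using c[of i] c[of "k' - i"] c[of "Suc k'"]
        by (simp add: w_def ln_div ln_mult Suc algebra_simps)
      moreover have "real k * L = L + i * L + (k' - i) * L"
        using i by (simp add: Suc algebra_simps of_nat_diff)
      ultimately show "m * ln (c k) + k * L \<le> L + T i + T (k' - i) - m * ln (w i)"
        by (simp add: algebra_simps)
    qed (use w less_imp_le in auto)
    \<comment> \<open>Here stationarity turns the averages over continuations into
      \<open>T i\<close>.\<close>
    also have "\<dots> = (\<Sum>i\<le>k'. w i * (\<Sum>u\<in>S. \<Sum>v\<in>N u. ln (real (card (N v)) - 1) + 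
        (\<Sum>x\<in>N v - {u}. ln (?F i v x)) / (real (card (N v)) - 1) + ln (?F (k' - i) u v) - ln (w i)))"
      by (simp add: sum.distrib sum_subtractf nonbacktracking_stationary 
          flip: L_def T_def) (simp add: m_def sum_distrib_right)
    also have "\<dots> = (\<Sum>u\<in>S. \<Sum>v\<in>N u. \<Sum>i\<le>k'. w i * (ln (real (card (N v)) - 1) + 
        (\<Sum>x\<in>N v - {u}. ln (?F i v x)) / (real (card (N v)) - 1) + ln (?F (k' - i) u v) - ln (w i)))"
      unfolding sum_distrib_left by (subst sum.swap, intro sum.cong refl, rule sum.swap)
    also have "\<dots> \<le> T k" unfolding T_def by (intro sum_mono step)
    finally show ?thesis by (simp add: c_def)
  qed
qed

text \<open>Grouped by heads, \<open>L\<close> is the sum of \<open>x ln (x - 1)\<close> over the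
  degrees \<open>x\<close>, and Jensen for this convex function compares it with the mean
  degree.\<close>

lemma L_ge: "m * ln (m / card S - 1) \<le> L" and mean_degree_ge_2: "m / card S \<ge> 2"
proof -
  define n where "n = real (card S)"
  have n: "n > 0" using finS ne by (simp add: n_def card_gt_0_iff)
  have "n * 2 = (\<Sum>v\<in>S. 2)" by (simp add: n_def)
  also have "\<dots> \<le> m" unfolding m_def using deg2 by (intro sum_mono) (simp add: numeral_le_real_of_nat_iff)
  finally show "m / card S \<ge> 2" using n by (simp add: n_def field_simps)
  let ?f = "\<lambda>x :: real. x * ln (x - 1)"
  have "?f (\<Sum>v\<in>S. (1 / n) *\<^sub>R real (card (N v))) \<le> (\<Sum>v\<in>S. (1 / n) * ?f (card (N v)))"
    using n finS ne deg2
    by (intro convex_on_sum[OF _ _ convex_on_times_ln_minus_one]) (auto simp: n_def numeral_le_real_of_nat_iff)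
  also have "(\<Sum>v\<in>S. (1 / n) *\<^sub>R real (card (N v))) = m / n" by (simp add: m_def sum_divide_distrib)
  also have "(\<Sum>v\<in>S. (1 / n) * ?f (card (N v))) = (\<Sum>v\<in>S. ?f (card (N v))) / n" by (simp add: sum_divide_distrib)
  also have "(\<Sum>v\<in>S. ?f (card (N v))) = L"
    unfolding L_def by (subst edge_sum_swap) simp
  finally show "m * ln (m / card S - 1) \<le> L" using n by (simp add: n_def field_simps)
qed

text \<open>Returns from logarithms to counts: \<open>1 + ln x \<le> x\<close> at
  \<open>x = branch_count N k u v / a\<close>, summed over the \<open>m\<close> directed edges. By
  \<open>T_ge\<close> and \<open>L_ge\<close> the logarithms have a nonnegative sum.\<close>

lemma branch_count_sum_ge:
  "m * (catalan k * (m / card S - 1) ^ k) \<le> (\<Sum>u\<in>S. \<Sum>v\<in>N u. real (branch_count N k u v))"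
proof -
  define D where "D = m / card S - 1"
  define a where "a = catalan k * D ^ k"
  have D: "D \<ge> 1" using mean_degree_ge_2 by (simp add: D_def)
  have a: "a > 0" using D catalan_pos[of k] by (simp add: a_def)
  have "ln a = ln (catalan k) + k * ln D"
    using D catalan_pos[of k] by (simp add: a_def ln_mult ln_realpow)
  then have "m * ln a = m * ln (catalan k) + k * (m * ln D)" by (simp add: algebra_simps)
  also have "\<dots> \<le> m * ln (catalan k) + k * L"
    using L_ge by (intro add_left_mono mult_left_mono) (auto simp: D_def)
  also have "\<dots> \<le> T k" by (rule T_ge)
  finally have T: "m * ln a \<le> T k" .
  have "m \<le> m + (T k - m * ln a)" using T by simp
  also have "\<dots> = (\<Sum>u\<in>S. \<Sum>v\<in>N u. 1 + (ln (real (branch_count N k u v)) - ln a))"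
    by (simp add: m_def T_def sum.distrib sum_subtractf sum_distrib_right)
  also have "\<dots> \<le> (\<Sum>u\<in>S. \<Sum>v\<in>N u. real (branch_count N k u v) / a)"
  proof (intro sum_mono)
    fix u v assume "u \<in> S" "v \<in> N u"
    then have p: "real (branch_count N k u v) > 0" using branch_count_pos[of v k u] subN[of u] by auto
    then have "ln (real (branch_count N k u v) / a) \<le> real (branch_count N k u v) / a - 1"
      using a by (intro ln_le_minus_one) auto
    then show "1 + (ln (real (branch_count N k u v)) - ln a) \<le> real (branch_count N k u v) / a"
      using p a by (simp add: ln_div)
  qed
  also have "\<dots> = (\<Sum>u\<in>S. \<Sum>v\<in>N u. real (branch_count N k u v)) / a"
    by (simp add: sum_divide_distrib)
  finally show ?thesis using a by (simp add: field_simps a_def D_def)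
qed

end

section \<open>Reduction to minimum degree two\<close>

text \<open>The sum of degree minus 2 is twice the number of edges minus twice the number of
  vertices. Deleting a vertex of degree \<open>d\<close> changes it by \<open>2 - 2 d\<close>, which
  is no loss for \<open>d \<le> 1\<close>; so a smallest subset that keeps the sum has minimum
  degree two, and positivity of the sum keeps it nonempty.\<close>

lemma exists_min_degree_two_subset:
  fixes N :: "'v \<Rightarrow> 'v set"
  assumes fin: "finite V" and sub: "\<And>v. v \<in> V \<Longrightarrow> N v \<subseteq> V"
    and sym: "\<And>u v. u \<in> N v \<Longrightarrow> v \<in> N u" and irr: "\<And>v. v \<notin> N v"
    and pos: "(\<Sum>v\<in>V. int (card (N v)) - 2) > 0"
  obtains S where "S \<subseteq> V" "S \<noteq> {}" "\<And>v. v \<in> S \<Longrightarrow> card (N v \<inter> S) \<ge> 2"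
    "(\<Sum>v\<in>S. int (card (N v \<inter> S)) - 2) \<ge> (\<Sum>v\<in>V. int (card (N v)) - 2)"
proof -
  define e where "e S = (\<Sum>v\<in>S. int (card (N v \<inter> S)) - 2)" for S
  define D where "D = (\<Sum>v\<in>V. int (card (N v)) - 2)"
  have eV: "e V = D" unfolding e_def D_def using sub by (intro sum.cong) (auto simp: Int_absorb2)
  define P where "P S \<longleftrightarrow> S \<subseteq> V \<and> e S \<ge> D" for S
  have "P V" using eV by (simp add: P_def)
  then obtain S where S: "P S" and min: "\<And>S'. P S' \<Longrightarrow> card S \<le> card S'"
    using exists_least_iff[of "\<lambda>n. \<exists>S. P S \<and> card S = n"] by (metis not_le_imp_less)
  have finS: "finite S" using S fin finite_subset by (auto simp: P_def)
  have "card (N v \<inter> S) \<ge> 2" if v: "v \<in> S" for v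
  proof (rule ccontr)
    assume "\<not> 2 \<le> card (N v \<inter> S)"
    then have d: "card (N v \<inter> S) \<le> 1" by simp
    let ?S = "S - {v}"
    have eq: "int (card (N u \<inter> ?S)) = int (card (N u \<inter> S)) - (if u \<in> N v then 1 else 0)" for u
    proof (cases "u \<in> N v")
      case True
      then have "v \<in> N u \<inter> S" using v sym by auto
      moreover have "N u \<inter> ?S = (N u \<inter> S) - {v}" by auto
      ultimately show ?thesis using True finS card_Suc_Diff1[of "N u \<inter> S" v] by simp
    next
      case False
      then have "N u \<inter> ?S = N u \<inter> S" using sym by auto
      then show ?thesis using False by simp
    qed
    have "e ?S = (\<Sum>u\<in>?S. int (card (N u \<inter> S)) - 2) - (\<Sum>u\<in>?S. if u \<in> N v then 1 else 0)"
      unfolding e_def eq by (simp add: sum_subtractf)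
    also have "(\<Sum>u\<in>?S. int (card (N u \<inter> S)) - 2) = e S - (int (card (N v \<inter> S)) - 2)"
      unfolding e_def using finS v by (simp add: sum_diff1)
    also have "(\<Sum>u\<in>?S. if u \<in> N v then 1 else 0 :: int) = int (card (N v \<inter> S))"
    proof -
      have "(\<Sum>u\<in>?S. if u \<in> N v then 1 else 0 :: int) = int (card (?S \<inter> N v))"
        using finS by (simp add: sum.If_cases Int_def)
      moreover have "?S \<inter> N v = N v \<inter> S" using irr by auto
      ultimately show ?thesis by simp
    qed
    finally have "e ?S \<ge> e S" using d by simp
    then have "P ?S" using S by (auto simp: P_def)
    then have "card S \<le> card ?S" by (rule min)
    then show False using card_Diff1_less[OF finS v] by simp
  qed
  moreover have "S \<noteq> {}" using S pos by (auto simp: P_def e_def D_def)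
  ultimately show ?thesis using that[of S] S by (auto simp: P_def e_def D_def)
qed

text \<open>The subset \<open>S\<close> has no more vertices than \<open>V\<close> but at least the
  same excess of degrees over 2. Hence its mean degree is at least \<open>d\<close>, and it retains
  at least \<open>card V * (d - 2)\<close> directed edges, whence the prefactor.\<close>

lemma branch_count_sum_ge_average_degree:
  fixes N :: "'v \<Rightarrow> 'v set"
  assumes fin: "finite V" and sub: "\<And>v. v \<in> V \<Longrightarrow> N v \<subseteq> V"
    and sym: "\<And>u v. u \<in> N v \<Longrightarrow> v \<in> N u" and irr: "\<And>v. v \<notin> N v"
    and out: "\<And>v. v \<notin> V \<Longrightarrow> N v = {}"
  defines "d \<equiv> (\<Sum>v\<in>V. real (card (N v))) / card V"
  assumes d: "d > 2"
  shows "real (card V) * (d - 2) * catalan k * (d - 1) ^ k \<le> (\<Sum>u\<in>V. \<Sum>v\<in>N u. real (branch_count N k u v))"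
proof -
  have n: "real (card V) > 0" using d by (cases "card V = 0") (auto simp: d_def)
  have D: "real_of_int (\<Sum>v\<in>V. int (card (N v)) - 2) = card V * (d - 2)"
    using n by (simp add: d_def sum_subtractf field_simps)
  then have "real_of_int (\<Sum>v\<in>V. int (card (N v)) - 2) > 0" using n d by simp
  then have "(\<Sum>v\<in>V. int (card (N v)) - 2) > 0" by linarith
  from exists_min_degree_two_subset[OF fin sub sym irr this]
  obtain S where S: "S \<subseteq> V" "S \<noteq> {}" "\<And>v. v \<in> S \<Longrightarrow> card (N v \<inter> S) \<ge> 2"
    "(\<Sum>v\<in>S. int (card (N v \<inter> S)) - 2) \<ge> (\<Sum>v\<in>V. int (card (N v)) - 2)"
    by blast
  define N' where "N' v = (if v \<in> S then N v \<inter> S else {})" for v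
  interpret min_degree_two S N'
    using S fin finite_subset sym by unfold_locales (auto simp: N'_def split: if_splits)
  have s: "real (card S) > 0" using finS ne by (simp add: card_gt_0_iff)
  have sn: "card S \<le> card V" using S fin by (simp add: card_mono)
  have "m - 2 * card S = real_of_int (\<Sum>v\<in>S. int (card (N v \<inter> S)) - 2)"
    unfolding m_def by (simp add: N'_def sum_subtractf)
  also have "\<dots> \<ge> real_of_int (\<Sum>v\<in>V. int (card (N v)) - 2)" using S(4) by linarith
  finally have mD: "m - 2 * card S \<ge> card V * (d - 2)" by (simp only: D)
  have "card S * (d - 2) \<le> card V * (d - 2)" using sn d by (intro mult_right_mono) auto
  with mD have "card S * d \<le> m" by (simp add: algebra_simps)
  then have dd: "d - 1 \<le> m / card S - 1" using s by (simp add: field_simps)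
  have "real (card V) * (d - 2) * catalan k * (d - 1) ^ k = (card V * (d - 2)) * (catalan k * (d - 1) ^ k)"
    by simp
  also have "\<dots> \<le> m * (catalan k * (m / card S - 1) ^ k)"
  proof (intro mult_mono power_mono)
    have "0 \<le> card V * (d - 2)" using d by simp
    with mD show "0 \<le> m" "card V * (d - 2) \<le> m" by linarith+
  qed (use d dd in auto)
  also have "\<dots> \<le> (\<Sum>u\<in>S. \<Sum>v\<in>N' u. real (branch_count N' k u v))"
    by (rule branch_count_sum_ge)
  also have finN: "finite (N u)" for u using sub[of u] out[of u] fin finite_subset by (cases "u \<in> V") auto
  then have "(\<Sum>u\<in>S. \<Sum>v\<in>N' u. real (branch_count N' k u v)) \<le> (\<Sum>u\<in>S. \<Sum>v\<in>N' u. real (branch_count N k u v))"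
    using branch_count_mono[of N N'] finN by (intro sum_mono) (auto simp: N'_def)
  also have "\<dots> \<le> (\<Sum>u\<in>S. \<Sum>v\<in>N u. real (branch_count N k u v))"
    using finN by (intro sum_mono sum_mono2) (auto simp: N'_def)
  also have "\<dots> \<le> (\<Sum>u\<in>V. \<Sum>v\<in>N u. real (branch_count N k u v))"
    using fin S by (intro sum_mono2 sum_nonneg) auto
  finally show ?thesis .
qed

section \<open>Branches along geodesics\<close>

text \<open>If \<open>f i = f (i + 2)\<close>, cutting out the two steps in between gives a shorter
  path.\<close>

lemma shortest_path_nonbacktracking:
  assumes "(u, y) \<in> R ^^ m" and least: "\<And>m'. m' < m \<Longrightarrow> (u, y) \<notin> R ^^ m'"
  obtains f where "f 0 = u" "\<And>i. i < m \<Longrightarrow> (f i, f (Suc i)) \<in> R" 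
    "\<And>i. i + 2 \<le> m \<Longrightarrow> f i \<noteq> f (i + 2)"
proof -
  obtain f where f: "f 0 = u" "f m = y" "\<And>i. i < m \<Longrightarrow> (f i, f (Suc i)) \<in> R"
    using assms(1) by (auto simp: relpow_fun_conv)
  have pow: "(f i, f (i + j)) \<in> R ^^ j" if "i + j \<le> m" for i j
    using f(3) that by (auto simp: relpow_fun_conv intro!: exI[of _ "\<lambda>l. f (i + l)"])
  have "f i \<noteq> f (i + 2)" if i: "i + 2 \<le> m" for i
  proof
    assume eq: "f i = f (i + 2)"
    have "(u, f i) \<in> R ^^ i" using pow[of 0 i] i f by simp
    moreover have "(f i, y) \<in> R ^^ (m - (i + 2))" 
      using pow[of "i + 2" "m - (i + 2)"] i f(2) eq le_add_diff_inverse[OF i] by (metis order_refl)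
    ultimately have "(u, y) \<in> R ^^ (i + (m - (i + 2)))" unfolding relpow_add by blast
    then show False using least[of "i + (m - (i + 2))"] i by auto
  qed
  with f that show ?thesis by blast
qed

text \<open>Each vertex of the path offers its successor as a continuation, so the recursion
  dominates the Catalan recursion as long as \<open>k\<close> further steps remain beyond the
  edge.\<close>

lemma branch_count_along_path:
  assumes fin: "\<And>x. finite (N x)"
    and f: "\<And>i. i < m \<Longrightarrow> f (Suc i) \<in> N (f i)" "\<And>i. i + 2 \<le> m \<Longrightarrow> f i \<noteq> f (i + 2)"
  shows "j + 1 + k \<le> m \<Longrightarrow> catalan k \<le> branch_count N k (f j) (f (Suc j))"
proof (induction k arbitrary: j rule: less_induct)
  case (less k)
  show ?case
  proof (cases k)
    case (Suc k')
    have "catalan k \<le> (\<Sum>i\<le>k'. catalan i * catalan (k' - i))" using Suc by simp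
    also have "\<dots> \<le> (\<Sum>i\<le>k'. (\<Sum>w\<in>N (f (Suc j)) - {f j}. branch_count N i (f (Suc j)) w) * 
        branch_count N (k' - i) (f j) (f (Suc j)))"
    proof (intro sum_mono mult_mono)
      fix i assume "i \<in> {..k'}"
      then have i: "i \<le> k'" by simp
      have "catalan i \<le> branch_count N i (f (Suc j)) (f (Suc (Suc j)))"
        using less.IH[of i "Suc j"] less.prems i Suc by simp
      also have "\<dots> \<le> (\<Sum>w\<in>N (f (Suc j)) - {f j}. branch_count N i (f (Suc j)) w)"
        using f(1)[of "Suc j"] f(2)[of j] less.prems Suc fin by (intro member_le_sum) auto
      finally show "catalan i \<le> (\<Sum>w\<in>N (f (Suc j)) - {f j}. branch_count N i (f (Suc j)) w)" .
      show "catalan (k' - i) \<le> branch_count N (k' - i) (f j) (f (Suc j))"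
        using less.IH[of "k' - i" j] less.prems Suc by simp
    qed auto
    finally show ?thesis using Suc by simp
  qed auto
qed

lemma card_relpow_image_le:
  fixes R :: "('v \<times> 'v) set"
  assumes "\<And>v. finite (R `` {v})" "\<And>v. card (R `` {v}) \<le> \<Delta>"
  shows "finite ((R ^^ i) `` {u}) \<and> card ((R ^^ i) `` {u}) \<le> \<Delta> ^ i"
proof (induction i)
  case (Suc i)
  have eq: "(R ^^ Suc i) `` {u} = (\<Union>v\<in>(R ^^ i) `` {u}. R `` {v})" by auto
  have "card (\<Union>v\<in>(R ^^ i) `` {u}. R `` {v}) \<le> (\<Sum>v\<in>(R ^^ i) `` {u}. card (R `` {v}))"
    using Suc by (intro card_UN_le) auto
  also have "\<dots> \<le> card ((R ^^ i) `` {u}) * \<Delta>"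
    using assms(2) sum_bounded_above[of "(R ^^ i) `` {u}" "\<lambda>v. card (R `` {v})" \<Delta>] by simp
  also have "\<dots> \<le> \<Delta> ^ i * \<Delta>" using Suc by simp
  finally have "card ((R ^^ Suc i) `` {u}) \<le> \<Delta> ^ Suc i" unfolding eq by (simp add: mult.commute)
  then show ?case unfolding eq using Suc assms by auto
qed (auto simp: Image_def)

lemma far_vertex_exists:
  fixes R :: "('v \<times> 'v) set"
  assumes "\<And>v. finite (R `` {v})" "\<And>v. card (R `` {v}) \<le> \<Delta>" 
    and V: "card V > (\<Sum>i\<le>r. \<Delta> ^ i)" "\<And>v. v \<in> V \<Longrightarrow> (u, v) \<in> R\<^sup>*"
  obtains y m where "m > r" "(u, y) \<in> R ^^ m" "\<And>m'. m' < m \<Longrightarrow> (u, y) \<notin> R ^^ m'"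
proof -
  let ?B = "\<Union>i\<le>r. (R ^^ i) `` {u}"
  have b: "finite ((R ^^ i) `` {u})" "card ((R ^^ i) `` {u}) \<le> \<Delta> ^ i" for i
    using card_relpow_image_le[of R \<Delta> i u] assms by auto
  have "card ?B \<le> (\<Sum>i\<le>r. card ((R ^^ i) `` {u}))" by (intro card_UN_le) auto
  also have "\<dots> \<le> (\<Sum>i\<le>r. \<Delta> ^ i)" by (intro sum_mono b)
  finally have "card ?B < card V" using V by simp
  moreover have "finite ?B" using b by auto
  ultimately obtain y where y: "y \<in> V" "y \<notin> ?B" by (metis card_mono not_le subsetI)
  then obtain m0 where "(u, y) \<in> R ^^ m0" using V by (auto simp: rtrancl_power)
  then obtain m where m: "(u, y) \<in> R ^^ m" "\<And>m'. m' < m \<Longrightarrow> (u, y) \<notin> R ^^ m'"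
    using exists_least_iff[of "\<lambda>m. (u, y) \<in> R ^^ m"] by blast
  moreover have "m > r" using y m by (force simp: not_le)
  ultimately show ?thesis using that by blast
qed

section \<open>Singular values of finite graphs\<close>

definition mat_trace :: "'a :: comm_semiring_0 mat \<Rightarrow> 'a" where
  "mat_trace A = (\<Sum>i<dim_row A. A $$ (i, i))"

lemma mat_trace_mult_commute:
  assumes "A \<in> carrier_mat n m" "B \<in> carrier_mat m n"
  shows "mat_trace (A * B) = mat_trace (B * A)"
proof -
  have "mat_trace (A * B) = (\<Sum>i<n. \<Sum>j<m. A $$ (i, j) * B $$ (j, i))"
    using assms by (auto simp: mat_trace_def scalar_prod_def atLeast0LessThan intro!: sum.cong)
  also have "\<dots> = (\<Sum>j<m. \<Sum>i<n. B $$ (j, i) * A $$ (i, j))"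
    by (subst sum.swap) (simp add: mult.commute)
  also have "\<dots> = mat_trace (B * A)"
    using assms by (auto simp: mat_trace_def scalar_prod_def atLeast0LessThan intro!: sum.cong)
  finally show ?thesis .
qed

lemma upper_triangular_pow:
  fixes B :: "'a :: comm_ring_1 mat"
  assumes B: "B \<in> carrier_mat n n" "upper_triangular B"
  shows "upper_triangular (B ^\<^sub>m k) \<and> (\<forall>i<n. (B ^\<^sub>m k) $$ (i, i) = (B $$ (i, i)) ^ k)"
proof (induction k)
  case 0
  then show ?case using B by (auto simp: upper_triangular_def)
next
  case (Suc k)
  have C: "B ^\<^sub>m k \<in> carrier_mat n n" using B by simp
  have entry: "(B ^\<^sub>m Suc k) $$ (i, j) = (\<Sum>l<n. (B ^\<^sub>m k) $$ (i, l) * B $$ (l, j))" if "i < n" "j < n" for i j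
    using that B C by (simp add: scalar_prod_def atLeast0LessThan)
  have z: "(B ^\<^sub>m k) $$ (i, l) * B $$ (l, j) = 0" if "i < n" "l < n" "l < i \<or> j < l" for i j l
    using that Suc B C unfolding upper_triangular_def by auto
  have "(B ^\<^sub>m Suc k) $$ (i, j) = 0" if "i < n" "j < i" for i j
    unfolding entry[OF that(1) less_trans[OF that(2,1)]] using z that
    by (intro sum.neutral) (metis lessThan_iff linorder_neqE_nat order.strict_trans)
  moreover have "(B ^\<^sub>m Suc k) $$ (i, i) = (B $$ (i, i)) ^ Suc k" if "i < n" for i
  proof -
    have "(\<Sum>l<n. (B ^\<^sub>m k) $$ (i, l) * B $$ (l, i)) = (\<Sum>l\<in>{i}. (B ^\<^sub>m k) $$ (i, l) * B $$ (l, i))"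
      using that z[of i _ i] by (intro sum.mono_neutral_right) (auto simp: neq_iff)
    then show ?thesis using entry[OF that that] Suc that by (simp add: mult.commute)
  qed
  ultimately show ?case using B C by (auto simp: upper_triangular_def)
qed

text \<open>The Schur form is triangular, so the diagonal of its power consists of powers of
  eigenvalues, listed with their algebraic multiplicities; the trace is invariant under the
  similarity.\<close>

lemma mat_trace_pow_eq_sum_eigenvalues:
  fixes A :: "complex mat"
  assumes A: "A \<in> carrier_mat n n"
  shows "mat_trace (A ^\<^sub>m k) = (\<Sum>x\<in>#proots (char_poly A). x ^ k)"
proof -
  obtain es where es: "char_poly A = (\<Prod>e\<leftarrow>es. [:- e, 1:])" 
    using char_poly_factorized[OF A] by blast
  obtain B P Q where BPQ: "schur_decomposition A es = (B, P, Q)" by (metis surj_pair)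
  from schur_decomposition[OF A es BPQ]
  have wit: "similar_mat_wit A B P Q" and ut: "upper_triangular B" and diag: "diag_mat B = es" by auto
  have car: "B \<in> carrier_mat n n" "P \<in> carrier_mat n n" "Q \<in> carrier_mat n n" "Q * P = 1\<^sub>m n"
    using wit A by (auto simp: similar_mat_wit_def Let_def)
  have Bk: "B ^\<^sub>m k \<in> carrier_mat n n" using car by simp
  have "mat_trace (A ^\<^sub>m k) = mat_trace (P * (B ^\<^sub>m k * Q))"
    using similar_mat_wit_pow_id[OF wit, of k] car Bk by (simp add: assoc_mult_mat[of P n n "B ^\<^sub>m k" n Q n])
  also have "\<dots> = mat_trace (B ^\<^sub>m k * Q * P)"
    using car Bk by (intro mat_trace_mult_commute) auto
  also have "B ^\<^sub>m k * Q * P = B ^\<^sub>m k" using car Bk by (simp add: assoc_mult_mat[of "B ^\<^sub>m k" n n Q n P n])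
  also have "mat_trace (B ^\<^sub>m k) = (\<Sum>i<n. (B $$ (i, i)) ^ k)"
    using upper_triangular_pow[OF car(1) ut, of k] car by (simp add: mat_trace_def)
  also have "\<dots> = (\<Sum>e\<leftarrow>es. e ^ k)"
    using car unfolding diag[symmetric] diag_mat_def 
    by (simp add: interv_sum_list_conv_sum_set_nat atLeast0LessThan comp_def)
  also have "\<dots> = (\<Sum>x\<in>#mset es. x ^ k)"
    by (simp flip: sum_mset_sum_list)
  also have "mset es = proots (char_poly A)"
  proof -
    have "(0 :: complex poly) \<notin> set (map (\<lambda>e. [:- e, 1:]) es)" by auto
    from proots_prod_list[OF this] show ?thesis 
      unfolding es by (simp add: comp_def)
  qed
  finally show ?thesis .
qed

text \<open>Read the eigenvalue equation at a coordinate \<open>i\<close> where the eigenvector has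
  maximal modulus.\<close>

lemma proots_char_poly_norm_le:
  fixes A :: "complex mat"
  assumes A: "A \<in> carrier_mat n n" and row: "\<And>i. i < n \<Longrightarrow> (\<Sum>j<n. cmod (A $$ (i, j))) \<le> D"
    and x: "x \<in># proots (char_poly A)"
  shows "cmod x \<le> D"
proof -
  have "char_poly A \<noteq> 0" using degree_monic_char_poly[OF A] by auto
  then have "poly (char_poly A) x = 0" using x by simp
  then have "eigenvalue A x" using eigenvalue_root_char_poly[OF A] by simp
  then obtain v where v: "v \<in> carrier_vec n" "v \<noteq> 0\<^sub>v n" "A *\<^sub>v v = x \<cdot>\<^sub>v v"
    using A by (auto simp: eigenvalue_def eigenvector_def)
  have n: "n > 0" using v by (cases n) auto
  let ?c = "(\<lambda>j. cmod (v $ j)) ` {..<n}"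
  have "Max ?c \<in> ?c" using n by (intro Max_in) auto
  then obtain i where i: "i < n" "cmod (v $ i) = Max ?c" by auto
  then have max: "cmod (v $ j) \<le> cmod (v $ i)" if "j < n" for j using that by simp
  have "v $ i \<noteq> 0"
  proof
    assume "v $ i = 0"
    then have "v = 0\<^sub>v n" using max v by (intro eq_vecI) force+
    then show False using v by simp
  qed
  have "cmod x * cmod (v $ i) = cmod ((A *\<^sub>v v) $ i)" using v i by (simp add: norm_mult)
  also have "(A *\<^sub>v v) $ i = (\<Sum>j<n. A $$ (i, j) * v $ j)"
    using A v(1) i by (simp add: scalar_prod_def atLeast0LessThan)
  also have "cmod \<dots> \<le> (\<Sum>j<n. cmod (A $$ (i, j)) * cmod (v $ i))"
    using max by (intro sum_norm_le) (auto simp: norm_mult intro!: mult_left_mono)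
  also have "\<dots> \<le> D * cmod (v $ i)"
    using row[OF i(1)] by (simp flip: sum_distrib_right add: mult_right_mono)
  finally show ?thesis using \<open>v $ i \<noteq> 0\<close> by simp
qed

section \<open>Adjacency matrices and singular values\<close>

lemma simple_graph_nbrs:
  assumes "simple_graph G"
  shows "nbrs G v \<subseteq> verts G" "v \<notin> nbrs G v" "u \<in> nbrs G v \<Longrightarrow> v \<in> nbrs G u"
    "v \<notin> verts G \<Longrightarrow> nbrs G v = {}"
  using assms by (auto simp: simple_graph_def nbrs_def sym_def irrefl_def)

lemma walk_count_Suc_right:
  assumes "\<And>u v. u \<in> N v \<Longrightarrow> v \<in> N u" and fin: "\<And>v. finite (N v)"
  shows "walk_count N (Suc t) x y = (\<Sum>z\<in>N y. walk_count N t x z)"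
proof (induction t arbitrary: x)
  case 0
  have "(\<Sum>z\<in>N x. of_bool (z = y)) = (of_bool (y \<in> N x) :: nat)"
    using fin[of x] by (simp add: of_bool_def if_distrib sum.If_cases Int_def conj_commute)
  moreover have "(\<Sum>z\<in>N y. of_bool (x = z)) = (of_bool (x \<in> N y) :: nat)"
    using fin[of y] by (simp add: of_bool_def if_distrib sum.If_cases Int_def conj_commute)
  ultimately show ?case using assms(1)[of x y] assms(1)[of y x] by auto
next
  case (Suc t)
  have "walk_count N (Suc (Suc t)) x y = (\<Sum>z\<in>N x. \<Sum>z'\<in>N y. walk_count N t z z')"
    using Suc by (simp only: walk_count.simps)
  also have "\<dots> = (\<Sum>z'\<in>N y. \<Sum>z\<in>N x. walk_count N t z z')" by (rule sum.swap)
  finally show ?case by simp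
qed

text \<open>The enumeration behind \<open>adjacency_matrix\<close> is an arbitrary choice. All facts
  that refer to it are proved together, and what leaves this proof no longer mentions
  \<open>vs\<close>.\<close>

lemma adjacency_matrix_pow_trace:
  assumes G: "simple_graph G" "finite (verts G)"
  defines "n \<equiv> card (verts G)"
  shows "adjacency_matrix G \<in> carrier_mat n n"
    and "mat_trace (adjacency_matrix G ^\<^sub>m t) = of_nat (\<Sum>v\<in>verts G. walk_count (nbrs G) t v v)"
    and "i < n \<Longrightarrow> \<exists>v\<in>verts G. (\<Sum>l<n. cmod (adjacency_matrix G $$ (i, l))) = card (nbrs G v)"
proof -
  define vs where "vs = (SOME vs. distinct vs \<and> set vs = verts G)"
  let ?A = "adjacency_matrix G"
  have vs: "distinct vs" "set vs = verts G" 
    using finite_distinct_list[OF G(2)] someI_ex[of "\<lambda>vs. distinct vs \<and> set vs = verts G"] 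
    unfolding vs_def by blast+
  have len: "length vs = n" using vs distinct_card[of vs] by (simp add: n_def)
  have A: "?A = mat n n (\<lambda>(i, j). if (vs ! i, vs ! j) \<in> adj G then 1 else 0)"
    by (simp add: adjacency_matrix_def vs_def n_def Let_def)
  show car: "?A \<in> carrier_mat n n" by (simp add: A)
  have bij: "bij_betw ((!) vs) {..<n} (verts G)"
    using bij_betw_nth[OF vs(1), of "{..<n}" "verts G"] vs len by simp
  have fin: "finite (nbrs G v)" for v using simple_graph_nbrs(1)[OF G(1)] G(2) finite_subset by blast
  have entry: "i < n \<Longrightarrow> j < n \<Longrightarrow> (?A ^\<^sub>m t) $$ (i, j) = of_nat (walk_count (nbrs G) t (vs ! i) (vs ! j))" for i j t
  proof (induction t arbitrary: j)
    case 0
    then show ?case using car vs len by (auto simp: nth_eq_iff_index_eq)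
  next
    case (Suc t)
    have "(?A ^\<^sub>m Suc t) $$ (i, j) = (\<Sum>l<n. (?A ^\<^sub>m t) $$ (i, l) * ?A $$ (l, j))"
      using Suc.prems car pow_carrier_mat[OF car, of t] 
      by (simp add: scalar_prod_def atLeast0LessThan)
    also have "\<dots> = (\<Sum>l<n. of_nat (walk_count (nbrs G) t (vs ! i) (vs ! l)) * (if (vs ! l, vs ! j) \<in> adj G then 1 else 0))"
      using Suc by (intro sum.cong) (auto simp: A)
    also have "\<dots> = (\<Sum>z\<in>verts G. of_nat (walk_count (nbrs G) t (vs ! i) z) * (if (z, vs ! j) \<in> adj G then 1 else 0))"
      by (rule sum.reindex_bij_betw[OF bij])
    also have "\<dots> = (\<Sum>z\<in>nbrs G (vs ! j). of_nat (walk_count (nbrs G) t (vs ! i) z))"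
      using G simple_graph_nbrs[OF G(1), of "vs ! j"]
      by (intro sum.mono_neutral_cong_right) (auto simp: nbrs_def simple_graph_def sym_def)
    also have "\<dots> = of_nat (walk_count (nbrs G) (Suc t) (vs ! i) (vs ! j))"
      using walk_count_Suc_right[of "nbrs G" t "vs ! i" "vs ! j"] simple_graph_nbrs[OF G(1)] fin by simp
    finally show ?case .
  qed
  have "mat_trace (?A ^\<^sub>m t) = (\<Sum>i<n. of_nat (walk_count (nbrs G) t (vs ! i) (vs ! i)))"
    using car entry by (simp add: mat_trace_def)
  also have "\<dots> = (\<Sum>v\<in>verts G. of_nat (walk_count (nbrs G) t v v))"
    by (rule sum.reindex_bij_betw[OF bij])
  finally show "mat_trace (?A ^\<^sub>m t) = of_nat (\<Sum>v\<in>verts G. walk_count (nbrs G) t v v)" by simp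
  show "\<exists>v\<in>verts G. (\<Sum>l<n. cmod (?A $$ (i, l))) = card (nbrs G v)" if i: "i < n"
  proof
    show "vs ! i \<in> verts G" using i len vs nth_mem by blast
    have "(\<Sum>l<n. cmod (?A $$ (i, l))) = (\<Sum>l<n. if (vs ! i, vs ! l) \<in> adj G then 1 else 0)"
      using i by (intro sum.cong) (auto simp: A)
    also have "\<dots> = (\<Sum>z\<in>verts G. if (vs ! i, z) \<in> adj G then 1 else 0)"
      by (rule sum.reindex_bij_betw[OF bij])
    also have "\<dots> = (\<Sum>z\<in>nbrs G (vs ! i). 1)"
      using G simple_graph_nbrs(1)[OF G(1), of "vs ! i"]
      by (intro sum.mono_neutral_cong_right) (auto simp: nbrs_def)
    finally show "(\<Sum>l<n. cmod (?A $$ (i, l))) = card (nbrs G (vs ! i))" by simp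
  qed
qed

text \<open>In decreasing order the first \<open>j\<close> entries are bounded by \<open>D\<close>,
  and every later one by the entry at index \<open>j - 1\<close>.\<close>

lemma sum_power_le_nth_largest:
  fixes M :: "real multiset" and \<sigma> :: real
  assumes M: "\<And>x. x \<in># M \<Longrightarrow> 0 \<le> x \<and> x \<le> D" and j: "1 \<le> j" "j \<le> size M"
  defines "\<sigma> \<equiv> rev (sorted_list_of_multiset M) ! (j - 1)"
  shows "(\<Sum>x\<in>#M. x ^ p) \<le> j * D ^ p + size M * \<sigma> ^ p" "\<sigma> \<ge> 0"
proof -
  define xs where "xs = rev (sorted_list_of_multiset M)"
  have mset: "mset xs = M" by (simp add: xs_def)
  have len: "length xs = size M" using mset size_mset by metis
  have set: "set xs = set_mset M" using mset set_mset_mset by metis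
  have srt: "xs ! b \<le> xs ! a" if "a \<le> b" "b < size M" for a b
    using that len sorted_rev_nth_mono[of xs a b] by (simp add: xs_def)
  have \<sigma>: "\<sigma> = xs ! (j - 1)" by (simp add: \<sigma>_def xs_def)
  have bd: "0 \<le> xs ! i" "xs ! i \<le> D" if "i < size M" for i
    using M[of "xs ! i"] nth_mem[of i xs] that len set by auto
  show s0: "\<sigma> \<ge> 0" using bd j by (simp add: \<sigma>)
  have D: "D \<ge> 0" using bd[of 0] j by linarith
  have "(\<Sum>x\<in>#M. x ^ p) = (\<Sum>x\<leftarrow>xs. x ^ p)" by (simp flip: mset sum_mset_sum_list)
  also have "\<dots> = (\<Sum>i<size M. (xs ! i) ^ p)"
    by (simp add: sum_list_sum_nth len atLeast0LessThan)
  also have "\<dots> \<le> (\<Sum>i<size M. (if i < j then D ^ p else 0) + \<sigma> ^ p)"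
  proof (intro sum_mono)
    fix i assume "i \<in> {..<size M}"
    then have i: "i < size M" by simp
    show "(xs ! i) ^ p \<le> (if i < j then D ^ p else 0) + \<sigma> ^ p"
    proof (cases "i < j")
      case True
      then show ?thesis using bd[OF i] s0 power_mono[of "xs ! i" D p] by (simp add: add_increasing2)
    next
      case False
      then show ?thesis using bd[OF i] srt[of "j - 1" i] i by (simp add: \<sigma> power_mono)
    qed
  qed
  also have "\<dots> = j * D ^ p + size M * \<sigma> ^ p"
  proof -
    have "{..<size M} \<inter> {i. i < j} = {..<j}" using j by auto
    then show ?thesis by (simp add: sum.distrib sum.If_cases)
  qed
  finally show "(\<Sum>x\<in>#M. x ^ p) \<le> j * D ^ p + size M * \<sigma> ^ p" .
qed

lemma norm_sum_mset_le:
  fixes f :: "'a \<Rightarrow> 'b :: real_normed_vector"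
  shows "norm (\<Sum>x\<in>#P. f x) \<le> (\<Sum>x\<in>#P. norm (f x))"
  by (induction P) (auto intro: norm_triangle_le)

lemma closed_walks_le_singular_value:
  assumes G: "simple_graph G" "finite (verts G)" and deg: "\<And>v. v \<in> verts G \<Longrightarrow> card (nbrs G v) \<le> \<Delta>"
    and j: "1 \<le> j" "j \<le> card (verts G)"
  shows "real (\<Sum>v\<in>verts G. walk_count (nbrs G) t v v) \<le> 
      j * real \<Delta> ^ t + card (verts G) * graph_singular_value j G ^ t" (is ?A)
    and "graph_singular_value j G \<ge> 0" (is ?B)
proof -
  let ?A = "adjacency_matrix G" and ?n = "card (verts G)"
  let ?P = "proots (char_poly ?A)"
  note A = adjacency_matrix_pow_trace[OF G]
  have size: "size ?P = ?n" using degree_monic_char_poly[OF A(1)] by (simp add: size_proots_complex)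
  have norm: "cmod x \<le> real \<Delta>" if "x \<in># ?P" for x
  proof (rule proots_char_poly_norm_le[OF A(1) _ that])
    fix i assume "i < ?n"
    from A(3)[OF this] show "(\<Sum>l<?n. cmod (?A $$ (i, l))) \<le> real \<Delta>" using deg by auto
  qed
  have "real (\<Sum>v\<in>verts G. walk_count (nbrs G) t v v) = cmod (mat_trace (?A ^\<^sub>m t))"
    by (simp only: A(2) norm_of_nat)
  also have "\<dots> = cmod (\<Sum>x\<in>#?P. x ^ t)" by (simp add: mat_trace_pow_eq_sum_eigenvalues[OF A(1)])
  also have "\<dots> \<le> (\<Sum>x\<in>#?P. cmod (x ^ t))"
    by (rule norm_sum_mset_le)
  also have "\<dots> = (\<Sum>y\<in>#image_mset cmod ?P. y ^ t)" by (simp add: norm_power multiset.map_comp comp_def)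
  finally have 1: "real (\<Sum>v\<in>verts G. walk_count (nbrs G) t v v) \<le> (\<Sum>y\<in>#image_mset cmod ?P. y ^ t)" .
  have M: "0 \<le> y \<and> y \<le> real \<Delta>" if "y \<in># image_mset cmod ?P" for y using that norm by auto
  have "j \<le> size (image_mset cmod ?P)" using j size by simp
  from sum_power_le_nth_largest(1)[OF M j(1) this, of t] 1
  show "real (\<Sum>v\<in>verts G. walk_count (nbrs G) t v v) \<le> 
      j * real \<Delta> ^ t + card (verts G) * graph_singular_value j G ^ t"
    by (simp add: graph_singular_value_def size)
  from sum_power_le_nth_largest(2)[OF M j(1) \<open>j \<le> size (image_mset cmod ?P)\<close>]
  show ?B by (simp add: graph_singular_value_def)
qed

text \<open>A branch at \<open>(u, v)\<close> projects to closed walks at the head \<open>v\<close>,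
  and each vertex is the head of at most \<Delta> directed edges.\<close>

lemma branch_counts_le_closed_walks:
  assumes G: "simple_graph G" "finite (verts G)" and deg: "\<And>v. v \<in> verts G \<Longrightarrow> card (nbrs G v) \<le> \<Delta>"
  shows "(\<Sum>u\<in>verts G. \<Sum>v\<in>nbrs G u. real (branch_count (nbrs G) k u v)) 
    \<le> \<Delta> * real (\<Sum>v\<in>verts G. walk_count (nbrs G) (2 * k) v v)"
proof -
  let ?N = "nbrs G" and ?V = "verts G"
  note N = simple_graph_nbrs[OF G(1)]
  have fin: "finite (?N v)" for v using N(1) G(2) finite_subset by blast
  have sel: "?N u = {v \<in> ?V. v \<in> ?N u}" "?N u = {v \<in> ?V. u \<in> ?N v}" for u using N by blast+
  have "(\<Sum>u\<in>?V. \<Sum>v\<in>?N u. real (branch_count ?N k u v)) \<le> (\<Sum>u\<in>?V. \<Sum>v\<in>?N u. real (walk_count ?N (2 * k) v v))"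
    using fin N by (intro sum_mono of_nat_mono branch_count_le_walk_count) auto
  also have "\<dots> = (\<Sum>u\<in>?V. \<Sum>v | v \<in> ?V \<and> v \<in> ?N u. real (walk_count ?N (2 * k) v v))"
    by (subst sel(1)) simp
  also have "\<dots> = (\<Sum>v\<in>?V. \<Sum>u | u \<in> ?V \<and> v \<in> ?N u. real (walk_count ?N (2 * k) v v))"
    by (rule sum.swap_restrict[OF G(2) G(2)])
  also have "\<dots> = (\<Sum>v\<in>?V. card (?N v) * real (walk_count ?N (2 * k) v v))"
    by (subst (2) sel(2)) simp
  also have "\<dots> \<le> (\<Sum>v\<in>?V. \<Delta> * real (walk_count ?N (2 * k) v v))"
    using deg by (intro sum_mono mult_right_mono) auto
  finally show ?thesis by (simp add: sum_distrib_left)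
qed

text \<open>Covers average degrees up to about 2, where the degree excess gives nothing: in a large
  connected graph of bounded degree a geodesic longer than \<open>k + 1\<close> leaves every vertex.
  Growth rate 4 corresponds to singular value 2, the value of 2 sqrt (d - 1) at
  \<open>d = 2\<close>.\<close>

lemma branch_counts_ge_catalan:
  assumes G: "simple_graph G" "finite (verts G)" "connected_graph G" 
    and deg: "\<And>v. v \<in> verts G \<Longrightarrow> card (nbrs G v) \<le> \<Delta>"
    and large: "card (verts G) > (\<Sum>i\<le>Suc k. \<Delta> ^ i)"
  shows "real (card (verts G)) * catalan k \<le> (\<Sum>u\<in>verts G. \<Sum>v\<in>nbrs G u. real (branch_count (nbrs G) k u v))"
proof -
  let ?N = "nbrs G" and ?V = "verts G"
  note N = simple_graph_nbrs[OF G(1)]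
  have fin: "finite (?N v)" for v using N(1) G(2) finite_subset by blast
  have R: "finite (adj G `` {v})" "card (adj G `` {v}) \<le> \<Delta>" for v
    using fin[of v] deg[of v] N(4)[of v] by (cases "v \<in> ?V"; simp add: nbrs_def)+
  have "real (catalan k) \<le> (\<Sum>v\<in>?N u. real (branch_count ?N k u v))" if u: "u \<in> ?V" for u
  proof -
    have "(u, v) \<in> (adj G)\<^sup>*" if "v \<in> ?V" for v using G(3) u that by (auto simp: connected_graph_def)
    from far_vertex_exists[OF R large this] obtain y m where m: "m > Suc k" "(u, y) \<in> adj G ^^ m"
      "\<And>m'. m' < m \<Longrightarrow> (u, y) \<notin> adj G ^^ m'" by blast
    from shortest_path_nonbacktracking[OF m(2,3)] obtain f where f: "f 0 = u" 
      "\<And>i. i < m \<Longrightarrow> (f i, f (Suc i)) \<in> adj G" "\<And>i. i + 2 \<le> m \<Longrightarrow> f i \<noteq> f (i + 2)" by blast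
    have "catalan k \<le> branch_count ?N k (f 0) (f (Suc 0))"
      using m f(2,3) fin by (intro branch_count_along_path[where m = m]) (auto simp: nbrs_def)
    also have "\<dots> \<le> (\<Sum>v\<in>?N u. branch_count ?N k u v)"
      using f(1) f(2)[of 0] m(1) fin unfolding f(1) by (intro member_le_sum) (auto simp: nbrs_def)
    finally show ?thesis by (simp flip: of_nat_sum)
  qed
  then have "(\<Sum>u\<in>?V. real (catalan k)) \<le> (\<Sum>u\<in>?V. \<Sum>v\<in>?N u. real (branch_count ?N k u v))"
    by (rule sum_mono)
  then show ?thesis by simp
qed

section \<open>The lower bound for finite graphs\<close>

text \<open>The threshold \<open>n0\<close> depends on \<epsilon>, \<Delta> and \<open>j\<close>
  only, so the bound holds termwise along the sequence and passes to the lower limits.\<close>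

lemma graph_singular_value_lower_bound:
  fixes \<epsilon> :: real and \<Delta> j :: nat
  assumes \<epsilon>: "\<epsilon> > 0" and j: "j \<ge> 1"
  shows "\<exists>n0. \<forall>G :: 'v ugraph. simple_graph G \<longrightarrow> finite (verts G) \<longrightarrow> connected_graph G \<longrightarrow> 
    (\<forall>v\<in>verts G. card (nbrs G v) \<le> \<Delta>) \<longrightarrow> card (verts G) \<ge> n0 \<longrightarrow>
    graph_singular_value j G \<ge> 2 * sqrt (average_degree G - 1) - \<epsilon>"
proof (cases "\<Delta> = 0")
  case True
  show ?thesis
  proof (intro exI[of _ j] allI impI)
    fix G :: "'v ugraph" assume G: "simple_graph G" "finite (verts G)" 
      "\<forall>v\<in>verts G. card (nbrs G v) \<le> \<Delta>" "card (verts G) \<ge> j"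
    have "average_degree G = 0" using G True by (simp add: average_degree_def)
    \<comment> \<open>\<open>sqrt\<close> is an odd function, so the right-hand side is negative
      when the average degree is 0.\<close>
    moreover have "graph_singular_value j G \<ge> 0"
      using closed_walks_le_singular_value(2)[OF G(1,2) _ j G(4), of \<Delta>] G by auto
    ultimately show "graph_singular_value j G \<ge> 2 * sqrt (average_degree G - 1) - \<epsilon>" 
      using \<epsilon> by (simp add: real_sqrt_minus)
  qed
next
  case False
  then have \<Delta>: "real \<Delta> \<ge> 1" by simp
  \<comment> \<open>\<delta> is the relative loss in the final bound, \<open>q < 4\<close> the
    growth rate required of the Catalan numbers, \<eta> the margin over average degree two; \<theta>
    collects the factor \<open>min \<eta> 1\<close> from that margin and the
    \<open>1 / \<Delta>\<close> lost in passing from edges to their heads.\<close>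
  define \<delta> where "\<delta> = min 1 (\<epsilon> / (2 * sqrt \<Delta>))"
  define q where "q = (2 - \<delta>)\<^sup>2"
  define \<eta> where "\<eta> = \<epsilon> / 2"
  define \<theta> where "\<theta> = min \<eta> 1 / \<Delta>"
  have \<delta>: "0 < \<delta>" "\<delta> \<le> 1" "\<delta> * sqrt \<Delta> \<le> \<epsilon> / 2"
  proof -
    show "0 < \<delta>" "\<delta> \<le> 1" using \<epsilon> \<Delta> by (auto simp: \<delta>_def)
    have "\<delta> * sqrt \<Delta> \<le> (\<epsilon> / (2 * sqrt \<Delta>)) * sqrt \<Delta>"
      by (intro mult_right_mono) (auto simp: \<delta>_def)
    then show "\<delta> * sqrt \<Delta> \<le> \<epsilon> / 2" using \<Delta> by simp
  qed
  have "\<delta> * 1 \<le> \<delta> * sqrt \<Delta>" using \<delta>(1) \<Delta> by (intro mult_left_mono) auto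
  then have \<delta>': "\<delta> \<le> \<epsilon> / 2" using \<delta>(3) by simp
  have q: "1 \<le> q" "q < 4"
  proof -
    show "1 \<le> q" unfolding q_def using \<delta> by (intro one_le_power) simp
    have "q < 2\<^sup>2" unfolding q_def using \<delta> by (intro power_strict_mono) auto
    then show "q < 4" by simp
  qed
  have \<eta>: "\<eta> > 0" using \<epsilon> by (simp add: \<eta>_def)
  have \<theta>: "0 < \<theta>" "\<theta> \<le> 1" using \<eta> \<Delta> by (auto simp: \<theta>_def field_simps)
  \<comment> \<open>One unit of the surplus factor 2 pays for the first \<open>j\<close>
    eigenvalues, the other remains for the estimate.\<close>
  obtain k where k: "real (catalan k) \<ge> (2 / \<theta>) * q ^ k"
    using catalan_growth[of q "2 / \<theta>"] q by auto
  then have k': "\<theta> * catalan k \<ge> 2 * q ^ k" using \<theta> by (simp add: field_simps)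
  have k0: "k > 0"
  proof (rule ccontr)
    assume "\<not> k > 0"
    then show False using k \<theta> by (simp add: field_simps)
  qed
  \<comment> \<open>The three summands serve the geodesics, the contribution of the first
    \<open>j\<close> eigenvalues, and the existence of a \<open>j\<close>-th one.\<close>
  define n0 where "n0 = Suc (\<Sum>i\<le>Suc k. \<Delta> ^ i) + j * \<Delta> ^ (2 * k) + j"
  show ?thesis
  proof (intro exI[of _ n0] allI impI)
    fix G :: "'v ugraph"
    assume G: "simple_graph G" "finite (verts G)" "connected_graph G" 
      and deg: "\<forall>v\<in>verts G. card (nbrs G v) \<le> \<Delta>" and n0: "card (verts G) \<ge> n0"
    define n where "n = card (verts G)"
    define d where "d = average_degree G"
    define \<sigma> where "\<sigma> = graph_singular_value j G"
    define F where "F = (\<Sum>u\<in>verts G. \<Sum>v\<in>nbrs G u. real (branch_count (nbrs G) k u v))"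
    define W where "W = real (\<Sum>v\<in>verts G. walk_count (nbrs G) (2 * k) v v)"
    have n: "n > (\<Sum>i\<le>Suc k. \<Delta> ^ i)" "j * \<Delta> ^ (2 * k) \<le> n" "j \<le> n" "n > 0"
      using n0 unfolding n0_def n_def by simp_all
    have FW: "F \<le> \<Delta> * W" unfolding F_def W_def
      using branch_counts_le_closed_walks[OF G(1,2), of \<Delta> k] deg by simp
    have W\<sigma>: "W \<le> j * real \<Delta> ^ (2 * k) + n * \<sigma> ^ (2 * k)" and \<sigma>: "\<sigma> \<ge> 0"
      using closed_walks_le_singular_value(1)[OF G(1,2) _ j, of \<Delta> "2 * k"]
        closed_walks_le_singular_value(2)[OF G(1,2) _ j, of \<Delta>] n deg 
      unfolding W_def \<sigma>_def n_def by auto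
    have d\<Delta>: "d \<le> \<Delta>"
    proof -
      have "(\<Sum>v\<in>verts G. real (card (nbrs G v))) \<le> (\<Sum>v\<in>verts G. real \<Delta>)"
        using deg by (intro sum_mono) auto
      then show ?thesis using n by (simp add: d_def average_degree_def n_def field_simps)
    qed
    \<comment> \<open>Used with \<open>b = d - 1\<close> when \<open>d\<close> exceeds 2 by more
      than \<eta>, and with \<open>b = 1\<close> otherwise.\<close>
    have key: "(2 - \<delta>) * sqrt b \<le> \<sigma>" if b: "b \<ge> 1" and Fb: "F \<ge> n * min \<eta> 1 * catalan k * b ^ k" for b
    proof -
      have 1: "1 \<le> (q * b) ^ k" using q b by (intro one_le_power) (metis mult_mono mult_1 order_trans zero_le_one)
      have "n * (2 * (q * b) ^ k) \<le> n * (\<theta> * catalan k * b ^ k)"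
        using k' b by (intro mult_left_mono) (auto simp: power_mult_distrib intro!: mult_right_mono)
      also have "\<dots> = (n * min \<eta> 1 * catalan k * b ^ k) / \<Delta>" by (simp add: \<theta>_def)
      also have "\<dots> \<le> F / \<Delta>" using Fb \<Delta> by (intro divide_right_mono) auto
      also have "\<dots> \<le> W" using FW \<Delta> by (simp add: field_simps)
      also have "W \<le> j * real \<Delta> ^ (2 * k) + n * \<sigma> ^ (2 * k)" by (rule W\<sigma>)
      also have "j * real \<Delta> ^ (2 * k) \<le> n * (q * b) ^ k"
      proof -
        have "j * real \<Delta> ^ (2 * k) = real (j * \<Delta> ^ (2 * k))" by simp
        also have "\<dots> \<le> real n * 1" using n by (simp del: of_nat_mult of_nat_power)
        also have "\<dots> \<le> n * (q * b) ^ k" using 1 by (intro mult_left_mono) auto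
        finally show ?thesis .
      qed
      finally have "n * (q * b) ^ k \<le> n * \<sigma> ^ (2 * k)" by simp
      then have "(q * b) ^ k \<le> \<sigma> ^ (2 * k)" using n by simp
      moreover have "q * b = ((2 - \<delta>) * sqrt b)\<^sup>2" using b by (simp add: q_def power_mult_distrib)
      ultimately have "((2 - \<delta>) * sqrt b) ^ (2 * k) \<le> \<sigma> ^ (2 * k)" by (simp add: power_mult)
      then show ?thesis using k0 \<sigma> \<delta> b by (subst (asm) power_mono_iff) auto
    qed
    have "\<sigma> \<ge> 2 * sqrt (d - 1) - \<epsilon>"
    proof (cases "d > 2 + \<eta>")
      case True
      have "n * min \<eta> 1 * catalan k * (d - 1) ^ k \<le> n * (d - 2) * catalan k * (d - 1) ^ k"
        using True \<eta> by (intro mult_right_mono mult_left_mono) auto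
      also have "\<dots> \<le> F" 
        unfolding n_def d_def average_degree_def F_def
        using G(2) simple_graph_nbrs[OF G(1)] True \<eta>
        by (intro branch_count_sum_ge_average_degree) (auto simp: d_def average_degree_def)
      finally have "(2 - \<delta>) * sqrt (d - 1) \<le> \<sigma>" using True \<eta> by (intro key) auto
      moreover have "\<delta> * sqrt (d - 1) \<le> \<delta> * sqrt \<Delta>" using \<delta> d\<Delta> by (intro mult_left_mono) auto
      ultimately show ?thesis using \<delta>(3) \<epsilon> by (simp add: algebra_simps)
    next
      case False
      have "n * min \<eta> 1 * catalan k * 1 ^ k \<le> real n * 1 * catalan k * 1 ^ k"
        by (intro mult_right_mono mult_left_mono) auto
      also have "\<dots> \<le> F"
        using branch_counts_ge_catalan[OF G, of \<Delta> k] deg n unfolding n_def F_def by simp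
      finally have "(2 - \<delta>) * sqrt 1 \<le> \<sigma>" by (intro key) auto
      moreover have "sqrt (d - 1) \<le> 1 + \<eta> / 2"
      proof -
        have "(1 + \<eta> / 2)\<^sup>2 = 1 + \<eta> + (\<eta> / 2)\<^sup>2" by (simp add: power2_eq_square algebra_simps)
        then have "d - 1 \<le> (1 + \<eta> / 2)\<^sup>2" using False zero_le_power2[of "\<eta> / 2"] by linarith
        then have "sqrt (d - 1) \<le> sqrt ((1 + \<eta> / 2)\<^sup>2)" by (rule real_sqrt_le_mono)
        then show ?thesis using \<eta> by simp
      qed
      ultimately show ?thesis using \<delta>' by (simp add: \<eta>_def)
    qed
    then show "graph_singular_value j G \<ge> 2 * sqrt (average_degree G - 1) - \<epsilon>" by (simp add: \<sigma>_def d_def)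
  qed
qed

lemma liminf_graph_singular_value_ge:
  fixes Gn :: "nat \<Rightarrow> 'v ugraph"
  assumes G: "\<And>n. simple_graph (Gn n) \<and> finite (verts (Gn n)) \<and> connected_graph (Gn n)"
    and deg: "\<And>n v. v \<in> verts (Gn n) \<Longrightarrow> card (nbrs (Gn n) v) \<le> \<Delta>"
    and size: "filterlim (\<lambda>n. card (verts (Gn n))) at_top sequentially" and j: "j \<ge> 1"
  shows "liminf (\<lambda>n. ereal (2 * sqrt (average_degree (Gn n) - 1))) \<le> liminf (\<lambda>n. ereal (graph_singular_value j (Gn n)))"
proof (rule ereal_le_epsilon2)
  fix \<epsilon> :: real assume "\<epsilon> > 0"
  from graph_singular_value_lower_bound[OF this j, of \<Delta>] obtain n0 where n0: 
    "\<And>G :: 'v ugraph. simple_graph G \<Longrightarrow> finite (verts G) \<Longrightarrow> connected_graph G \<Longrightarrow> 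
    (\<forall>v\<in>verts G. card (nbrs G v) \<le> \<Delta>) \<Longrightarrow> card (verts G) \<ge> n0 \<Longrightarrow>
    graph_singular_value j G \<ge> 2 * sqrt (average_degree G - 1) - \<epsilon>" by blast
  have "eventually (\<lambda>n. card (verts (Gn n)) \<ge> n0) sequentially"
    using size by (simp add: filterlim_at_top)
  then have "eventually (\<lambda>n. ereal (2 * sqrt (average_degree (Gn n) - 1)) \<le> ereal (graph_singular_value j (Gn n)) + ereal \<epsilon>) sequentially"
  proof eventually_elim
    case (elim n)
    from n0[of "Gn n", OF _ _ _ _ elim] G[of n] deg show ?case by auto
  qed
  then have "liminf (\<lambda>n. ereal (2 * sqrt (average_degree (Gn n) - 1))) \<le> liminf (\<lambda>n. ereal (graph_singular_value j (Gn n)) + ereal \<epsilon>)"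
    by (rule Liminf_mono)
  also have "\<dots> = liminf (\<lambda>n. ereal (graph_singular_value j (Gn n))) + ereal \<epsilon>"
    by (rule Liminf_add_ereal_right) auto
  finally show "liminf (\<lambda>n. ereal (2 * sqrt (average_degree (Gn n) - 1))) \<le> liminf (\<lambda>n. ereal (graph_singular_value j (Gn n))) + ereal \<epsilon>" .
qed

section \<open>Spectral measures and closed walks\<close>

lemma ell2_inner_summable:
  assumes "f \<in> ell2 V" "g \<in> ell2 V"
  shows "(\<lambda>v. f v * cnj (g v)) summable_on V"
proof -
  have "(\<lambda>v. (cmod (f v))\<^sup>2 + (cmod (g v))\<^sup>2) summable_on V"
    using assms by (intro summable_on_add) (auto simp: ell2_def)
  moreover have "norm (f v * cnj (g v)) \<le> (cmod (f v))\<^sup>2 + (cmod (g v))\<^sup>2" for v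
  proof -
    have "2 * (cmod (f v) * cmod (g v)) \<le> (cmod (f v))\<^sup>2 + (cmod (g v))\<^sup>2"
      using sum_squares_bound[of "cmod (f v)" "cmod (g v)"] by simp
    moreover have "0 \<le> cmod (f v) * cmod (g v)" by simp
    ultimately show ?thesis unfolding norm_mult complex_mod_cnj by linarith
  qed
  ultimately have "(\<lambda>v. norm (f v * cnj (g v))) summable_on V"
    by (rule summable_on_comparison_test) auto
  then show ?thesis by (rule abs_summable_summable)
qed

lemma ell2_scale:
  assumes "f \<in> ell2 V" shows "(\<lambda>v. c * f v) \<in> ell2 V"
  using assms by (auto simp: ell2_def norm_mult power_mult_distrib intro: summable_on_cmult_right)

lemma ell2_add:
  assumes "f \<in> ell2 V" "g \<in> ell2 V" shows "(\<lambda>v. f v + g v) \<in> ell2 V"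
proof -
  have "(\<lambda>v. 2 * (cmod (f v))\<^sup>2 + 2 * (cmod (g v))\<^sup>2) summable_on V"
    using assms by (intro summable_on_add summable_on_cmult_right) (auto simp: ell2_def)
  moreover have "(cmod (f v + g v))\<^sup>2 \<le> 2 * (cmod (f v))\<^sup>2 + 2 * (cmod (g v))\<^sup>2" for v
  proof -
    have "(cmod (f v + g v))\<^sup>2 \<le> (cmod (f v) + cmod (g v))\<^sup>2"
      by (intro power_mono norm_triangle_ineq) auto
    also have "\<dots> \<le> 2 * (cmod (f v))\<^sup>2 + 2 * (cmod (g v))\<^sup>2"
      using sum_squares_bound[of "cmod (f v)" "cmod (g v)"] by (simp add: power2_sum)
    finally show ?thesis .
  qed
  ultimately have "(\<lambda>v. (cmod (f v + g v))\<^sup>2) summable_on V"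
    by (rule summable_on_comparison_test) auto
  then show ?thesis using assms by (simp add: ell2_def)
qed

lemma ell2_diff:
  assumes "f \<in> ell2 V" "g \<in> ell2 V" shows "(\<lambda>v. f v - g v) \<in> ell2 V"
  using ell2_add[OF assms(1) ell2_scale[OF assms(2), of "-1"]] by simp

lemma ell2_inner_cnj: "ell2_inner V f g = cnj (ell2_inner V g f)"
  unfolding ell2_inner_def infsum_cnj[symmetric] by (intro infsum_cong) (simp add: mult.commute)

lemma ell2_inner_add_left:
  assumes "f \<in> ell2 V" "g \<in> ell2 V" "h \<in> ell2 V"
  shows "ell2_inner V (\<lambda>v. f v + g v) h = ell2_inner V f h + ell2_inner V g h"
  unfolding ell2_inner_def distrib_right
  by (intro infsum_add ell2_inner_summable assms)

lemma ell2_inner_scale_left: "ell2_inner V (\<lambda>v. c * f v) h = c * ell2_inner V f h"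
  unfolding ell2_inner_def by (simp add: mult.assoc infsum_cmult_right')

lemma ell2_inner_diff_left:
  assumes "f \<in> ell2 V" "g \<in> ell2 V" "h \<in> ell2 V"
  shows "ell2_inner V (\<lambda>v. f v - g v) h = ell2_inner V f h - ell2_inner V g h"
  using ell2_inner_add_left[OF assms(1) ell2_scale[OF assms(2), of "-1"] assms(3)]
    ell2_inner_scale_left[of V "-1" g h] by simp

lemma ell2_inner_add_right:
  assumes "f \<in> ell2 V" "g \<in> ell2 V" "h \<in> ell2 V"
  shows "ell2_inner V h (\<lambda>v. f v + g v) = ell2_inner V h f + ell2_inner V h g"
  using ell2_inner_add_left[OF assms] by (metis complex_cnj_add ell2_inner_cnj)

lemma ell2_inner_diff_right:
  assumes "f \<in> ell2 V" "g \<in> ell2 V" "h \<in> ell2 V"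
  shows "ell2_inner V h (\<lambda>v. f v - g v) = ell2_inner V h f - ell2_inner V h g"
  using ell2_inner_diff_left[OF assms] by (metis complex_cnj_diff ell2_inner_cnj)

lemma ell2_inner_scale_right: "ell2_inner V h (\<lambda>v. c * f v) = cnj c * ell2_inner V h f"
  using ell2_inner_scale_left[of V c f h] by (metis complex_cnj_mult ell2_inner_cnj)

lemma ell2_inner_self:
  assumes "f \<in> ell2 V"
  shows "Re (ell2_inner V f f) \<ge> 0"
proof -
  have "0 \<le> (\<Sum>\<^sub>\<infinity>v\<in>V. f v * cnj (f v))"
    by (rule infsum_nonneg_complex[OF ell2_inner_summable[OF assms assms]]) (simp add: less_eq_complex_def)
  then show ?thesis by (simp add: ell2_inner_def less_eq_complex_def)
qed

lemma finite_support_ell2: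
  assumes "finite {v. f v \<noteq> 0}" "\<And>v. v \<notin> V \<Longrightarrow> f v = 0"
  shows "f \<in> ell2 V"
proof -
  have "(\<lambda>v. (cmod (f v))\<^sup>2) summable_on {v. f v \<noteq> 0}" using assms by (intro summable_on_finite) auto
  moreover have "(\<lambda>v. (cmod (f v))\<^sup>2) summable_on {v. f v \<noteq> 0} \<longleftrightarrow> (\<lambda>v. (cmod (f v))\<^sup>2) summable_on V"
    by (rule summable_on_cong_neutral) (use assms in auto)
  ultimately have "(\<lambda>v. (cmod (f v))\<^sup>2) summable_on V" by blast
  then show ?thesis using assms by (simp add: ell2_def)
qed

lemma ell2_inner_finite_support:
  assumes "finite {v. g v \<noteq> 0}" "\<And>v. v \<notin> V \<Longrightarrow> g v = 0"
  shows "ell2_inner V f g = (\<Sum>v | g v \<noteq> 0. f v * cnj (g v))"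
proof -
  have "ell2_inner V f g = (\<Sum>\<^sub>\<infinity>v\<in>{v. g v \<noteq> 0}. f v * cnj (g v))"
    unfolding ell2_inner_def using assms by (intro infsum_cong_neutral) auto
  then show ?thesis using assms by simp
qed

text \<open>Real parts suffice because test functions may be multiplied by the imaginary unit, and
  they are what real polarisation delivers. Finitely supported tests suffice, and these lie in the
  domain of the adjacency operator.\<close>

lemma ell2_eqI:
  assumes "f \<in> ell2 V" "g \<in> ell2 V" 
    and eq: "\<And>h. finite {v. h v \<noteq> 0} \<Longrightarrow> (\<And>v. v \<notin> V \<Longrightarrow> h v = 0) \<Longrightarrow> 
      Re (ell2_inner V f h) = Re (ell2_inner V g h)"
  shows "f = g"
proof
  fix v
  show "f v = g v"
  proof (cases "v \<in> V")
    case True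
    have "Re (f v * cnj c) = Re (g v * cnj c)" if "c \<noteq> 0" for c
    proof -
      define h where "h w = (if w = v then c else 0)" for w
      have s: "{w. h w \<noteq> 0} = {v}" using that by (auto simp: h_def)
      have z: "w \<notin> V \<Longrightarrow> h w = 0" for w using True by (auto simp: h_def)
      have "ell2_inner V k h = k v * cnj c" for k
        using ell2_inner_finite_support[of h V k] s z by (simp add: h_def)
      then show ?thesis using eq[of h] s z by simp
    qed
    from this[of 1] this[of \<i>] show ?thesis by (auto simp: complex_eq_iff)
  next
    case False
    then show ?thesis using assms by (simp add: ell2_def)
  qed
qed

section \<open>Integration against signed densities\<close>

text \<open>Says that \<open>M1 - M2\<close> has density \<phi> with respect to \<open>M0\<close>,
  with negative parts moved to the other side so that all terms are nonnegative;
  \<open>ennreal\<close> truncates at zero and thus extracts the parts of \<phi>.\<close>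

lemma nn_integral_signed_density:
  fixes \<phi> :: "real \<Rightarrow> real"
  assumes [simp, measurable_cong]: "sets M1 = sets borel" "sets M2 = sets borel" "sets M0 = sets borel"
    and [measurable]: "\<phi> \<in> borel_measurable borel"
    and eq: "\<And>X. X \<in> sets borel \<Longrightarrow> 
      emeasure M1 X + (\<integral>\<^sup>+x. indicator X x * ennreal (- \<phi> x) \<partial>M0) = 
      emeasure M2 X + (\<integral>\<^sup>+x. indicator X x * ennreal (\<phi> x) \<partial>M0)"
    and h: "h \<in> borel_measurable borel"
  shows "(\<integral>\<^sup>+x. h x \<partial>M1) + (\<integral>\<^sup>+x. h x * ennreal (- \<phi> x) \<partial>M0) = 
      (\<integral>\<^sup>+x. h x \<partial>M2) + (\<integral>\<^sup>+x. h x * ennreal (\<phi> x) \<partial>M0)"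
  using h
proof (induction h rule: borel_measurable_induct)
  case (cong f g)
  then have "f = g" by auto
  with cong show ?case by simp
next
  case (set A)
  then show ?case using eq[OF set] by simp
next
  case (mult u c)
  note [measurable] = mult.hyps(2)
  show ?case using mult.IH
    by (simp add: nn_integral_cmult mult.assoc flip: distrib_left)
next
  case (add u v)
  note [measurable] = add.hyps(1,3)
  let ?I = "\<lambda>M u. \<integral>\<^sup>+x. u x \<partial>M" and ?J = "\<lambda>\<psi> u. \<integral>\<^sup>+x. u x * ennreal (\<psi> x) \<partial>M0"
  have split: "?I M (\<lambda>x. v x + u x) + ?J \<psi> (\<lambda>x. v x + u x) = (?I M v + ?J \<psi> v) + (?I M u + ?J \<psi> u)"
    if "\<psi> \<in> borel_measurable borel" and M: "sets M = sets borel" for \<psi> M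
  proof -
    note [measurable] = that(1)
    have "borel_measurable M = (borel_measurable borel :: (real \<Rightarrow> ennreal) set)"
      by (rule measurable_cong_sets[OF M refl])
    then have m: "v \<in> borel_measurable M" "u \<in> borel_measurable M"
      using add.hyps(1,3) by blast+
    have "?I M (\<lambda>x. v x + u x) = ?I M v + ?I M u" using m by (intro nn_integral_add)
    moreover have "?J \<psi> (\<lambda>x. v x + u x) = ?J \<psi> v + ?J \<psi> u"
      unfolding distrib_right by (intro nn_integral_add; measurable)
    ultimately show ?thesis by (simp only: add_ac)
  qed
  have m: "(\<lambda>x. - \<phi> x) \<in> borel_measurable borel" by measurable
  show ?case unfolding split[OF m assms(1)] split[OF assms(4,2)] add.IH ..
next
  case (seq U)
  note [measurable] = seq.hyps(1)
  have inc: "incseq (\<lambda>i x. U i x * ennreal (\<psi> x))" for \<psi> :: "real \<Rightarrow> real"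
    using seq.hyps(3) by (auto simp: incseq_def le_fun_def intro!: mult_right_mono)
  have conv: "(\<integral>\<^sup>+x. (SUP i. U i) x \<partial>M) + (\<integral>\<^sup>+x. (SUP i. U i) x * ennreal (\<psi> x) \<partial>M0) = 
      (SUP i. (\<integral>\<^sup>+x. U i x \<partial>M) + (\<integral>\<^sup>+x. U i x * ennreal (\<psi> x) \<partial>M0))"
    if "\<psi> \<in> borel_measurable borel" and M: "sets M = sets borel" for \<psi> M
  proof -
    note [measurable] = that(1)
    have "borel_measurable M = (borel_measurable borel :: (real \<Rightarrow> ennreal) set)"
      by (rule measurable_cong_sets[OF M refl])
    then have m: "U i \<in> borel_measurable M" for i
      using seq.hyps(1) by blast
    have "(\<integral>\<^sup>+x. (SUP i. U i) x * ennreal (\<psi> x) \<partial>M0) = (\<integral>\<^sup>+x. (SUP i. U i x * ennreal (\<psi> x)) \<partial>M0)"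
      by (simp add: SUP_mult_right_ennreal image_comp)
    also have "\<dots> = (SUP i. \<integral>\<^sup>+x. U i x * ennreal (\<psi> x) \<partial>M0)"
      by (intro nn_integral_monotone_convergence_SUP[OF inc]; measurable)
    finally have 1: "(\<integral>\<^sup>+x. (SUP i. U i) x * ennreal (\<psi> x) \<partial>M0) = (SUP i. \<integral>\<^sup>+x. U i x * ennreal (\<psi> x) \<partial>M0)" .
    have "(\<integral>\<^sup>+x. (SUP i. U i) x \<partial>M) = (\<integral>\<^sup>+x. (SUP i. U i x) \<partial>M)"
      by (simp add: image_comp)
    also have "\<dots> = (SUP i. \<integral>\<^sup>+x. U i x \<partial>M)"
      by (intro nn_integral_monotone_convergence_SUP m seq.hyps(3))
    finally have 2: "(\<integral>\<^sup>+x. (SUP i. U i) x \<partial>M) = (SUP i. \<integral>\<^sup>+x. U i x \<partial>M)" .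
    have "incseq (\<lambda>i. \<integral>\<^sup>+x. U i x \<partial>M)" "incseq (\<lambda>i. \<integral>\<^sup>+x. U i x * ennreal (\<psi> x) \<partial>M0)"
      using seq.hyps(3) inc[of \<psi>] by (auto simp: incseq_def le_fun_def intro!: nn_integral_mono)
    then show ?thesis unfolding 1 2 by (rule ennreal_SUP_add[symmetric])
  qed
  have m: "(\<lambda>x. - \<phi> x) \<in> borel_measurable borel" by measurable
  show ?case unfolding conv[OF m assms(1)] conv[OF assms(4,2)] seq.IH ..
qed

text \<open>Integrating \<open>x\<close> against the density \<open>4 * x\<close> gives
  \<open>4 * x\<^sup>2\<close>. The previous lemma is applied to the positive and the negative part
  of \<open>x\<close> separately; this is the calculation behind \<open>inner_A_A\<close>.\<close>

lemma integral_signed_density: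
  assumes [simp, measurable_cong]: "sets M1 = sets borel" "sets M2 = sets borel" "sets M0 = sets borel"
    and fin: "finite_measure M1" "finite_measure M2" "finite_measure M0"
    and i: "integrable M1 (\<lambda>x. x)" "integrable M2 (\<lambda>x. x)" "integrable M0 (\<lambda>x. x)" "integrable M0 (\<lambda>x. x\<^sup>2)"
    and eq: "\<And>X. X \<in> sets borel \<Longrightarrow> measure M1 X - measure M2 X = (\<integral>x. indicator X x * (4 * x) \<partial>M0)"
  shows "(\<integral>x. x \<partial>M1) - (\<integral>x. x \<partial>M2) = 4 * (\<integral>x. x\<^sup>2 \<partial>M0)"
proof -
  have nn: "(\<integral>\<^sup>+x. ennreal (g x) \<partial>M) = ennreal (\<integral>x. max 0 (g x) \<partial>M)" if "integrable M g" for M and g :: "real \<Rightarrow> real"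
  proof -
    have "(\<integral>\<^sup>+x. ennreal (g x) \<partial>M) = (\<integral>\<^sup>+x. ennreal (max 0 (g x)) \<partial>M)"
      by (intro nn_integral_cong) (simp add: max_def ennreal_neg)
    also have "\<dots> = ennreal (\<integral>x. max 0 (g x) \<partial>M)"
      using that by (intro nn_integral_eq_integral integrable_max) auto
    finally show ?thesis .
  qed
  have key: "(\<integral>\<^sup>+x. h x \<partial>M1) + (\<integral>\<^sup>+x. h x * ennreal (- (4 * x)) \<partial>M0) = 
      (\<integral>\<^sup>+x. h x \<partial>M2) + (\<integral>\<^sup>+x. h x * ennreal (4 * x) \<partial>M0)" if "h \<in> borel_measurable borel" for h
  proof (rule nn_integral_signed_density[OF _ _ _ _ _ that])
    fix X :: "real set" assume X [measurable]: "X \<in> sets borel"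
    have ii: "integrable M0 (\<lambda>x. indicator X x * (4 * x))" 
      using integrable_real_mult_indicator[of X M0 "\<lambda>x. 4 * x"] i(3) by (simp add: mult.commute)
    have ii': "integrable M0 (\<lambda>x. - (indicator X x * (4 * x)))" using ii by simp
    have e: "(\<integral>\<^sup>+x. indicator X x * ennreal (4 * x) \<partial>M0) = ennreal (\<integral>x. max 0 (indicator X x * (4 * x)) \<partial>M0)"
      by (subst nn[OF ii, symmetric]) (auto intro!: nn_integral_cong simp: indicator_def)
    have e': "(\<integral>\<^sup>+x. indicator X x * ennreal (- (4 * x)) \<partial>M0) = ennreal (\<integral>x. max 0 (- (indicator X x * (4 * x))) \<partial>M0)"
      by (subst nn[OF ii', symmetric]) (auto intro!: nn_integral_cong simp: indicator_def)
    have "(\<integral>x. indicator X x * (4 * x) \<partial>M0) = (\<integral>x. max 0 (indicator X x * (4 * x)) - max 0 (- (indicator X x * (4 * x))) \<partial>M0)"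
      by (intro Bochner_Integration.integral_cong) auto
    also have "\<dots> = (\<integral>x. max 0 (indicator X x * (4 * x)) \<partial>M0) - (\<integral>x. max 0 (- (indicator X x * (4 * x))) \<partial>M0)"
      using ii ii' by (intro Bochner_Integration.integral_diff) auto
    finally have "measure M1 X + (\<integral>x. max 0 (- (indicator X x * (4 * x))) \<partial>M0) = 
        measure M2 X + (\<integral>x. max 0 (indicator X x * (4 * x)) \<partial>M0)" using eq[OF X] by simp
    then have "ennreal (measure M1 X) + ennreal (\<integral>x. max 0 (- (indicator X x * (4 * x))) \<partial>M0) = 
        ennreal (measure M2 X) + ennreal (\<integral>x. max 0 (indicator X x * (4 * x)) \<partial>M0)"
      by (simp flip: ennreal_plus)
    then show "emeasure M1 X + (\<integral>\<^sup>+x. indicator X x * ennreal (- (4 * x)) \<partial>M0) = 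
        emeasure M2 X + (\<integral>\<^sup>+x. indicator X x * ennreal (4 * x) \<partial>M0)"
      unfolding e e' using fin by (simp add: finite_measure.emeasure_eq_measure)
  qed auto
  define A where "A M = (\<integral>x. max 0 x \<partial>M)" for M :: "real measure"
  define B where "B M = (\<integral>x. max 0 (- x) \<partial>M)" for M :: "real measure"
  have AB: "(\<integral>x. x \<partial>M) = A M - B M" if "integrable M (\<lambda>x. x)" for M :: "real measure"
  proof -
    have "(\<integral>x. x \<partial>M) = (\<integral>x. max 0 x - max 0 (- x) \<partial>M)" by (intro Bochner_Integration.integral_cong) auto
    also have "\<dots> = A M - B M" unfolding A_def B_def using that by (intro Bochner_Integration.integral_diff) auto
    finally show ?thesis .
  qed
  define P where "P = (\<integral>x. indicator {0..} x * (4 * x\<^sup>2) \<partial>M0)"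
  define Q where "Q = (\<integral>x. indicator {..<0} x * (4 * x\<^sup>2) \<partial>M0)"
  have PQi: "integrable M0 (\<lambda>x. indicator Y x * (4 * x\<^sup>2))" if "Y \<in> sets borel" for Y
    using integrable_real_mult_indicator[of Y M0 "\<lambda>x. 4 * x\<^sup>2"] i(4) that by (simp add: mult.commute)
  have PQ: "4 * (\<integral>x. x\<^sup>2 \<partial>M0) = P + Q"
  proof -
    have "4 * (\<integral>x. x\<^sup>2 \<partial>M0) = (\<integral>x. indicator {0..} x * (4 * x\<^sup>2) + indicator {..<0} x * (4 * x\<^sup>2) \<partial>M0)"
      unfolding integral_mult_right_zero[symmetric]
      by (intro Bochner_Integration.integral_cong) (auto simp: indicator_def)
    also have "\<dots> = P + Q" unfolding P_def Q_def by (intro Bochner_Integration.integral_add PQi) auto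
    finally show ?thesis .
  qed
  have nnPQ: "(\<integral>\<^sup>+x. indicator Y x * ennreal (4 * x\<^sup>2) \<partial>M0) = ennreal (\<integral>x. indicator Y x * (4 * x\<^sup>2) \<partial>M0)"
    if "Y \<in> sets borel" for Y
    by (subst nn_integral_eq_integral[OF PQi[OF that], symmetric])
      (auto intro!: nn_integral_cong simp: indicator_def)
  have e1: "(\<integral>\<^sup>+x. ennreal x * ennreal (4 * x) \<partial>M0) = ennreal P"
    unfolding P_def by (subst nnPQ[symmetric]) (auto intro!: nn_integral_cong simp: indicator_def power2_eq_square ennreal_neg simp flip: ennreal_mult')
  have e2: "(\<integral>\<^sup>+x. ennreal (- x) * ennreal (- (4 * x)) \<partial>M0) = ennreal Q"
  proof -
    have "ennreal (- x) * ennreal (- (4 * x)) = indicator {..<0} x * ennreal (4 * x\<^sup>2)" for x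
      by (cases "x < 0") (auto simp: indicator_def power2_eq_square ennreal_neg simp flip: ennreal_mult')
    then show ?thesis unfolding Q_def by (simp add: nnPQ)
  qed
  \<comment> \<open>Parts of opposite sign live on disjoint half-lines.\<close>
  have z: "ennreal x * ennreal (- (4 * x)) = 0" "ennreal (- x) * ennreal (4 * x) = 0" for x
    by (cases "x \<ge> 0"; auto simp: ennreal_neg)+
  have nneg: "A M \<ge> 0" "B M \<ge> 0" "P \<ge> 0" "Q \<ge> 0" for M
    by (auto simp: A_def B_def P_def Q_def intro!: Bochner_Integration.integral_nonneg)
  have nA: "(\<integral>\<^sup>+x. ennreal x \<partial>M) = ennreal (A M)" if "integrable M (\<lambda>x. x)" for M
    unfolding A_def by (rule nn[OF that])
  have nB: "(\<integral>\<^sup>+x. ennreal (- x) \<partial>M) = ennreal (B M)" if "integrable M (\<lambda>x. x)" for M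
    unfolding B_def by (rule nn) (use that in simp)
  have "ennreal (A M1) + 0 = ennreal (A M2) + ennreal P"
    using key[of ennreal] by (simp only: nA[OF i(1)] nA[OF i(2)] z e1 nn_integral_const) simp
  moreover have "ennreal (B M1) + ennreal Q = ennreal (B M2) + 0"
    using key[of "\<lambda>x. ennreal (- x)"] by (simp only: nB[OF i(1)] nB[OF i(2)] z e2 nn_integral_const) simp
  ultimately have "A M1 = A M2 + P" "B M1 + Q = B M2" using nneg by (simp_all flip: ennreal_plus)
  then show ?thesis using AB i PQ by simp
qed

section \<open>Projection-valued measures\<close>

locale pvm =
  fixes V :: "'v set" and E
  assumes pvm: "projection_valued_measure V E"
begin

abbreviation inner :: "('v \<Rightarrow> complex) \<Rightarrow> ('v \<Rightarrow> complex) \<Rightarrow> complex" where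
  "inner \<equiv> ell2_inner V"

lemma proj: "B \<in> sets borel \<Longrightarrow> orthogonal_projection V (E B)"
  using pvm by (simp add: projection_valued_measure_def)

lemma E_ell2: "B \<in> sets borel \<Longrightarrow> f \<in> ell2 V \<Longrightarrow> E B f \<in> ell2 V"
  using proj by (auto simp: orthogonal_projection_def)

lemma E_add: "B \<in> sets borel \<Longrightarrow> f \<in> ell2 V \<Longrightarrow> g \<in> ell2 V \<Longrightarrow> 
    E B (\<lambda>v. f v + g v) = (\<lambda>v. E B f v + E B g v)"
  using proj by (auto simp: orthogonal_projection_def)

lemma E_scale: "B \<in> sets borel \<Longrightarrow> f \<in> ell2 V \<Longrightarrow> E B (\<lambda>v. c * f v) = (\<lambda>v. c * E B f v)"
  using proj by (auto simp: orthogonal_projection_def)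

lemma E_diff: "B \<in> sets borel \<Longrightarrow> f \<in> ell2 V \<Longrightarrow> g \<in> ell2 V \<Longrightarrow> 
    E B (\<lambda>v. f v - g v) = (\<lambda>v. E B f v - E B g v)"
  using E_add[of B f "\<lambda>v. -1 * g v"] E_scale[of B g "-1"] ell2_scale[of g V "-1"] by simp

lemma E_adjoint: "B \<in> sets borel \<Longrightarrow> f \<in> ell2 V \<Longrightarrow> g \<in> ell2 V \<Longrightarrow> inner (E B f) g = inner f (E B g)"
  using proj by (auto simp: orthogonal_projection_def)

lemma E_Int: "B \<in> sets borel \<Longrightarrow> C \<in> sets borel \<Longrightarrow> f \<in> ell2 V \<Longrightarrow> E (B \<inter> C) f = E B (E C f)"
  using pvm by (simp add: projection_valued_measure_def)

lemma E_UNIV: "f \<in> ell2 V \<Longrightarrow> E UNIV f = f"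
  using pvm by (simp add: projection_valued_measure_def)

lemma E_sums: "f \<in> ell2 V \<Longrightarrow> range B \<subseteq> sets borel \<Longrightarrow> disjoint_family B \<Longrightarrow> 
    (\<lambda>i. inner (E (B i) f) f) sums inner (E (\<Union>i. B i) f) f" for B :: "nat \<Rightarrow> real set"
  using pvm unfolding projection_valued_measure_def by blast

definition "qf B f = Re (inner (E B f) f)"

lemma qf_eq: "B \<in> sets borel \<Longrightarrow> f \<in> ell2 V \<Longrightarrow> qf B f = Re (inner (E B f) (E B f))"
  unfolding qf_def using E_adjoint[of B "E B f" f] E_Int[of B B f] E_ell2[of B f] by simp

lemma qf_nonneg: "B \<in> sets borel \<Longrightarrow> f \<in> ell2 V \<Longrightarrow> qf B f \<ge> 0"
  by (simp add: qf_eq ell2_inner_self E_ell2)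

lemma qf_sums: "f \<in> ell2 V \<Longrightarrow> range B \<subseteq> sets borel \<Longrightarrow> disjoint_family B \<Longrightarrow> 
    (\<lambda>i. qf (B i) f) sums qf (\<Union>i. B i) f" for B :: "nat \<Rightarrow> real set"
  unfolding qf_def using E_sums by (intro sums_Re)

text \<open>The empty set is disjoint from itself, so the series with constant term
  \<open>qf {} f\<close> converges.\<close>

lemma qf_empty: "f \<in> ell2 V \<Longrightarrow> qf {} f = 0"
  using qf_sums[of f "\<lambda>_. {}"] sums_summable summable_const_iff 
  by (fastforce simp: disjoint_family_on_def)

lemma emeasure_pvm: 
  assumes "f \<in> ell2 V" "B \<in> sets borel" 
  shows "emeasure (pvm_measure V E f) B = ennreal (qf B f)"
  unfolding pvm_measure_def qf_def[symmetric]
proof (rule emeasure_measure_of_sigma)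
  show "sigma_algebra UNIV (sets (borel :: real measure))"
    using sets.sigma_algebra_axioms[of borel] by simp
  show "positive (sets borel) (\<lambda>B. ennreal (qf B f))" using assms by (simp add: positive_def qf_empty)
  show "countably_additive (sets borel) (\<lambda>B. ennreal (qf B f))"
    unfolding countably_additive_def
  proof (intro allI impI)
    fix B :: "nat \<Rightarrow> real set" assume B: "range B \<subseteq> sets borel" "disjoint_family B"
    then show "(\<Sum>i. ennreal (qf (B i) f)) = ennreal (qf (\<Union> (range B)) f)"
      using assms by (intro suminf_ennreal_eq qf_sums qf_nonneg) auto
  qed
qed fact

lemma sets_pvm [simp, measurable_cong]: "sets (pvm_measure V E f) = sets borel"
  unfolding pvm_measure_def using sets.sigma_sets_eq[of "borel :: real measure"] by simp

lemma space_pvm [simp]: "space (pvm_measure V E f) = UNIV"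
  by (simp add: pvm_measure_def space_measure_of_conv)

lemma finite_pvm: "f \<in> ell2 V \<Longrightarrow> finite_measure (pvm_measure V E f)"
  by (rule finite_measureI) (simp add: emeasure_pvm)

lemma measure_pvm: "f \<in> ell2 V \<Longrightarrow> B \<in> sets borel \<Longrightarrow> measure (pvm_measure V E f) B = qf B f"
  by (simp add: measure_def emeasure_pvm qf_nonneg)

lemma qf_polarisation:
  assumes "C \<in> sets borel" "f \<in> ell2 V" "g \<in> ell2 V"
  shows "qf C (\<lambda>v. f v + g v) - qf C (\<lambda>v. f v - g v) = 4 * Re (inner (E C f) g)"
proof -
  note e = E_ell2[OF assms(1,2)] E_ell2[OF assms(1,3)]
  have "inner (E C g) f = cnj (inner (E C f) g)"
    using E_adjoint[OF assms(1,3,2)] ell2_inner_cnj by metis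
  then show ?thesis unfolding qf_def using assms e
    by (simp add: E_add E_diff ell2_inner_add_left ell2_inner_add_right ell2_inner_diff_left 
        ell2_inner_diff_right ell2_add ell2_diff)
qed

lemma pvm_measure_E:
  assumes C: "C \<in> sets borel" and f: "f \<in> ell2 V"
  shows "pvm_measure V E (E C f) = density (pvm_measure V E f) (indicator C)"
proof (rule measure_eqI)
  fix B assume "B \<in> sets (pvm_measure V E (E C f))"
  then have B: "B \<in> sets borel" by simp
  have "qf B (E C f) = Re (inner (E (B \<inter> C) f) (E C f))" using E_Int[OF B C f] by (simp add: qf_def)
  also have "\<dots> = Re (inner (E C (E (B \<inter> C) f)) f)"
    using E_adjoint[OF C E_ell2[of "B \<inter> C", OF _ f] f] B C by simp
  also have "E C (E (B \<inter> C) f) = E (B \<inter> C) f" 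
    using E_Int[OF C _ f, of "B \<inter> C"] B C by (simp add: Int_ac)
  finally have "qf B (E C f) = qf (B \<inter> C) f" by (simp add: qf_def)
  then show "emeasure (pvm_measure V E (E C f)) B = emeasure (density (pvm_measure V E f) (indicator C)) B"
    using B C f E_ell2 by (simp add: emeasure_pvm emeasure_density nn_integral_indicator' Int_commute 
        flip: indicator_inter_arith)
qed simp

lemma inner_E_disjoint:
  assumes X: "X \<in> sets borel" and B: "B \<in> sets borel" and C: "C \<in> sets borel" and "B \<inter> C = {}" 
    and f: "f \<in> ell2 V" and g: "g \<in> ell2 V"
  shows "Re (inner (E X (E B f)) (E C g)) = 0"
proof -
  have "inner (E X (E B f)) (E C g) = inner (E C (E X (E B f))) g"
    using E_adjoint[OF C _ g, of "E X (E B f)"] E_ell2 X B f by simp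
  also have "E C (E X (E B f)) = E (C \<inter> (X \<inter> B)) f"
    using E_Int[OF C _ f, of "X \<inter> B"] E_Int[OF X B f] X B by simp
  \<comment> \<open>The quadratic form of \<open>E {}\<close> vanishes, and by polarisation so do
    the real parts of its inner products.\<close>
  also have "C \<inter> (X \<inter> B) = {}" using assms by blast
  finally show ?thesis 
    using qf_polarisation[of "{}" f g] f g by (simp add: qf_empty ell2_add ell2_diff)
qed

text \<open>Additivity is assumed for quadratic forms only; polarisation against finitely supported
  \<open>h\<close> lifts it to vectors.\<close>

lemma E_compl:
  assumes C: "C \<in> sets borel" and f: "f \<in> ell2 V"
  shows "f = (\<lambda>v. E C f v + E (- C) f v)"
proof (rule ell2_eqI[of _ V])
  have C': "- C \<in> sets borel" using C by auto
  show e: "(\<lambda>v. E C f v + E (- C) f v) \<in> ell2 V" using C C' f by (intro ell2_add E_ell2)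
  fix h :: "'v \<Rightarrow> complex" assume "finite {v. h v \<noteq> 0}" "\<And>v. v \<notin> V \<Longrightarrow> h v = 0"
  then have h: "h \<in> ell2 V" by (rule finite_support_ell2)
  have q: "qf C k + qf (- C) k = qf UNIV k" if "k \<in> ell2 V" for k
  proof -
    interpret finite_measure "pvm_measure V E k" using that by (rule finite_pvm)
    show ?thesis using finite_measure_Union[of C "- C"] C C' that by (simp add: measure_pvm)
  qed
  have "4 * Re (inner (E C f) h) + 4 * Re (inner (E (- C) f) h) = 4 * Re (inner (E UNIV f) h)"
    using qf_polarisation[OF C f h] qf_polarisation[OF C' f h] qf_polarisation[of UNIV f h]
      q[OF ell2_add[OF f h]] q[OF ell2_diff[OF f h]] f h by simp
  then show "Re (inner f h) = Re (inner (\<lambda>v. E C f v + E (- C) f v) h)"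
    using f h C C' by (simp add: E_UNIV ell2_inner_add_left E_ell2)
qed fact

end

section \<open>Spectral resolutions of the adjacency operator\<close>

locale adjacency_resolution =
  fixes G :: "'v ugraph" and E
  assumes G: "simple_graph G" "locally_finite_graph G" and res: "spectral_resolution G E"
begin

sublocale pvm "verts G" E
  using res by unfold_locales (simp add: spectral_resolution_def)

abbreviation "A \<equiv> adjacency_op G"
abbreviation "D \<equiv> adjacency_dom G"
abbreviation "\<mu> f \<equiv> pvm_measure (verts G) E f"

lemma A_add: "A (\<lambda>v. f v + g v) = (\<lambda>v. A f v + A g v)"
  by (simp add: adjacency_op_def sum.distrib)

lemma A_scale: "A (\<lambda>v. c * f v) = (\<lambda>v. c * A f v)"
  by (simp add: adjacency_op_def sum_distrib_left)

lemma A_diff: "A (\<lambda>v. f v - g v) = (\<lambda>v. A f v - A g v)"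
  by (simp add: adjacency_op_def sum_subtractf)

lemma D_ell2: "f \<in> D \<Longrightarrow> f \<in> ell2 (verts G)" "f \<in> D \<Longrightarrow> A f \<in> ell2 (verts G)"
  by (auto simp: adjacency_dom_def)

lemma D_add: "f \<in> D \<Longrightarrow> g \<in> D \<Longrightarrow> (\<lambda>v. f v + g v) \<in> D"
  by (simp add: adjacency_dom_def A_add ell2_add)

lemma D_diff: "f \<in> D \<Longrightarrow> g \<in> D \<Longrightarrow> (\<lambda>v. f v - g v) \<in> D"
  by (simp add: adjacency_dom_def A_diff ell2_diff)

lemma D_scale: "f \<in> D \<Longrightarrow> (\<lambda>v. c * f v) \<in> D"
  by (simp add: adjacency_dom_def A_scale ell2_scale)

lemma D_iff: "f \<in> D \<longleftrightarrow> f \<in> ell2 (verts G) \<and> integrable (\<mu> f) (\<lambda>x. x\<^sup>2)"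
  using res by (auto simp: spectral_resolution_def)

lemma form: "f \<in> D \<Longrightarrow> inner (A f) f = complex_of_real (\<integral>x. x \<partial>\<mu> f)"
  using res by (auto simp: spectral_resolution_def)

lemma integrable_id: "f \<in> D \<Longrightarrow> integrable (\<mu> f) (\<lambda>x. x)"
proof -
  assume f: "f \<in> D"
  then interpret finite_measure "\<mu> f" using D_ell2 finite_pvm by blast
  have i: "integrable (\<mu> f) (\<lambda>x. 1 + x\<^sup>2)" using f D_iff by auto
  have "\<bar>x\<bar> \<le> 1 + x\<^sup>2" for x :: real
    using zero_le_power2[of "\<bar>x\<bar> - 1"] zero_le_power2[of x] 
    by (simp add: power2_diff)
  then show ?thesis by (intro Bochner_Integration.integrable_bound[OF i]) auto
qed

text \<open>By \<open>form\<close> the quadratic form is real; its imaginary part at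
  \<open>f + i g\<close> is the difference of the two sides.\<close>

lemma inner_A_symmetric:
  assumes f: "f \<in> D" and g: "g \<in> D"
  shows "Re (inner (A g) f) = Re (inner (A f) g)"
proof -
  note [simp] = D_ell2[OF f] D_ell2[OF g] ell2_scale
  have "Im (inner (A (\<lambda>v. f v + \<i> * g v)) (\<lambda>v. f v + \<i> * g v)) = 0"
    using form[OF D_add[OF f D_scale[OF g]]] by simp
  moreover have "Im (inner (A f) f) = 0" "Im (inner (A g) g) = 0" using form f g by auto
  ultimately show ?thesis unfolding A_add A_scale
    by (simp add: ell2_inner_add_left ell2_inner_add_right ell2_inner_scale_left ell2_inner_scale_right ell2_add)
qed

lemma inner_A_polarisation:
  assumes f: "f \<in> D" and g: "g \<in> D"
  shows "4 * Re (inner (A f) g) = (\<integral>x. x \<partial>\<mu> (\<lambda>v. f v + g v)) - (\<integral>x. x \<partial>\<mu> (\<lambda>v. f v - g v))"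
proof -
  note [simp] = D_ell2[OF f] D_ell2[OF g]
  have "(\<integral>x. x \<partial>\<mu> (\<lambda>v. f v + g v)) = Re (inner (A (\<lambda>v. f v + g v)) (\<lambda>v. f v + g v))"
    using form[OF D_add[OF f g]] by simp
  moreover have "(\<integral>x. x \<partial>\<mu> (\<lambda>v. f v - g v)) = Re (inner (A (\<lambda>v. f v - g v)) (\<lambda>v. f v - g v))"
    using form[OF D_diff[OF f g]] by simp
  ultimately show ?thesis unfolding A_add A_diff using inner_A_symmetric[OF f g]
    by (simp add: ell2_inner_add_left ell2_inner_add_right ell2_inner_diff_left ell2_inner_diff_right ell2_add ell2_diff)
qed

lemma E_D: 
  assumes f: "f \<in> D" and C: "C \<in> sets borel" 
  shows "E C f \<in> D"
proof -
  have "integrable (density (\<mu> f) (indicator C)) (\<lambda>x. x\<^sup>2)"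
    using f C D_iff[of f]
      integrable_real_mult_indicator[of C "\<mu> f" "\<lambda>x. x\<^sup>2"]
    by (subst integrable_density[where g = "indicator C :: real \<Rightarrow> real", simplified ennreal_indicator])
      (auto simp: mult.commute)
  then show ?thesis using pvm_measure_E[OF C] D_iff f C E_ell2 by auto
qed

text \<open>The sum and the difference of the two projected vectors have the same spectral measure,
  since all cross terms \<open>Re (inner (E X (E B f)) (E C g))\<close> vanish; hence they have the
  same quadratic form.\<close>

lemma inner_A_disjoint:
  assumes f: "f \<in> D" and g: "g \<in> D" and B: "B \<in> sets borel" and C: "C \<in> sets borel" and disj: "B \<inter> C = {}" 
  shows "Re (inner (A (E B f)) (E C g)) = 0"
proof -
  let ?f = "E B f" and ?g = "E C g"
  have D: "?f \<in> D" "?g \<in> D" using assms E_D by auto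
  note [simp] = D_ell2(1)[OF D(1)] D_ell2(1)[OF D(2)]
  have "\<mu> (\<lambda>v. ?f v + ?g v) = \<mu> (\<lambda>v. ?f v - ?g v)"
  proof (rule measure_eqI)
    fix X assume "X \<in> sets (\<mu> (\<lambda>v. ?f v + ?g v))"
    then have X: "X \<in> sets borel" by simp
    have "qf X (\<lambda>v. ?f v + ?g v) = qf X (\<lambda>v. ?f v - ?g v)"
      using qf_polarisation[OF X, of ?f ?g] inner_E_disjoint[OF X B C disj] D_ell2 f g by simp
    then show "emeasure (\<mu> (\<lambda>v. ?f v + ?g v)) X = emeasure (\<mu> (\<lambda>v. ?f v - ?g v)) X"
      using X by (simp add: emeasure_pvm ell2_add ell2_diff)
  qed simp
  then show ?thesis using inner_A_polarisation[OF D] by simp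
qed

lemma finite_support_D:
  assumes "finite {v. h v \<noteq> 0}" "\<And>v. v \<notin> verts G \<Longrightarrow> h v = 0"
  shows "h \<in> D"
proof -
  have "{v. A h v \<noteq> 0} \<subseteq> (\<Union>u\<in>{v. h v \<noteq> 0}. nbrs G u)"
  proof
    fix v assume "v \<in> {v. A h v \<noteq> 0}"
    then obtain u where "u \<in> nbrs G v" "h u \<noteq> 0" 
      unfolding adjacency_op_def using sum.neutral by (metis (mono_tags, lifting) mem_Collect_eq)
    then show "v \<in> (\<Union>u\<in>{v. h v \<noteq> 0}. nbrs G u)"
      using G by (auto simp: simple_graph_def nbrs_def sym_def)
  qed
  moreover have "finite (\<Union>u\<in>{v. h v \<noteq> 0}. nbrs G u)"
    using assms G by (auto simp: locally_finite_graph_def)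
  ultimately have "finite {v. A h v \<noteq> 0}" by (rule finite_subset)
  moreover have "A h v = 0" if "v \<notin> verts G" for v
  proof -
    have "nbrs G v = {}" using that G by (auto simp: simple_graph_def nbrs_def)
    then show ?thesis by (simp add: adjacency_op_def)
  qed
  ultimately show ?thesis using assms by (simp add: adjacency_dom_def finite_support_ell2)
qed

text \<open>Both \<open>f\<close> and the test function are split along \<open>C\<close> and its
  complement. By \<open>inner_A_disjoint\<close> the operator is block diagonal for this
  splitting.\<close>

lemma A_E_commute:
  assumes f: "f \<in> D" and C: "C \<in> sets borel"
  shows "A (E C f) = E C (A f)"
proof (rule ell2_eqI[of _ "verts G"])
  have C': "- C \<in> sets borel" using C by auto
  note D = E_D[OF f C] E_D[OF f C']
  show "A (E C f) \<in> ell2 (verts G)" "E C (A f) \<in> ell2 (verts G)" using D D_ell2 E_ell2 C f by auto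
  fix h :: "'v \<Rightarrow> complex" assume "finite {v. h v \<noteq> 0}" "\<And>v. v \<notin> verts G \<Longrightarrow> h v = 0"
  then have h: "h \<in> D" by (rule finite_support_D)
  note Dh = E_D[OF h C] E_D[OF h C']
  note [simp] = D_ell2[OF D(1)] D_ell2[OF D(2)] D_ell2[OF Dh(1)] D_ell2[OF Dh(2)] D_ell2[OF h] D_ell2[OF f]
  have hs: "h = (\<lambda>v. E C h v + E (- C) h v)" using E_compl[OF C] by simp
  have fs: "A f = (\<lambda>v. A (E C f) v + A (E (- C) f) v)" 
    using E_compl[OF C D_ell2(1)[OF f]] A_add by metis
  have "Re (inner (A (E C f)) h) = Re (inner (A (E C f)) (E C h)) + Re (inner (A (E C f)) (E (- C) h))"
    by (subst hs) (simp add: ell2_inner_add_right)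
  also have "Re (inner (A (E C f)) (E (- C) h)) = 0" by (rule inner_A_disjoint[OF f h C C']) simp
  also have "Re (inner (A (E C f)) (E C h)) + 0 = Re (inner (A f) (E C h))"
    using inner_A_disjoint[OF f h C' C] by (subst fs) (simp add: ell2_inner_add_left)
  also have "\<dots> = Re (inner (E C (A f)) h)" using E_adjoint[OF C] by simp
  finally show "Re (inner (A (E C f)) h) = Re (inner (E C (A f)) h)" .
qed

text \<open>The mass of a set \<open>X\<close> under \<open>\<mu> ?p\<close> minus
  \<open>\<mu> ?m\<close> is four times \<open>Re (inner (E X f) (A f))\<close>. By commutation this
  is the quadratic form at \<open>E X f\<close>, so the difference has density \<open>4 * x\<close>
  with respect to \<open>\<mu> f\<close>. Integrating \<open>x\<close> and polarising gives the
  claim.\<close>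

lemma inner_A_A:
  assumes f: "f \<in> D" and Af: "A f \<in> D"
  shows "Re (inner (A f) (A f)) = (\<integral>x. x\<^sup>2 \<partial>\<mu> f)"
proof -
  note [simp] = D_ell2[OF f] D_ell2[OF Af]
  let ?p = "\<lambda>v. f v + A f v" and ?m = "\<lambda>v. f v - A f v"
  have pm: "?p \<in> D" "?m \<in> D" using f Af D_add D_diff by auto
  have "(\<integral>x. x \<partial>\<mu> ?p) - (\<integral>x. x \<partial>\<mu> ?m) = 4 * (\<integral>x. x\<^sup>2 \<partial>\<mu> f)"
  proof (rule integral_signed_density)
    fix X :: "real set" assume X: "X \<in> sets borel"
    note [simp] = E_ell2[OF X]
    have "measure (\<mu> ?p) X - measure (\<mu> ?m) X = 4 * Re (inner (E X f) (A f))"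
      using X by (simp add: measure_pvm qf_polarisation ell2_add ell2_diff)
    also have "inner (E X f) (A f) = inner (E X f) (E X (A f))"
      using E_Int[OF X X, of f] E_adjoint[OF X, of "E X f" "A f"] by simp
    also have "E X (A f) = A (E X f)" by (rule A_E_commute[OF f X, symmetric])
    also have "Re (inner (E X f) (A (E X f))) = Re (inner (A (E X f)) (E X f))"
      by (subst ell2_inner_cnj) simp
    also have "\<dots> = (\<integral>x. x \<partial>\<mu> (E X f))" using form[OF E_D[OF f X]] by simp
    also have "\<dots> = (\<integral>x. indicator X x * x \<partial>\<mu> f)"
      using X by (subst pvm_measure_E[OF X])
        (simp_all add: integral_density[where g = "indicator X :: real \<Rightarrow> real", simplified ennreal_indicator])
    also have "4 * (\<integral>x. indicator X x * x \<partial>\<mu> f) = (\<integral>x. 4 * (indicator X x * x) \<partial>\<mu> f)"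
      by simp
    also have "\<dots> = (\<integral>x. indicator X x * (4 * x) \<partial>\<mu> f)"
      by (intro Bochner_Integration.integral_cong) simp_all
    finally show "measure (\<mu> ?p) X - measure (\<mu> ?m) X = (\<integral>x. indicator X x * (4 * x) \<partial>\<mu> f)" .
  next
    show "finite_measure (\<mu> ?p)" "finite_measure (\<mu> ?m)" "finite_measure (\<mu> f)"
      using finite_pvm D_ell2(1) pm f by blast+
    show "integrable (\<mu> ?p) (\<lambda>x. x)" "integrable (\<mu> ?m) (\<lambda>x. x)" "integrable (\<mu> f) (\<lambda>x. x)"
      by (intro integrable_id pm f)+
    show "integrable (\<mu> f) (\<lambda>x. x\<^sup>2)" using f D_iff by blast
  qed simp_all
  then show ?thesis using inner_A_polarisation[OF f Af] by simp
qed

text \<open>\<open>inner_A_A\<close> for \<open>E C f\<close> in place of \<open>f\<close>, for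
  every Borel set \<open>C\<close>.\<close>

lemma pvm_measure_A:
  assumes f: "f \<in> D" and Af: "A f \<in> D"
  shows "\<mu> (A f) = density (\<mu> f) (\<lambda>x. ennreal (x\<^sup>2))"
proof (rule measure_eqI)
  fix C assume "C \<in> sets (\<mu> (A f))"
  then have C: "C \<in> sets borel" by simp
  note [simp] = D_ell2[OF f] D_ell2[OF Af]
  have comm: "E C (A f) = A (E C f)" by (rule A_E_commute[OF f C, symmetric])
  have "qf C (A f) = Re (inner (A (E C f)) (A (E C f)))" using C by (simp add: qf_eq comm)
  also have "\<dots> = (\<integral>x. x\<^sup>2 \<partial>\<mu> (E C f))"
    using E_D[OF f C] E_D[OF Af C] by (intro inner_A_A) (simp_all add: comm)
  finally have "ennreal (qf C (A f)) = (\<integral>\<^sup>+x. ennreal (x\<^sup>2) \<partial>\<mu> (E C f))"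
    using E_D[OF f C] D_iff by (subst nn_integral_eq_integral) auto
  also have "\<dots> = (\<integral>\<^sup>+x. indicator C x * ennreal (x\<^sup>2) \<partial>\<mu> f)"
    using C by (subst pvm_measure_E[OF C]) (auto intro!: nn_integral_density)
  finally show "emeasure (\<mu> (A f)) C = emeasure (density (\<mu> f) (\<lambda>x. ennreal (x\<^sup>2))) C"
    using C by (simp add: emeasure_pvm emeasure_density mult.commute)
qed simp

end

section \<open>Even moments as walk counts\<close>

lemma walk_count_finite_support:
  assumes "\<And>x. finite (N x)"
    and sym: "\<And>u v. u \<in> N v \<Longrightarrow> v \<in> N u"
  shows "finite {v. walk_count N k v y \<noteq> 0}"
proof (induction k)
  case 0
  then show ?case by simp
next
  case (Suc k)
  have "{v. walk_count N (Suc k) v y \<noteq> 0} \<subseteq> (\<Union>z\<in>{v. walk_count N k v y \<noteq> 0}. N z)"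
  proof
    fix v assume "v \<in> {v. walk_count N (Suc k) v y \<noteq> 0}"
    then have "(\<Sum>z\<in>N v. walk_count N k z y) \<noteq> 0" by simp
    then obtain z where "z \<in> N v" "walk_count N k z y \<noteq> 0" by (rule sum.not_neutral_contains_not_neutral)
    then show "v \<in> (\<Union>z\<in>{v. walk_count N k v y \<noteq> 0}. N z)" using sym by auto
  qed
  then show ?case by (rule finite_subset) (use Suc assms in auto)
qed

lemma walk_count_sym:
  assumes "\<And>u v. u \<in> N v \<Longrightarrow> v \<in> N u" and fin: "\<And>v. finite (N v)"
  shows "walk_count N t x y = walk_count N t y x"
proof (induction t arbitrary: x y)
  case (Suc t)
  have "walk_count N (Suc t) y x = (\<Sum>z\<in>N x. walk_count N t y z)"
    by (rule walk_count_Suc_right[OF assms])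
  also have "\<dots> = (\<Sum>z\<in>N x. walk_count N t z y)" by (intro sum.cong refl Suc)
  finally show ?case by simp
qed auto

text \<open>Splits a walk at its vertex after \<open>i\<close> steps. The set \<open>S\<close> only
  has to contain the support, so one set can serve several lengths.\<close>

lemma walk_count_add:
  assumes fin: "\<And>x. finite (N x)" and S: "finite S" "{v. walk_count N j v y \<noteq> 0} \<subseteq> S"
  shows "walk_count N (i + j) x y = (\<Sum>v\<in>S. walk_count N i x v * walk_count N j v y)"
proof (induction i arbitrary: x)
  case 0
  have "(\<Sum>v\<in>S. of_bool (x = v) * walk_count N j v y) = (\<Sum>v\<in>S. if x = v then walk_count N j v y else 0)"
    by (intro sum.cong) auto
  also have "\<dots> = walk_count N j x y" using S by auto
  finally show ?case by simp
next
  case (Suc i)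
  then show ?case by (simp add: sum_distrib_right) (rule sum.swap)
qed

text \<open>The vectors \<open>f k\<close> are the iterates of the operator on the indicator of
  \<open>r\<close>. Their spectral measures have densities \<open>x ^ (2 * k)\<close>, and the total
  mass is the squared norm, which counts pairs of walks of length \<open>k\<close> from
  \<open>r\<close> to a common vertex.\<close>

lemma spectral_measure_moments:
  assumes G: "simple_graph G" "locally_finite_graph G" and r: "r \<in> verts G"
    and \<kappa>: "spectral_measure_at G (indicator {r}) \<kappa>"
  shows "(\<integral>\<^sup>+x. ennreal (x ^ (2 * k)) \<partial>\<kappa>) = of_nat (walk_count (nbrs G) (2 * k) r r)"
proof -
  obtain E where E: "spectral_resolution G E" "\<kappa> = pvm_measure (verts G) E (indicator {r})"
    using \<kappa> by (auto simp: spectral_measure_at_def)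
  interpret adjacency_resolution G E using G E by unfold_locales
  let ?N = "nbrs G"
  have fin: "finite (?N v)" for v using G 
simple_graph_nbrs(4)[OF G(1), of v]
    by (cases "v \<in> verts G") (auto simp: locally_finite_graph_def)
  have sym: "u \<in> ?N v \<Longrightarrow> v \<in> ?N u" for u v using G by (auto simp: simple_graph_def nbrs_def sym_def)
  have out: "walk_count ?N k v r = 0" if "v \<notin> verts G" for v k
  proof -
    have "?N v = {}" using that G by (auto simp: simple_graph_def nbrs_def)
    then show ?thesis using that r by (cases k) auto
  qed
  define f where "f k v = complex_of_nat (walk_count ?N k v r)" for k v
  note supp = walk_count_finite_support[of ?N, OF fin sym]
  have fD: "f k \<in> D" for k using supp[of k r] out by (intro finite_support_D) (auto simp: f_def)
  have Af: "A (f k) = f (Suc k)" for k by (auto simp: adjacency_op_def f_def)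
  have f0: "f 0 = indicator {r}" by (auto simp: f_def indicator_def)
  have dens: "\<mu> (f k) = density \<kappa> (\<lambda>x. ennreal (x ^ (2 * k)))" for k
  proof (induction k)
    case 0
    show ?case by (simp add: f0 E(2) density_1)
  next
    case (Suc k)
    have [measurable_cong]: "sets \<kappa> = sets borel" by (simp add: E(2))
    have "\<mu> (f (Suc k)) = density (density \<kappa> (\<lambda>x. ennreal (x ^ (2 * k)))) (\<lambda>x. ennreal (x\<^sup>2))"
      using pvm_measure_A[OF fD, of k] fD[of "Suc k"] by (simp add: Af Suc)
    also have "\<dots> = density \<kappa> (\<lambda>x. ennreal (x ^ (2 * Suc k)))"
    proof (subst density_density_eq)
      have "ennreal (x ^ (2 * k)) * ennreal (x\<^sup>2) = ennreal (x ^ (2 * Suc k))" for x :: real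
        by (subst ennreal_mult''[symmetric]) (auto simp: power2_eq_square mult_ac)
      then show "density \<kappa> (\<lambda>x. ennreal (x ^ (2 * k)) * ennreal (x\<^sup>2)) = density \<kappa> (\<lambda>x. ennreal (x ^ (2 * Suc k)))"
        by simp
    qed measurable
    finally show ?case .
  qed
  have "(\<integral>\<^sup>+x. ennreal (x ^ (2 * k)) \<partial>\<kappa>) = emeasure (\<mu> (f k)) UNIV"
    unfolding dens by (subst emeasure_density) (auto simp: E(2))
  also have "\<dots> = ennreal (Re (inner (f k) (f k)))"
    using fD D_ell2 by (simp add: emeasure_pvm qf_def E_UNIV)
  also have "inner (f k) (f k) = (\<Sum>v | f k v \<noteq> 0. f k v * cnj (f k v))"
    using supp[of k r] out by (intro ell2_inner_finite_support) (auto simp: f_def)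
  also have "\<dots> = of_nat (\<Sum>v | walk_count ?N k v r \<noteq> 0. walk_count ?N k r v * walk_count ?N k v r)"
    using walk_count_sym[of ?N, OF sym fin] by (simp add: f_def)
  also have "(\<Sum>v | walk_count ?N k v r \<noteq> 0. walk_count ?N k r v * walk_count ?N k v r) = walk_count ?N (k + k) r r"
    by (intro walk_count_add[symmetric] fin supp) auto
  finally show ?thesis by (simp add: ennreal_of_nat_eq_real_of_nat mult_2)
qed

section \<open>Universal covers\<close>

text \<open>The endpoint is stored at the head, so that \<open>hd\<close> is the covering map and
  \<open>tl\<close> is the parent in the tree.\<close>

primrec nb_walks :: "('v \<Rightarrow> 'v set) \<Rightarrow> 'v \<Rightarrow> nat \<Rightarrow> 'v list set" where
  "nb_walks N x 0 = {[x]}"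
| "nb_walks N x (Suc n) = {y # s | s y. s \<in> nb_walks N x n \<and> y \<in> N (hd s) \<and> (tl s \<noteq> [] \<longrightarrow> y \<noteq> hd (tl s))}"

definition nb_tree :: "('v \<Rightarrow> 'v set) \<Rightarrow> 'v \<Rightarrow> 'v list ugraph" where
  "nb_tree N x = (let V = (\<Union>n. nb_walks N x n) in 
     \<lparr>verts = V, adj = {(s, t). s \<in> V \<and> t \<in> V \<and> (tl s = t \<or> tl t = s)}\<rparr>)"

lemma verts_nb_tree: "verts (nb_tree N x) = (\<Union>n. nb_walks N x n)"
  by (simp add: nb_tree_def Let_def)

lemma adj_nb_tree: "(s, t) \<in> adj (nb_tree N x) \<longleftrightarrow> 
    s \<in> verts (nb_tree N x) \<and> t \<in> verts (nb_tree N x) \<and> (tl s = t \<or> tl t = s)"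
  by (simp add: nb_tree_def Let_def)

lemma nb_walks_length: "s \<in> nb_walks N x n \<Longrightarrow> length s = Suc n"
  by (induction n arbitrary: s) auto

lemma nb_walks_last: "s \<in> nb_walks N x n \<Longrightarrow> last s = x"
proof (induction n arbitrary: s)
  case (Suc n)
  then obtain t y where "s = y # t" "t \<in> nb_walks N x n" by auto
  with Suc.IH[of t] nb_walks_length[of t N x n] show ?case by auto
qed auto

lemma nb_walks_tl: "s \<in> nb_walks N x n \<Longrightarrow> tl s \<noteq> [] \<Longrightarrow> n = Suc (n - 1) \<and> tl s \<in> nb_walks N x (n - 1) \<and> hd s \<in> N (hd (tl s))"
  by (cases n) auto

lemma nb_tree_verts_nonempty: "s \<in> verts (nb_tree N x) \<Longrightarrow> s \<noteq> []"
  using nb_walks_length by (fastforce simp: verts_nb_tree)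

lemma nb_tree_verts_last: "s \<in> verts (nb_tree N x) \<Longrightarrow> last s = x"
  using nb_walks_last by (fastforce simp: verts_nb_tree)

lemma nb_tree_root: "[x] \<in> verts (nb_tree N x)"
  unfolding verts_nb_tree by (rule UN_I[of 0]) auto

lemma nb_tree_Cons: 
  assumes "s \<in> verts (nb_tree N x)" "y \<in> N (hd s)" "tl s \<noteq> [] \<Longrightarrow> y \<noteq> hd (tl s)"
  shows "y # s \<in> verts (nb_tree N x)"
proof -
  obtain n where "s \<in> nb_walks N x n" using assms(1) by (auto simp: verts_nb_tree)
  then have "y # s \<in> nb_walks N x (Suc n)" using assms by auto
  then show ?thesis unfolding verts_nb_tree by blast
qed

lemma nb_tree_ConsD: "y # s \<in> verts (nb_tree N x) \<Longrightarrow> s \<noteq> [] \<Longrightarrow> 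
    s \<in> verts (nb_tree N x) \<and> y \<in> N (hd s) \<and> (tl s \<noteq> [] \<longrightarrow> y \<noteq> hd (tl s))"
proof -
  assume "y # s \<in> verts (nb_tree N x)" and s: "s \<noteq> []"
  then obtain n where n: "y # s \<in> nb_walks N x n" by (auto simp: verts_nb_tree)
  with s show ?thesis by (cases n) (auto simp: verts_nb_tree)
qed

locale loc_fin_graph =
  fixes G :: "'v ugraph" and x
  assumes G: "simple_graph G" "locally_finite_graph G" "connected_graph G" and x: "x \<in> verts G"
begin

abbreviation "N \<equiv> nbrs G"
abbreviation "T \<equiv> nb_tree (nbrs G) x"

lemma finN: "finite (N v)"
  using G simple_graph_nbrs(4)[OF G(1)] by (cases "v \<in> verts G") (auto simp: locally_finite_graph_def)

lemma vertsN: "u \<in> N v \<Longrightarrow> u \<in> verts G" using simple_graph_nbrs(1)[OF G(1)] by blast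

lemma symN: "u \<in> N v \<Longrightarrow> v \<in> N u" by (rule simple_graph_nbrs(3)[OF G(1)])

lemma nbrs_T: "s \<in> verts T \<Longrightarrow> 
    nbrs T s = {y # s | y. y \<in> N (hd s) \<and> (tl s \<noteq> [] \<longrightarrow> y \<noteq> hd (tl s))} \<union> (if tl s = [] then {} else {tl s})"
proof -
  assume s: "s \<in> verts T"
  define P where "P t \<longleftrightarrow> (\<exists>y. t = y # s \<and> y \<in> N (hd s) \<and> (tl s \<noteq> [] \<longrightarrow> y \<noteq> hd (tl s)))" for t
  note ne = nb_tree_verts_nonempty[OF s]
  have 1: "t \<in> nbrs T s \<longleftrightarrow> t \<in> verts T \<and> (tl s = t \<or> tl t = s)" for t
    using s by (simp add: nbrs_def adj_nb_tree)
  have 2: "t \<in> verts T \<and> tl t = s \<longleftrightarrow> P t" for t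
  proof
    assume t: "t \<in> verts T \<and> tl t = s"
    then have "t = hd t # s" using nb_tree_verts_nonempty[of t N x] by (metis list.collapse)
    then show "P t" using nb_tree_ConsD[of "hd t" s N x] t ne unfolding P_def by metis
  next
    assume "P t"
    then show "t \<in> verts T \<and> tl t = s" using nb_tree_Cons[OF s] by (auto simp: P_def)
  qed
  have 3: "tl s \<in> verts T \<longleftrightarrow> tl s \<noteq> []"
    using nb_tree_ConsD[of "hd s" "tl s" N x] s nb_tree_verts_nonempty[of "tl s" N x] ne by (metis list.collapse)
  have "t \<in> nbrs T s \<longleftrightarrow> P t \<or> (tl s \<noteq> [] \<and> t = tl s)" for t
    using 1 2 3 by metis
  then show ?thesis by (auto simp: P_def)
qed

text \<open>The children of \<open>s\<close> carry all neighbours of \<open>hd s\<close> except the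
  one just left, and the parent carries that one.\<close>

lemma hd_T_bij: 
  assumes s: "s \<in> verts T"
  shows "bij_betw hd (nbrs T s) (N (hd s))"
proof -
  have bk: "tl s \<noteq> [] \<Longrightarrow> hd (tl s) \<in> N (hd s)"
    using nb_tree_ConsD[of "hd s" "tl s" N x] s nb_tree_verts_nonempty[OF s] symN by auto
  have "inj_on hd (nbrs T s)" unfolding nbrs_T[OF s] by (auto simp: inj_on_def split: if_splits)
  moreover have "y \<in> hd ` nbrs T s" if y: "y \<in> N (hd s)" for y
  proof (cases "tl s \<noteq> [] \<and> y = hd (tl s)")
    case True
    then have "tl s \<in> nbrs T s" unfolding nbrs_T[OF s] by simp
    then show ?thesis using True by blast
  next
    case False
    then have "y # s \<in> nbrs T s" unfolding nbrs_T[OF s] using y by auto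
    then show ?thesis by force
  qed
  moreover have "hd ` nbrs T s \<subseteq> N (hd s)" unfolding nbrs_T[OF s] using bk by (auto split: if_splits)
  ultimately show ?thesis by (auto simp: bij_betw_def)
qed

lemma simple_T: "simple_graph T"
proof -
  have "tl s \<noteq> s" if "s \<in> verts T" for s :: "'v list"
    using nb_tree_verts_nonempty[OF that] by (cases s) auto
  then show ?thesis by (auto simp: simple_graph_def adj_nb_tree sym_def irrefl_def)
qed

lemma locally_finite_T: "locally_finite_graph T"
  unfolding locally_finite_graph_def using hd_T_bij finN bij_betw_finite by blast

lemma T_reach: "s \<in> nb_walks N x n \<Longrightarrow> ([x], s) \<in> adj T ^^ n"
proof (induction n arbitrary: s)
  case (Suc n)
  then obtain t y where t: "s = y # t" "t \<in> nb_walks N x n" by auto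
  have "s \<in> verts T" "t \<in> verts T" using Suc.prems t(2) unfolding verts_nb_tree by blast+
  then have "(t, s) \<in> adj T" using t by (simp add: adj_nb_tree)
  then show ?case using Suc.IH[OF t(2)] by auto
qed auto

lemma connected_T: "connected_graph T"
proof -
  have r: "([x], s) \<in> (adj T)\<^sup>*" if "s \<in> verts T" for s
    using that T_reach relpow_imp_rtrancl by (fastforce simp: verts_nb_tree)
  have "sym ((adj T)\<^sup>*)" using simple_T by (auto simp: simple_graph_def intro: sym_rtrancl)
  then show ?thesis using r nb_tree_root[of x N] unfolding connected_graph_def 
    by (blast dest: symD intro: rtrancl_trans)
qed

text \<open>A longest walk on a cycle would have two different neighbours there, and both would have
  to be its tail.\<close>

lemma tree_T: "tree_graph T"
proof -
  have False if c: "is_cycle T c" for c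
  proof -
    have len: "length c \<ge> 3" and dist: "distinct c" and 
      a: "\<And>i. Suc i < length c \<Longrightarrow> (c ! i, c ! Suc i) \<in> adj T" "(last c, hd c) \<in> adj T"
      using c by (auto simp: is_cycle_def)
    let ?m = "Max (length ` set c)"
    have "c \<noteq> []" using len by auto
    then have "?m \<in> length ` set c" by (intro Max_in) auto
    then obtain i where i: "i < length c" "length (c ! i) = ?m" by (auto simp: in_set_conv_nth)
    \<comment> \<open>Cyclic successor and predecessor of \<open>i\<close>; they differ because a
      cycle has at least three vertices.\<close>
    define j where "j = (if Suc i < length c then Suc i else 0)"
    define k where "k = (if i = 0 then length c - 1 else i - 1)"
    have jk: "j < length c" "k < length c" "j \<noteq> k" using len i by (auto simp: j_def k_def)
    have symT: "(u, v) \<in> adj T \<Longrightarrow> (v, u) \<in> adj T" for u v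
      using simple_T by (auto simp: simple_graph_def sym_def)
    have adj_j: "(c ! i, c ! j) \<in> adj T"
    proof (cases "Suc i < length c")
      case False
      then have "length c - 1 = i" using i by simp
      then have "last c = c ! i" using \<open>c \<noteq> []\<close> by (simp add: last_conv_nth)
      then show ?thesis using a(2) False \<open>c \<noteq> []\<close> by (simp add: j_def hd_conv_nth)
    qed (use a(1) in \<open>simp add: j_def\<close>)
    have adj_k: "(c ! i, c ! k) \<in> adj T"
    proof (cases "i = 0")
      case True
      then show ?thesis using symT[OF a(2)] \<open>c \<noteq> []\<close> by (simp add: k_def hd_conv_nth last_conv_nth)
    next
      case False
      then show ?thesis using symT[OF a(1)[of "i - 1"]] i by (simp add: k_def)
    qed
    have "tl (c ! i) = c ! l" if "(c ! i, c ! l) \<in> adj T" "l < length c" for l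
    proof -
      have "length (c ! l) \<le> ?m" using that by (intro Max_ge) auto
      moreover have "c ! l \<in> verts T" using that by (simp add: adj_nb_tree)
      then have "c ! l \<noteq> []" by (rule nb_tree_verts_nonempty)
      ultimately have "tl (c ! l) \<noteq> c ! i" using i by (cases "c ! l") auto
      then show ?thesis using that by (simp add: adj_nb_tree)
    qed
    then have "c ! j = c ! k" using adj_j adj_k jk by metis
    then show False using dist jk by (simp add: nth_eq_iff_index_eq)
  qed
  then show ?thesis using simple_T connected_T by (auto simp: tree_graph_def)
qed

lemma hd_T_covering: "covering_map T G hd"
proof -
  have sub: "hd s \<in> verts G" if "s \<in> verts T" for s
  proof -
    obtain n where "s \<in> nb_walks N x n" using \<open>s \<in> verts T\<close> by (auto simp: verts_nb_tree)
    then show ?thesis using x vertsN by (cases n) auto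
  qed
  have "v \<in> hd ` verts T" if "(x, v) \<in> (adj G)\<^sup>*" for v
    using that
  proof (induction rule: rtrancl_induct)
    case base
    then show ?case using nb_tree_root[of x N] by force
  next
    case (step u v)
    then obtain s where s: "s \<in> verts T" "hd s = u" by auto
    then have "v \<in> hd ` nbrs T s" using hd_T_bij[OF s(1)] step(2) by (auto simp: bij_betw_def nbrs_def)
    then show ?case using simple_graph_nbrs(1)[OF simple_T] by blast
  qed
  then have "verts G \<subseteq> hd ` verts T" using G(3) x by (auto simp: connected_graph_def)
  moreover have "(hd s, hd t) \<in> adj G" if "(s, t) \<in> adj T" for s t
  proof -
    have "t \<in> nbrs T s" "s \<in> verts T" using that by (auto simp: nbrs_def adj_nb_tree)
    then show ?thesis using bij_betwE[OF hd_T_bij] by (auto simp: nbrs_def)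
  qed
  ultimately show ?thesis using sub hd_T_bij by (auto simp: covering_map_def)
qed

lemma valid_T: "valid_marked (T, \<lambda>_ :: unit. [x])"
  using simple_T locally_finite_T connected_T nb_tree_root by (auto simp: valid_marked_def)

lemma graph_ball_T: "graph_ball T [x] r = (\<Union>n\<le>r. nb_walks N x n)"
proof
  have "s \<in> verts T \<and> length s \<le> Suc k" if "([x], s) \<in> adj T ^^ k" for k s
    using that
  proof (induction k arbitrary: s)
    case 0
    then show ?case using nb_tree_root by auto
  next
    case (Suc k)
    then obtain t where t: "([x], t) \<in> adj T ^^ k" "(t, s) \<in> adj T" by auto
    then have "length s \<le> Suc (length t)" by (auto simp: adj_nb_tree)
    then show ?case using Suc.IH[OF t(1)] t(2) by (auto simp: adj_nb_tree)
  qed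
  then have "s \<in> verts T \<and> length s \<le> Suc r" if "s \<in> graph_ball T [x] r" for s
    using that by (force simp: graph_ball_def)
  then show "graph_ball T [x] r \<subseteq> (\<Union>n\<le>r. nb_walks N x n)"
    using nb_walks_length by (fastforce simp: verts_nb_tree)
  show "(\<Union>n\<le>r. nb_walks N x n) \<subseteq> graph_ball T [x] r"
    using T_reach by (auto simp: graph_ball_def)
qed

lemma nb_walks_head_ball: "s \<in> nb_walks N x n \<Longrightarrow> hd s \<in> graph_ball G x n"
proof -
  have "(x, hd s) \<in> adj G ^^ n" if "s \<in> nb_walks N x n" for s n
    using that
  proof (induction n arbitrary: s)
    case (Suc n)
    then obtain t y where t: "s = y # t" "t \<in> nb_walks N x n" "y \<in> N (hd t)" by auto
    then show ?case using Suc.IH[OF t(2)] by (auto simp: nbrs_def)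
  qed auto
  then show "s \<in> nb_walks N x n \<Longrightarrow> hd s \<in> graph_ball G x n" by (auto simp: graph_ball_def)
qed

end

section \<open>Transport of non-backtracking walks\<close>

text \<open>Bijectivity on neighbourhoods is asked only at endpoints of walks shorter than
  \<open>r\<close>, so that the lemma serves covering maps as well as isomorphisms of balls.\<close>

lemma nb_walks_bij:
  assumes sym: "\<And>u v. u \<in> N v \<Longrightarrow> v \<in> N u"
    and cov: "\<And>n s. n < r \<Longrightarrow> s \<in> nb_walks N x n \<Longrightarrow> bij_betw \<phi> (N (hd s)) (N' (\<phi> (hd s)))"
  shows "n \<le> r \<Longrightarrow> bij_betw (map \<phi>) (nb_walks N x n) (nb_walks N' (\<phi> x) n)"
proof (induction n)
  case 0
  then show ?case by (auto simp: bij_betw_def)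
next
  case (Suc n)
  then have IH: "bij_betw (map \<phi>) (nb_walks N x n) (nb_walks N' (\<phi> x) n)" and n: "n < r" by auto
  have ne: "s \<noteq> []" if "s \<in> nb_walks N x n" for s using nb_walks_length[OF that] by auto
  have bk: "hd (tl s) \<in> N (hd s)" if "s \<in> nb_walks N x n" "tl s \<noteq> []" for s
    using nb_walks_tl[OF that] sym by auto
  have hd: "hd (map \<phi> s) = \<phi> (hd s)" "tl (map \<phi> s) \<noteq> [] \<longleftrightarrow> tl s \<noteq> []" 
    "tl s \<noteq> [] \<Longrightarrow> hd (tl (map \<phi> s)) = \<phi> (hd (tl s))" if "s \<in> nb_walks N x n" for s
    using ne[OF that] by (auto simp: hd_map map_tl simp flip: map_tl)
  show ?case unfolding bij_betw_def
  proof
    show "inj_on (map \<phi>) (nb_walks N x (Suc n))"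
    proof (rule inj_onI)
      fix a b assume a: "a \<in> nb_walks N x (Suc n)" and b: "b \<in> nb_walks N x (Suc n)" and eq: "map \<phi> a = map \<phi> b"
      obtain y s where s: "a = y # s" "s \<in> nb_walks N x n" "y \<in> N (hd s)" using a by auto
      obtain z t where t: "b = z # t" "t \<in> nb_walks N x n" "z \<in> N (hd t)" using b by auto
      have "s = t" using eq s t bij_betw_imp_inj_on[OF IH] by (auto dest: inj_onD)
      moreover have "\<phi> y = \<phi> z" using eq s t by simp
      ultimately have "y = z" using s t bij_betw_imp_inj_on[OF cov[OF n s(2)]] by (auto dest: inj_onD)
      then show "a = b" using s t \<open>s = t\<close> by simp
    qed
    show "map \<phi> ` nb_walks N x (Suc n) = nb_walks N' (\<phi> x) (Suc n)"
    proof (intro equalityI subsetI)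
      fix a assume "a \<in> map \<phi> ` nb_walks N x (Suc n)"
      then obtain b where b: "b \<in> nb_walks N x (Suc n)" "a = map \<phi> b" by blast
      then obtain y s where "b = y # s" and s': "s \<in> nb_walks N x n" "y \<in> N (hd s)"
        "tl s \<noteq> [] \<longrightarrow> y \<noteq> hd (tl s)" by auto
      with b have s: "a = map \<phi> (y # s)" "s \<in> nb_walks N x n" "y \<in> N (hd s)" 
        "tl s \<noteq> [] \<longrightarrow> y \<noteq> hd (tl s)" by auto
      note c = cov[OF n s(2)]
      have "map \<phi> s \<in> nb_walks N' (\<phi> x) n" using IH s by (auto simp: bij_betw_def)
      moreover have "\<phi> y \<in> N' (hd (map \<phi> s))" using c s hd[OF s(2)] by (auto simp: bij_betw_def)
      moreover have "\<phi> y \<noteq> hd (tl (map \<phi> s))" if "tl (map \<phi> s) \<noteq> []"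
        using that s(3,4) hd[OF s(2)] bk[OF s(2)] bij_betw_imp_inj_on[OF c] by (auto dest: inj_onD)
      ultimately show "a \<in> nb_walks N' (\<phi> x) (Suc n)" unfolding s(1) by simp
    next
      fix a assume "a \<in> nb_walks N' (\<phi> x) (Suc n)"
      then obtain y' s' where s': "a = y' # s'" "s' \<in> nb_walks N' (\<phi> x) n" "y' \<in> N' (hd s')" 
        "tl s' \<noteq> [] \<longrightarrow> y' \<noteq> hd (tl s')" by auto
      obtain s where s: "s \<in> nb_walks N x n" "s' = map \<phi> s" using IH s'(2) by (auto simp: bij_betw_def)
      have "y' \<in> \<phi> ` N (hd s)" using s' s hd[OF s(1)] cov[OF n s(1)] by (auto simp: bij_betw_def)
      then obtain y where y: "y \<in> N (hd s)" "y' = \<phi> y" by auto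
      have "tl s \<noteq> [] \<longrightarrow> y \<noteq> hd (tl s)" using s'(4) y s hd[OF s(1)] by auto
      then have "y # s \<in> nb_walks N x (Suc n)" using y s by simp
      then show "a \<in> map \<phi> ` nb_walks N x (Suc n)" using s' s y by force
    qed
  qed
qed

text \<open>The index set \<open>I\<close> is all of \<open>nat\<close> for whole trees and an
  initial segment for balls. Adjacency is preserved because it is expressed by \<open>tl\<close>,
  which commutes with \<open>map \<phi>\<close>.\<close>

lemma nb_tree_iso:
  assumes bij: "\<And>n. n \<in> I \<Longrightarrow> bij_betw (map \<phi>) (nb_walks N x n) (nb_walks N' x' n)"
    and I: "\<And>n m. n \<in> I \<Longrightarrow> m \<le> n \<Longrightarrow> m \<in> I" "0 \<in> I" and x': "x' = \<phi> x"
  shows "marked_isomorphic (induced_subgraph (nb_tree N x) (\<Union>n\<in>I. nb_walks N x n), \<lambda>_ :: unit. [x]) 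
    (induced_subgraph (nb_tree N' x') (\<Union>n\<in>I. nb_walks N' x' n), \<lambda>_. [x'])"
proof -
  let ?V = "\<Union>n\<in>I. nb_walks N x n" and ?V' = "\<Union>n\<in>I. nb_walks N' x' n"
  have v: "verts (nb_tree N x) \<inter> ?V = ?V" "verts (nb_tree N' x') \<inter> ?V' = ?V'"
    by (auto simp: verts_nb_tree)
  have inj: "inj_on (map \<phi>) ?V"
  proof (rule inj_onI)
    fix s t assume "s \<in> ?V" "t \<in> ?V" and eq: "map \<phi> s = map \<phi> t"
    then obtain n m where nm: "n \<in> I" "m \<in> I" "s \<in> nb_walks N x n" "t \<in> nb_walks N x m" by auto
    moreover have "n = m" using nb_walks_length[OF nm(3)] nb_walks_length[OF nm(4)] eq map_eq_imp_length_eq by fastforce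
    ultimately show "s = t" using bij_betw_imp_inj_on[OF bij[OF nm(1)]] eq by (auto dest: inj_onD)
  qed
  have im: "map \<phi> ` ?V = ?V'" unfolding image_UN using bij by (auto simp: bij_betw_def)
  have tl: "tl s \<in> ?V" if "s \<in> ?V" "tl s \<noteq> []" for s
    using that nb_walks_tl[of s N x] I by (metis UN_iff diff_le_self)
  have tl_iff: "(tl s = t) = (tl (map \<phi> s) = map \<phi> t)" if "s \<in> ?V" "t \<in> ?V" for s t
  proof
    assume eq: "tl (map \<phi> s) = map \<phi> t"
    have "t \<noteq> []" using that nb_walks_length by fastforce
    then have "tl s \<noteq> []" using eq by (cases s) auto
    then show "tl s = t" using tl[OF that(1)] that(2) inj eq by (auto simp flip: map_tl dest: inj_onD)
  qed (simp flip: map_tl)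
  have "(s, t) \<in> adj (nb_tree N x) \<longleftrightarrow> (map \<phi> s, map \<phi> t) \<in> adj (nb_tree N' x')" if "s \<in> ?V" "t \<in> ?V" for s t
  proof -
    have "map \<phi> s \<in> ?V'" "map \<phi> t \<in> ?V'" unfolding im[symmetric] using that by blast+
    then have "s \<in> verts (nb_tree N x)" "t \<in> verts (nb_tree N x)" 
      "map \<phi> s \<in> verts (nb_tree N' x')" "map \<phi> t \<in> verts (nb_tree N' x')"
      using that unfolding verts_nb_tree by blast+
    then show ?thesis using tl_iff that by (simp only: adj_nb_tree)
  qed
  then have "\<forall>s\<in>?V. \<forall>t\<in>?V. (s, t) \<in> adj (nb_tree N x) \<inter> ?V \<times> ?V \<longleftrightarrow> 
      (map \<phi> s, map \<phi> t) \<in> adj (nb_tree N' x') \<inter> ?V' \<times> ?V'"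
    using im by blast
  moreover have "bij_betw (map \<phi>) ?V ?V'" using inj im by (simp add: bij_betw_def)
  moreover have "map \<phi> [x] = [x']" using x' by simp
  ultimately show ?thesis unfolding marked_isomorphic_def prod.case induced_subgraph_def ugraph.simps v
    by (intro exI[of _ "map \<phi>"] conjI allI)
qed

section \<open>Uniqueness of the universal cover\<close>

text \<open>Non-backtracking walks without a fixed start; unlike \<open>nb_walks\<close> they can be
  reversed and joined.\<close>

fun nb_list :: "('v \<times> 'v) set \<Rightarrow> 'v list \<Rightarrow> bool" where
  "nb_list R [] = True"
| "nb_list R [x] = True"
| "nb_list R [x, y] = ((x, y) \<in> R)"
| "nb_list R (x # y # z # l) = ((x, y) \<in> R \<and> x \<noteq> z \<and> nb_list R (y # z # l))"

lemma nb_list_append: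
  "nb_list R (p @ [a]) \<Longrightarrow> nb_list R (a # q) \<Longrightarrow> (p \<noteq> [] \<Longrightarrow> q \<noteq> [] \<Longrightarrow> last p \<noteq> hd q) \<Longrightarrow> nb_list R (p @ a # q)"
proof (induction p rule: induct_list012)
  case (2 x)
  then show ?case by (cases q) auto
next
  case (3 x y zs)
  then show ?case by (cases zs) (auto split: if_splits)
qed auto

lemma nb_list_appendD: "nb_list R (p @ q) \<Longrightarrow> nb_list R p"
proof (induction p rule: induct_list012)
  case (3 x y zs)
  then show ?case by (cases zs; cases q) auto
qed auto

lemma nb_list_rev: "sym R \<Longrightarrow> nb_list R l \<Longrightarrow> nb_list R (rev l)"
proof (induction l rule: induct_list012)
  case (3 x y zs)
  have "nb_list R (y # zs)" using 3 by (cases zs) auto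
  then have 1: "nb_list R (rev zs @ [y])" using 3 by simp
  have "(x, y) \<in> R" using 3 by (cases zs) auto
  then have 2: "nb_list R (y # [x])" using 3 by (auto dest: symD)
  have "zs \<noteq> [] \<Longrightarrow> hd zs \<noteq> x" using 3 by (cases zs) auto
  then have "nb_list R (rev zs @ y # [x])" 
    using nb_list_append[OF 1 2] by (simp add: last_rev)
  then show ?case by simp
qed auto

lemma nb_list_nth: "nb_list R l \<Longrightarrow> Suc i < length l \<Longrightarrow> (l ! i, l ! Suc i) \<in> R"
proof (induction R l arbitrary: i rule: nb_list.induct)
  case (4 R x y z l)
  then show ?case by (cases i) auto
qed auto

lemma nb_list_nth2: "nb_list R l \<Longrightarrow> Suc (Suc i) < length l \<Longrightarrow> l ! i \<noteq> l ! Suc (Suc i)"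
proof (induction R l arbitrary: i rule: nb_list.induct)
  case (4 R x y z l)
  then show ?case by (cases i) auto
qed auto

text \<open>Two equal entries at the smallest possible distance \<open>d\<close> bound a cycle:
  distance 1 would be a loop and distance 2 a backtrack, so \<open>d\<close> is at least 3.\<close>

lemma tree_nb_list_distinct:
  assumes tree: "tree_graph G" and nb: "nb_list (adj G) s"
  shows "distinct s"
proof (rule ccontr)
  assume "\<not> distinct s"
  then obtain i0 j0 where "i0 < j0" "j0 < length s" "s ! i0 = s ! j0"
    by (metis distinct_conv_nth linorder_neqE_nat)
  define P where "P d \<longleftrightarrow> (\<exists>i. d > 0 \<and> i + d < length s \<and> s ! i = s ! (i + d))" for d
  have "P (j0 - i0)" unfolding P_def using \<open>i0 < j0\<close> \<open>j0 < length s\<close> \<open>s ! i0 = s ! j0\<close> 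
    by (intro exI[of _ i0]) auto
  then obtain d where d: "P d" "\<And>d'. d' < d \<Longrightarrow> \<not> P d'" using exists_least_iff[of P] by blast
  then obtain i where i: "d > 0" "i + d < length s" "s ! i = s ! (i + d)" by (auto simp: P_def)
  have irr: "(a, a) \<notin> adj G" for a using tree by (auto simp: tree_graph_def simple_graph_def irrefl_def)
  have "d \<noteq> 1"
  proof
    assume "d = 1"
    then have "(s ! i, s ! i) \<in> adj G" using nb_list_nth[OF nb, of i] i by simp
    then show False using irr by blast
  qed
  moreover have "d \<noteq> 2" using nb_list_nth2[OF nb, of i] i by auto
  ultimately have d3: "d \<ge> 3" using i by simp
  define c where "c = take d (drop i s)"
  have len: "length c = d" using i by (simp add: c_def)
  have nth: "c ! k = s ! (i + k)" if "k < d" for k using that i by (simp add: c_def)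
  have "distinct c" unfolding distinct_conv_nth len
  proof (intro allI impI)
    fix a b assume ab: "a < d" "b < d" "a \<noteq> b"
    have "c ! k \<noteq> c ! l" if kl: "k < l" "l < d" for k l
    proof
      assume "c ! k = c ! l"
      then have "P (l - k)" unfolding P_def using kl i by (intro exI[of _ "i + k"]) (auto simp: nth)
      then show False using d(2)[of "l - k"] kl by simp
    qed
    then show "c ! a \<noteq> c ! b" using ab by (metis linorder_neqE_nat)
  qed
  moreover have "(c ! k, c ! Suc k) \<in> adj G" if "Suc k < length c" for k
    using nb_list_nth[OF nb, of "i + k"] that i by (simp add: nth len)
  moreover have "(last c, hd c) \<in> adj G"
  proof -
    have "c \<noteq> []" using len i by auto
    then have "last c = s ! (i + d - 1)" "hd c = s ! (i + d)" 
      using i nth[of 0] nth[of "d - 1"] len by (auto simp: last_conv_nth hd_conv_nth)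
    then show ?thesis using nb_list_nth[OF nb, of "i + d - 1"] i by simp
  qed
  ultimately have "is_cycle G c" using d3 len by (simp add: is_cycle_def)
  then show False using tree by (auto simp: tree_graph_def)
qed

context loc_fin_graph begin

lemma nb_walks_nb_list: "s \<in> nb_walks N x n \<Longrightarrow> nb_list (adj G) s"
proof (induction n arbitrary: s)
  case (Suc n)
  then obtain y t where t: "s = y # t" "t \<in> nb_walks N x n" "y \<in> N (hd t)" "tl t \<noteq> [] \<longrightarrow> y \<noteq> hd (tl t)" by auto
  have "(y, hd t) \<in> adj G" using symN[OF t(3)] by (simp add: nbrs_def)
  moreover have "t \<noteq> []" using nb_walks_length[OF t(2)] by auto
  ultimately show ?case using Suc.IH[OF t(2)] t
    by (cases "(adj G, s)" rule: nb_list.cases) auto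
qed auto

text \<open>After the common suffix, which is the common beginning of the two walks, is removed, one
  remainder followed by the reverse of the other is a non-backtracking walk with equal ends, which a
  tree does not admit.\<close>

lemma tree_hd_inj:
  assumes tree: "tree_graph G" and s: "s \<in> verts T" and t: "t \<in> verts T" and eq: "hd s = hd t"
  shows "s = t"
proof -
  obtain p q c where c: "s = p @ c" "t = q @ c" "p = [] \<or> q = [] \<or> last p \<noteq> last q"
    using longest_common_suffix[of s t] by blast
  have ne: "s \<noteq> []" "t \<noteq> []" using nb_tree_verts_nonempty[OF s] nb_tree_verts_nonempty[OF t] by auto
  have nb: "nb_list (adj G) s" "nb_list (adj G) t" using s t nb_walks_nb_list by (auto simp: verts_nb_tree)
  note dist = tree_nb_list_distinct[OF tree nb(1)] tree_nb_list_distinct[OF tree nb(2)]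
  have "c \<noteq> []"
    using c ne nb_tree_verts_last[OF s] nb_tree_verts_last[OF t] by auto
  then obtain a c' where a: "c = a # c'" by (cases c) auto
  show ?thesis
  proof (cases "p = [] \<or> q = []")
    case True
    then show ?thesis
    proof
      assume "p = []"
      then show ?thesis using c eq a dist by (cases q) auto
    next
      assume "q = []"
      then show ?thesis using c eq a dist by (cases p) auto
    qed
  next
    case False
    have "nb_list (adj G) (p @ [a])" using nb(1) c a nb_list_appendD[of "adj G" "p @ [a]" c'] by simp
    moreover have "nb_list (adj G) (q @ [a])" using nb(2) c a nb_list_appendD[of "adj G" "q @ [a]" c'] by simp
    then have "nb_list (adj G) (rev (q @ [a]))" using G(1) by (intro nb_list_rev) (auto simp: simple_graph_def)
    ultimately have "nb_list (adj G) (p @ a # rev q)" using False c(3) 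
      by (simp add: nb_list_append hd_rev)
    then have "distinct (p @ a # rev q)" by (rule tree_nb_list_distinct[OF tree])
    moreover have "hd p = hd q" using eq c False by simp
    ultimately show ?thesis using False by (metis disjoint_iff distinct_append hd_in_set list.set_intros(2) set_rev)
  qed
qed

lemma tree_iso:
  assumes tree: "tree_graph G"
  shows "marked_isomorphic (T, \<lambda>_ :: unit. [x]) (G, \<lambda>_. x)"
proof -
  have cov: "hd ` verts T = verts G" "\<And>s t. (s, t) \<in> adj T \<Longrightarrow> (hd s, hd t) \<in> adj G"
    using hd_T_covering by (auto simp: covering_map_def)
  have "bij_betw hd (verts T) (verts G)" using tree_hd_inj[OF tree] cov by (auto simp: bij_betw_def inj_on_def)
  moreover have "(s, t) \<in> adj T" if s: "s \<in> verts T" and t: "t \<in> verts T" and "(hd s, hd t) \<in> adj G" for s t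
  proof -
    have "hd t \<in> hd ` nbrs T s" using hd_T_bij[OF s] that(3) by (auto simp: bij_betw_def nbrs_def)
    then obtain t' where t': "t' \<in> nbrs T s" "hd t = hd t'" by blast
    then have "t' = t" using tree_hd_inj[OF tree _ t] simple_graph_nbrs(1)[OF simple_T] by (metis subsetD)
    then show ?thesis using t' by (simp add: nbrs_def)
  qed
  ultimately show ?thesis unfolding marked_isomorphic_def prod.case using cov(2)
    by (intro exI[of _ hd]) auto
qed

end

lemma induced_subgraph_nb_tree: "induced_subgraph (nb_tree N x) (\<Union>n. nb_walks N x n) = nb_tree N x"
proof -
  have "adj (nb_tree N x) \<subseteq> verts (nb_tree N x) \<times> verts (nb_tree N x)" by (auto simp: adj_nb_tree)
  then show ?thesis unfolding verts_nb_tree[symmetric] induced_subgraph_def by (simp add: Int_absorb2)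
qed

text \<open>A tree is isomorphic to its own tree of non-backtracking walks, and the covering map
  carries these bijectively to those of \<open>G\<close>.\<close>

lemma tree_cover_iso_nb_tree:
  assumes H: "loc_fin_graph H h" and G: "loc_fin_graph G x" and tree: "tree_graph H" 
    and cov: "covering_map H G \<pi>" "\<pi> h = x"
  shows "marked_isomorphic (H, \<lambda>_ :: unit. h) (nb_tree (nbrs G) x, \<lambda>_. [x])"
proof -
  interpret H: loc_fin_graph H h by fact
  interpret G: loc_fin_graph G x by fact
  have hd: "hd s \<in> verts H" if "s \<in> nb_walks (nbrs H) h n" for s n
    using H.hd_T_covering that by (force simp: covering_map_def verts_nb_tree)
  have "bij_betw (map \<pi>) (nb_walks (nbrs H) h n) (nb_walks (nbrs G) x n)" for n
    unfolding cov(2)[symmetric] using cov(1) hd H.symN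
    by (intro nb_walks_bij[where r = n]) (auto simp: covering_map_def)
  then have "marked_isomorphic (induced_subgraph (nb_tree (nbrs H) h) (\<Union>n. nb_walks (nbrs H) h n), \<lambda>_ :: unit. [h])
      (induced_subgraph (nb_tree (nbrs G) x) (\<Union>n. nb_walks (nbrs G) x n), \<lambda>_. [x])"
    using cov(2) by (intro nb_tree_iso[where \<phi> = \<pi>]) simp_all
  then have "marked_isomorphic (nb_tree (nbrs H) h, \<lambda>_ :: unit. [h]) (nb_tree (nbrs G) x, \<lambda>_. [x])"
    by (simp only: induced_subgraph_nb_tree)
  moreover have "marked_isomorphic (H, \<lambda>_ :: unit. h) (nb_tree (nbrs H) h, \<lambda>_. [h])"
    by (rule marked_isomorphic_sym[OF H.valid_T H.tree_iso[OF tree]])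
  ultimately show ?thesis using marked_isomorphic_trans by blast
qed

section \<open>Balls and local isomorphisms\<close>

lemma relpow_hom: "(\<And>u v. (u, v) \<in> R \<Longrightarrow> (f u, f v) \<in> S) \<Longrightarrow> (x, y) \<in> R ^^ k \<Longrightarrow> (f x, f y) \<in> S ^^ k"
  by (induction k arbitrary: y) auto

lemma graph_ball_Suc: "u \<in> graph_ball G x i \<Longrightarrow> v \<in> nbrs G u \<Longrightarrow> v \<in> graph_ball G x (Suc i)"
proof -
  assume "u \<in> graph_ball G x i" "v \<in> nbrs G u"
  then obtain k where "k \<le> i" "(x, u) \<in> adj G ^^ k" "(u, v) \<in> adj G" by (auto simp: graph_ball_def nbrs_def)
  then show ?thesis unfolding graph_ball_def by (auto intro!: exI[of _ "Suc k"])
qed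

lemma graph_ball_mono: "i \<le> j \<Longrightarrow> graph_ball G x i \<subseteq> graph_ball G x j"
proof
  fix v assume "i \<le> j" "v \<in> graph_ball G x i"
  then obtain k where "k \<le> j" "(x, v) \<in> adj G ^^ k" unfolding graph_ball_def using le_trans by blast
  then show "v \<in> graph_ball G x j" unfolding graph_ball_def by blast
qed

lemma relpow_verts: "simple_graph G \<Longrightarrow> x \<in> verts G \<Longrightarrow> (x, v) \<in> adj G ^^ k \<Longrightarrow> v \<in> verts G"
  by (cases k) (auto simp: simple_graph_def)

lemma graph_ball_verts: 
  assumes "simple_graph G" "x \<in> verts G" 
  shows "graph_ball G x r \<subseteq> verts G"
proof
  fix v assume "v \<in> graph_ball G x r"
  then obtain k where "(x, v) \<in> adj G ^^ k" unfolding graph_ball_def by blast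
  then show "v \<in> verts G" by (rule relpow_verts[OF assms])
qed

lemma induced_ball_relpow: 
  "(x, v) \<in> adj G ^^ k \<Longrightarrow> k \<le> r \<Longrightarrow> (x, v) \<in> adj (induced_subgraph G (graph_ball G x r)) ^^ k"
proof (induction k arbitrary: v)
  case (Suc k)
  then obtain u where u: "(x, u) \<in> adj G ^^ k" "(u, v) \<in> adj G" by auto
  have "k \<le> r" using Suc.prems by simp
  then have "u \<in> graph_ball G x r" "v \<in> graph_ball G x r" 
    using u(1) Suc.prems unfolding graph_ball_def by blast+
  then show ?case using Suc.IH[OF u(1)] u(2) Suc.prems by (auto simp: induced_subgraph_def)
qed auto

text \<open>Full neighbourhoods are matched only at distance less than \<open>r\<close>, where all
  neighbours still lie in the ball.\<close>

lemma ball_iso_local: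
  assumes G: "loc_fin_graph G x" and H: "loc_fin_graph H y"
    and iso: "marked_isomorphic (induced_subgraph G (graph_ball G x r), \<lambda>_ :: unit. x) 
      (induced_subgraph H (graph_ball H y r), \<lambda>_. y)"
  obtains \<phi> where "\<phi> x = y" "inj_on \<phi> (graph_ball G x r)" 
    "\<And>i u. i < r \<Longrightarrow> u \<in> graph_ball G x i \<Longrightarrow> bij_betw \<phi> (nbrs G u) (nbrs H (\<phi> u))"
proof -
  interpret G: loc_fin_graph G x by fact
  interpret H: loc_fin_graph H y by fact
  let ?B = "graph_ball G x" and ?C = "graph_ball H y"
  have v: "verts (induced_subgraph G (?B r)) = ?B r" "verts (induced_subgraph H (?C r)) = ?C r"
    using graph_ball_verts[OF G.G(1) G.x] graph_ball_verts[OF H.G(1) H.x] by (auto simp: induced_subgraph_def)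
  obtain \<phi> where bij: "bij_betw \<phi> (?B r) (?C r)" and root: "\<phi> x = y" 
    and adj: "\<And>u w. u \<in> ?B r \<Longrightarrow> w \<in> ?B r \<Longrightarrow> (u, w) \<in> adj G \<longleftrightarrow> (\<phi> u, \<phi> w) \<in> adj H"
  proof -
    obtain \<phi> where p: "bij_betw \<phi> (?B r) (?C r)" "\<phi> x = y" 
      "\<forall>u\<in>?B r. \<forall>w\<in>?B r. (u, w) \<in> adj (induced_subgraph G (?B r)) \<longleftrightarrow> (\<phi> u, \<phi> w) \<in> adj (induced_subgraph H (?C r))"
      using iso unfolding marked_isomorphic_def prod.case v by blast
    have "\<phi> u \<in> ?C r" if "u \<in> ?B r" for u using p(1) that by (auto simp: bij_betw_def)
    then show ?thesis using that[OF p(1,2)] p(3) by (auto simp: induced_subgraph_def)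
  qed
  \<comment> \<open>Paths of length at most \<open>r\<close> from the root stay in the ball, so
    \<phi> does not increase the distance to the root.\<close>
  have hom: "\<phi> u \<in> ?C i" if b: "u \<in> ?B i" "i \<le> r" for u i
  proof -
    obtain k where k: "k \<le> i" "(x, u) \<in> adj G ^^ k" using b(1) by (auto simp: graph_ball_def)
    then have "(x, u) \<in> adj (induced_subgraph G (?B r)) ^^ k" using b(2) by (intro induced_ball_relpow) auto
    then have "(\<phi> x, \<phi> u) \<in> adj H ^^ k"
      by (rule relpow_hom[rotated]) (use adj in \<open>auto simp: induced_subgraph_def\<close>)
    then show ?thesis using k root by (auto simp: graph_ball_def)
  qed
  have "bij_betw \<phi> (nbrs G u) (nbrs H (\<phi> u))" if i: "i < r" and u: "u \<in> ?B i" for i u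
  proof -
    have ur: "u \<in> ?B r" using u i graph_ball_mono[of i r G x] by auto
    have nr: "nbrs G u \<subseteq> ?B r" using graph_ball_Suc[OF u] graph_ball_mono[of "Suc i" r G x] i by auto
    have nC: "nbrs H (\<phi> u) \<subseteq> ?C r" 
      using graph_ball_Suc[OF hom[OF u]] graph_ball_mono[of "Suc i" r H y] i by auto
    have "\<phi> ` nbrs G u = nbrs H (\<phi> u)"
    proof (intro equalityI subsetI)
      fix b assume "b \<in> \<phi> ` nbrs G u"
      then show "b \<in> nbrs H (\<phi> u)" using adj ur nr by (auto simp: nbrs_def)
    next
      fix b assume b: "b \<in> nbrs H (\<phi> u)"
      then obtain a where "a \<in> ?B r" "b = \<phi> a" using nC bij by (auto simp: bij_betw_def)
      then show "b \<in> \<phi> ` nbrs G u" using adj[OF ur, of a] b by (auto simp: nbrs_def)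
    qed
    moreover have "inj_on \<phi> (nbrs G u)" using bij nr by (auto simp: bij_betw_def intro: inj_on_subset)
    ultimately show ?thesis by (simp add: bij_betw_def)
  qed
  then show ?thesis using that root bij by (auto simp: bij_betw_def)
qed

text \<open>With \<open>t\<close> steps left at distance \<open>i\<close>, the condition
  \<open>i + t \<le> r\<close> keeps the walk where \<phi> matches neighbourhoods.\<close>

lemma walk_count_local:
  assumes loc: "\<And>i u. i < r \<Longrightarrow> u \<in> graph_ball G x i \<Longrightarrow> bij_betw \<phi> (nbrs G u) (nbrs H (\<phi> u))"
    and inj: "inj_on \<phi> (graph_ball G x r)"
  shows "u \<in> graph_ball G x i \<Longrightarrow> i + t \<le> r \<Longrightarrow> 
    walk_count (nbrs G) t u x = walk_count (nbrs H) t (\<phi> u) (\<phi> x)"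
proof (induction t arbitrary: i u)
  case 0
  have "x \<in> graph_ball G x r" by (auto simp: graph_ball_def intro!: exI[of _ 0])
  moreover have "u \<in> graph_ball G x r" using 0 graph_ball_mono[of i r G x] by auto
  ultimately show ?case using inj by (auto dest: inj_onD)
next
  case (Suc t)
  have "walk_count (nbrs G) (Suc t) u x = (\<Sum>z\<in>nbrs G u. walk_count (nbrs H) t (\<phi> z) (\<phi> x))"
    using Suc.IH[OF graph_ball_Suc[OF Suc.prems(1)]] Suc.prems by simp
  also have "\<dots> = (\<Sum>z\<in>nbrs H (\<phi> u). walk_count (nbrs H) t z (\<phi> x))"
    using loc[OF _ Suc.prems(1)] Suc.prems by (intro sum.reindex_bij_betw) auto
  finally show ?case by simp
qed

text \<open>Walks lift uniquely; the inequality is due to walks whose lift ends at another vertex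
  above \<open>\<pi> v\<close>.\<close>

lemma walk_count_covering:
  assumes H: "loc_fin_graph H h" and cov: "covering_map H G \<pi>"
  shows "u \<in> verts H \<Longrightarrow> walk_count (nbrs H) t u v \<le> walk_count (nbrs G) t (\<pi> u) (\<pi> v)"
proof (induction t arbitrary: u)
  case (Suc t)
  interpret loc_fin_graph H h by fact
  have "walk_count (nbrs H) (Suc t) u v \<le> (\<Sum>z\<in>nbrs H u. walk_count (nbrs G) t (\<pi> z) (\<pi> v))"
    using Suc.IH vertsN by (auto intro: sum_mono)
  also have "\<dots> = (\<Sum>z\<in>nbrs G (\<pi> u). walk_count (nbrs G) t z (\<pi> v))"
    using cov Suc.prems by (intro sum.reindex_bij_betw) (auto simp: covering_map_def)
  finally show ?case by simp
qed auto

lemma card_closed_walks: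
  assumes "loc_fin_graph G x"
  shows "card (closed_walks k G x) = walk_count (nbrs G) k x x"
proof -
  interpret loc_fin_graph G x by fact
  define W where "W k u v = {w. length w = Suc k \<and> hd w = u \<and> last w = v \<and> set w \<subseteq> verts G \<and> (\<forall>i<k. (w ! i, w ! Suc i) \<in> adj G)}" for k u v
  have "finite (W k u v) \<and> card (W k u v) = walk_count N k u v" if "u \<in> verts G" for k u v
    using that
  proof (induction k arbitrary: u)
    case 0
    have "W 0 u v = (if u = v then {[u]} else {})"
      using 0 by (auto simp: W_def length_Suc_conv)
    then show ?case by simp
  next
    case (Suc k)
    have eq: "W (Suc k) u v = (\<Union>z\<in>N u. (#) u ` W k z v)"
    proof (intro equalityI subsetI)
      fix w assume w: "w \<in> W (Suc k) u v"
      then obtain w' where w': "w = u # w'" "length w' = Suc k" by (auto simp: W_def length_Suc_conv)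
      then obtain z w'' where z: "w' = z # w''" by (cases w') auto
      have step: "(w ! i, w ! Suc i) \<in> adj G" if "i < Suc k" for i using w that by (auto simp: W_def)
      have "z \<in> N u" using step[of 0] w' z by (simp add: nbrs_def)
      moreover have "w' \<in> W k z v" using w w' z step[of "Suc i" for i] by (auto simp: W_def)
      ultimately show "w \<in> (\<Union>z\<in>N u. (#) u ` W k z v)" using w' by blast
    next
      fix w assume "w \<in> (\<Union>z\<in>N u. (#) u ` W k z v)"
      then obtain z w' where z: "z \<in> N u" "w = u # w'" "w' \<in> W k z v" by blast
      have "w' \<noteq> []" "hd w' = z" using z(3) by (auto simp: W_def)
      then have "w' ! 0 = z" by (simp add: hd_conv_nth)
      then show "w \<in> W (Suc k) u v" using z Suc.prems by (auto simp: W_def nbrs_def nth_Cons split: nat.split)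
    qed
    have IH: "finite (W k z v)" "card (W k z v) = walk_count N k z v" if "z \<in> N u" for z
      using Suc.IH[OF vertsN[OF that]] by auto
    have "card (W (Suc k) u v) = (\<Sum>z\<in>N u. card ((#) u ` W k z v))"
      unfolding eq by (intro card_UN_disjoint finN ballI impI finite_imageI IH) (auto simp: W_def)
    also have "\<dots> = walk_count N (Suc k) u v" by (simp add: card_image IH)
    finally show ?case unfolding eq using IH finN by auto
  qed
  moreover have "closed_walks k G x = W k x x" by (auto simp: closed_walks_def W_def)
  ultimately show ?thesis using x by simp
qed

lemma marked_isomorphic_balls:
  assumes G: "loc_fin_graph G x" and H: "loc_fin_graph H y"
    and iso: "marked_isomorphic (G, \<lambda>_ :: unit. x) (H, \<lambda>_. y)"
  shows "marked_isomorphic (induced_subgraph G (graph_ball G x r), \<lambda>_ :: unit. x) 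
      (induced_subgraph H (graph_ball H y r), \<lambda>_. y)"
proof -
  interpret G: loc_fin_graph G x by fact
  interpret H: loc_fin_graph H y by fact
  obtain \<phi> where bij: "bij_betw \<phi> (verts G) (verts H)" and root: "\<phi> x = y" 
    and adj: "\<And>u w. u \<in> verts G \<Longrightarrow> w \<in> verts G \<Longrightarrow> (u, w) \<in> adj G \<longleftrightarrow> (\<phi> u, \<phi> w) \<in> adj H"
    using iso unfolding marked_isomorphic_def prod.case by blast
  let ?\<psi> = "inv_into (verts G) \<phi>"
  have \<psi>: "?\<psi> y = x" using bij_betw_inv_into_left[OF bij G.x] root by simp
  have ball1: "\<phi> v \<in> graph_ball H y r" if b: "v \<in> graph_ball G x r" for v
  proof -
    obtain k where k: "k \<le> r" "(x, v) \<in> adj G ^^ k" using b by (auto simp: graph_ball_def)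
    have "(\<phi> x, \<phi> v) \<in> adj H ^^ k"
      by (rule relpow_hom[OF _ k(2)]) (use adj G.G(1) in \<open>auto simp: simple_graph_def\<close>)
    then show ?thesis using k root by (auto simp: graph_ball_def)
  qed
  have ball2: "?\<psi> v \<in> graph_ball G x r" if b: "v \<in> graph_ball H y r" for v
  proof -
    obtain k where k: "k \<le> r" "(y, v) \<in> adj H ^^ k" using b by (auto simp: graph_ball_def)
    have "(?\<psi> u, ?\<psi> w) \<in> adj G" if "(u, w) \<in> adj H" for u w
    proof -
      have uw: "u \<in> verts H" "w \<in> verts H" using that H.G(1) by (auto simp: simple_graph_def)
      then show ?thesis using that adj[of "?\<psi> u" "?\<psi> w"] bij_betw_inv_into_right[OF bij] 
        bij_betw_apply[OF bij_betw_inv_into[OF bij]] by simp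
    qed
    then have "(?\<psi> y, ?\<psi> v) \<in> adj G ^^ k" by (rule relpow_hom[OF _ k(2)])
    then show ?thesis using k \<psi> by (auto simp: graph_ball_def)
  qed
  have sub: "graph_ball G x r \<subseteq> verts G" "graph_ball H y r \<subseteq> verts H"
    using graph_ball_verts[OF G.G(1) G.x] graph_ball_verts[OF H.G(1) H.x] by auto
  have im: "\<phi> ` graph_ball G x r = graph_ball H y r"
  proof (intro equalityI subsetI)
    fix b assume b: "b \<in> graph_ball H y r"
    then have "b = \<phi> (?\<psi> b)" using sub bij_betw_inv_into_right[OF bij] by auto
    then show "b \<in> \<phi> ` graph_ball G x r" using ball2[OF b] by blast
  qed (use ball1 in auto)
  then have "bij_betw \<phi> (graph_ball G x r) (graph_ball H y r)"
    using bij sub by (auto simp: bij_betw_def intro: inj_on_subset)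
  moreover have "\<forall>u\<in>graph_ball G x r. \<forall>v\<in>graph_ball G x r. 
      ((u, v) \<in> adj G \<inter> graph_ball G x r \<times> graph_ball G x r) =
      ((\<phi> u, \<phi> v) \<in> adj H \<inter> graph_ball H y r \<times> graph_ball H y r)"
    using adj sub ball1 by blast
  moreover have "verts G \<inter> graph_ball G x r = graph_ball G x r" "verts H \<inter> graph_ball H y r = graph_ball H y r"
    using sub by auto
  ultimately show ?thesis unfolding marked_isomorphic_def prod.case induced_subgraph_def ugraph.simps
    using root by (intro exI[of _ \<phi>]) simp
qed

section \<open>Isomorphism classes and their representatives\<close>

lemma valid_marked_rep: "valid_marked (rep_marked_graph g)"
  using Quotient3_rep_reflp[OF Quotient3_marked_graph, of g] by (simp add: marked_equiv_def)

lemma marked_graph_eqI: "marked_isomorphic (rep_marked_graph g) (rep_marked_graph h) \<Longrightarrow> g = h"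
  using Quotient3_rel_rep[OF Quotient3_marked_graph, of g h] by (simp add: marked_equiv_def valid_marked_rep)

lemma marked_isomorphic_rep_abs: "valid_marked y \<Longrightarrow> marked_isomorphic (rep_marked_graph (abs_marked_graph y)) y"
  using Quotient3_rep_abs[OF Quotient3_marked_graph, of y]
  by (simp add: marked_equiv_def marked_isomorphic_refl)

lemma rep_rooted: "rep_marked_graph g = (graph g, \<lambda>_ :: unit. origin g)"
  by (rule prod_eqI) (auto simp: graph_def origin_def roots_def)

lemma valid_rooted: "valid_marked (graph g, \<lambda>_ :: unit. origin g)"
  using valid_marked_rep[of g] by (simp only: rep_rooted)

lemma loc_fin_graph_rooted: "loc_fin_graph (graph g) (origin g)"
  using valid_rooted[of g] by unfold_locales (auto simp: valid_marked_def)

lemma root_nbhd_rooted: "root_nbhd r g = 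
    (induced_subgraph (graph g) (graph_ball (graph g) (origin g) r), \<lambda>_ :: unit. origin g)"
proof -
  have "roots g = (\<lambda>_. origin g)" by (auto simp: origin_def)
  then show ?thesis by (simp add: root_nbhd_def)
qed

text \<open>Moves the tree of lists onto natural numbers through \<open>to_nat\<close>, as
  representatives of classes have vertices in \<open>nat\<close>.\<close>

lemma image_graph_iso:
  assumes f: "inj f" and U: "valid_marked (U, \<lambda>_ :: unit. u)"
  defines "F \<equiv> \<lparr>verts = f ` verts U, adj = map_prod f f ` adj U\<rparr>"
  shows "valid_marked (F, \<lambda>_ :: unit. f u)" "marked_isomorphic (F, \<lambda>_ :: unit. f u) (U, \<lambda>_. u)"
proof -
  have adj: "(f a, f b) \<in> adj F \<longleftrightarrow> (a, b) \<in> adj U" for a b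
    using f by (auto simp: F_def map_prod_def inj_eq dest: injD)
  have nb: "nbrs F (f a) = f ` nbrs U a" for a
    using f by (auto simp: F_def nbrs_def map_prod_def inj_eq dest: injD)
  have "(f a, f b) \<in> (adj F)\<^sup>*" if "(a, b) \<in> (adj U)\<^sup>*" for a b
    using that adj by (induction rule: rtrancl_induct) (auto intro: rtrancl_into_rtrancl)
  then have "connected_graph F" using U by (auto simp: valid_marked_def connected_graph_def F_def)
  moreover have "simple_graph F"
    using U f by (auto simp: valid_marked_def simple_graph_def F_def sym_def irrefl_def inj_eq)
  moreover have "locally_finite_graph F" using U nb 
    by (auto simp: valid_marked_def locally_finite_graph_def F_def)
  ultimately show valid: "valid_marked (F, \<lambda>_ :: unit. f u)" using U by (auto simp: valid_marked_def F_def)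
  have "marked_isomorphic (U, \<lambda>_ :: unit. u) (F, \<lambda>_. f u)"
    unfolding marked_isomorphic_def prod.case using adj f
    by (intro exI[of _ f]) (auto simp: F_def bij_betw_def intro: inj_on_subset)
  then show "marked_isomorphic (F, \<lambda>_ :: unit. f u) (U, \<lambda>_. u)"
    by (rule marked_isomorphic_sym[OF U])
qed

lemma tree_graph_iso:
  assumes K: "simple_graph K" "connected_graph K" and H: "tree_graph H"
    and adj: "\<And>u v. (u, v) \<in> adj K \<Longrightarrow> (\<psi> u, \<psi> v) \<in> adj H" and inj: "inj_on \<psi> (verts K)"
  shows "tree_graph K"
proof -
  have False if c: "is_cycle K c" for c
  proof -
    have sub: "set c \<subseteq> verts K"
    proof
      fix v assume "v \<in> set c"
      then obtain i where i: "i < length c" "v = c ! i" by (auto simp: in_set_conv_nth)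
      have len: "length c \<ge> 3" using c by (simp add: is_cycle_def)
      have "(c ! i, c ! Suc i) \<in> adj K" if "Suc i < length c" using c that by (simp add: is_cycle_def)
      moreover have "(c ! (i - 1), c ! i) \<in> adj K" if "\<not> Suc i < length c"
      proof -
        have "\<forall>j. Suc j < length c \<longrightarrow> (c ! j, c ! Suc j) \<in> adj K" using c by (simp add: is_cycle_def)
        moreover have "Suc (i - 1) = i" using that i len by simp
        ultimately show ?thesis using i(1) by metis
      qed
      ultimately show "v \<in> verts K" using K i by (auto simp: simple_graph_def)
    qed
    have "c \<noteq> []" using c by (auto simp: is_cycle_def)
    then have "is_cycle H (map \<psi> c)"
      using c sub inj adj by (auto simp: is_cycle_def distinct_map last_map hd_map intro: inj_on_subset)
    then show False using H by (auto simp: tree_graph_def)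
  qed
  then show ?thesis using K by (auto simp: tree_graph_def)
qed

lemma covering_map_comp_iso:
  assumes K: "simple_graph K" and H: "simple_graph H" and bij: "bij_betw \<psi> (verts K) (verts H)"
    and adj: "\<And>u v. u \<in> verts K \<Longrightarrow> v \<in> verts K \<Longrightarrow> (u, v) \<in> adj K \<longleftrightarrow> (\<psi> u, \<psi> v) \<in> adj H"
    and cov: "covering_map H G \<pi>"
  shows "covering_map K G (\<pi> \<circ> \<psi>)"
proof -
  have nb: "bij_betw \<psi> (nbrs K u) (nbrs H (\<psi> u))" if u: "u \<in> verts K" for u
  proof -
    have sub: "nbrs K u \<subseteq> verts K" by (rule simple_graph_nbrs(1)[OF K])
    have "b \<in> \<psi> ` nbrs K u" if b: "b \<in> nbrs H (\<psi> u)" for b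
    proof -
      have "b \<in> verts H" using b simple_graph_nbrs(1)[OF H] by auto
      then obtain a where a: "a \<in> verts K" "b = \<psi> a" using bij by (auto simp: bij_betw_def)
      then show ?thesis using adj[OF u a(1)] b by (auto simp: nbrs_def)
    qed
    moreover have "\<psi> a \<in> nbrs H (\<psi> u)" if "a \<in> nbrs K u" for a
      using that sub adj[OF u, of a] by (auto simp: nbrs_def)
    moreover have "inj_on \<psi> (nbrs K u)" using bij sub by (auto simp: bij_betw_def intro: inj_on_subset)
    ultimately show ?thesis by (auto simp: bij_betw_def)
  qed
  have 1: "(\<pi> \<circ> \<psi>) ` verts K = verts G"
  proof -
    have "(\<pi> \<circ> \<psi>) ` verts K = \<pi> ` (\<psi> ` verts K)" by (rule image_comp[symmetric])
    then show ?thesis using cov bij by (simp only: covering_map_def bij_betw_def)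
  qed
  have 2: "(\<pi> (\<psi> u), \<pi> (\<psi> v)) \<in> adj G" if "(u, v) \<in> adj K" for u v
  proof -
    have "u \<in> verts K" "v \<in> verts K" using that K by (auto simp: simple_graph_def)
    then have "(\<psi> u, \<psi> v) \<in> adj H" using adj that by blast
    then show ?thesis using cov by (auto simp: covering_map_def)
  qed
  have 3: "bij_betw (\<pi> \<circ> \<psi>) (nbrs K u) (nbrs G (\<pi> (\<psi> u)))" if u: "u \<in> verts K" for u
  proof (rule bij_betw_trans[OF nb[OF u]])
    have "\<psi> u \<in> verts H" using bij u by (auto simp: bij_betw_def)
    then show "bij_betw \<pi> (nbrs H (\<psi> u)) (nbrs G (\<pi> (\<psi> u)))" using cov by (auto simp: covering_map_def)
  qed
  show ?thesis unfolding covering_map_def using 1 2 3 by auto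
qed

lemma universal_cover_exists:
  "\<exists>t. tree_graph (graph t) \<and> (\<exists>\<pi>. covering_map (graph t) (graph g) \<pi> \<and> \<pi> (origin t) = origin g)"
proof -
  interpret loc_fin_graph "graph g" "origin g" by (rule loc_fin_graph_rooted)
  define F where "F = \<lparr>verts = to_nat ` verts T, adj = map_prod to_nat to_nat ` adj T\<rparr>"
  let ?t = "abs_marked_graph (F, \<lambda>_ :: unit. to_nat [origin g])"
  note F = image_graph_iso[OF inj_to_nat valid_T, folded F_def]
  have "marked_isomorphic (graph ?t, \<lambda>_ :: unit. origin ?t) (F, \<lambda>_. to_nat [origin g])"
    using marked_isomorphic_rep_abs[OF F(1)] by (simp add: rep_rooted)
  then have "marked_isomorphic (graph ?t, \<lambda>_ :: unit. origin ?t) (T, \<lambda>_. [origin g])"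
    using F(2) by (rule marked_isomorphic_trans)
  then obtain \<psi> where \<psi>: "bij_betw \<psi> (verts (graph ?t)) (verts T)" "\<psi> (origin ?t) = [origin g]"
    "\<And>u v. u \<in> verts (graph ?t) \<Longrightarrow> v \<in> verts (graph ?t) \<Longrightarrow> (u, v) \<in> adj (graph ?t) \<longleftrightarrow> (\<psi> u, \<psi> v) \<in> adj T"
    unfolding marked_isomorphic_def prod.case by blast
  interpret t: loc_fin_graph "graph ?t" "origin ?t" by (rule loc_fin_graph_rooted)
  have "tree_graph (graph ?t)"
    using \<psi> t.G by (intro tree_graph_iso[OF _ _ tree_T]) (auto simp: bij_betw_def simple_graph_def)
  moreover have "covering_map (graph ?t) (graph g) (hd \<circ> \<psi>)"
    by (rule covering_map_comp_iso[OF t.G(1) simple_T \<psi>(1,3) hd_T_covering])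
  ultimately show ?thesis using \<psi>(2) by (intro exI[of _ ?t]) auto
qed

text \<open>Justifies the definite description in \<open>universal_cover\<close>: any two candidates
  are isomorphic to the same tree of non-backtracking walks.\<close>

lemma universal_cover_covers:
  "tree_graph (graph (universal_cover g))"
  "\<exists>\<pi>. covering_map (graph (universal_cover g)) (graph g) \<pi> \<and> \<pi> (origin (universal_cover g)) = origin g"
proof -
  let ?P = "\<lambda>t. tree_graph (graph t) \<and> (\<exists>\<pi>. covering_map (graph t) (graph g) \<pi> \<and> \<pi> (origin t) = origin g)"
  interpret loc_fin_graph "graph g" "origin g" by (rule loc_fin_graph_rooted)
  have iso: "marked_isomorphic (graph t, \<lambda>_ :: unit. origin t) (T, \<lambda>_. [origin g])" if "?P t" for t
    using that tree_cover_iso_nb_tree[OF loc_fin_graph_rooted loc_fin_graph_rooted] by blast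
  have "t = t'" if "?P t" "?P t'" for t t'
  proof (rule marked_graph_eqI)
    have "marked_isomorphic (T, \<lambda>_ :: unit. [origin g]) (graph t', \<lambda>_. origin t')"
      by (rule marked_isomorphic_sym[OF valid_rooted iso[OF that(2)]])
    then show "marked_isomorphic (rep_marked_graph t) (rep_marked_graph t')"
      unfolding rep_rooted using iso[OF that(1)] marked_isomorphic_trans by blast
  qed
  then have "\<exists>!t. ?P t" using universal_cover_exists[of g] by blast
  from theI'[OF this] show "tree_graph (graph (universal_cover g))"
    "\<exists>\<pi>. covering_map (graph (universal_cover g)) (graph g) \<pi> \<and> \<pi> (origin (universal_cover g)) = origin g"
    unfolding universal_cover_def by blast+
qed

section \<open>Local functions on rooted graphs\<close>

definition root_walks :: "nat \<Rightarrow> rooted_graph \<Rightarrow> nat" where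
  "root_walks k g = card (closed_walks k (graph g) (origin g))"

lemma root_walks_eq: "root_walks k g = walk_count (nbrs (graph g)) k (origin g) (origin g)"
  by (simp add: root_walks_def card_closed_walks[OF loc_fin_graph_rooted])

lemma root_walks_universal_cover: "root_walks k (universal_cover g) \<le> root_walks k g"
proof -
  interpret t: loc_fin_graph "graph (universal_cover g)" "origin (universal_cover g)" by (rule loc_fin_graph_rooted)
  obtain \<pi> where \<pi>: "covering_map (graph (universal_cover g)) (graph g) \<pi>" "\<pi> (origin (universal_cover g)) = origin g"
    using universal_cover_covers(2) by blast
  show ?thesis unfolding root_walks_eq
    using walk_count_covering[OF t.loc_fin_graph_axioms \<pi>(1) t.x, of k "origin (universal_cover g)"] \<pi>(2) by simp
qed

lemma root_walks_local:
  assumes "marked_isomorphic (root_nbhd k g) (root_nbhd k h)"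
  shows "root_walks k g = root_walks k h"
proof -
  obtain \<phi> where \<phi>: "\<phi> (origin g) = origin h" "inj_on \<phi> (graph_ball (graph g) (origin g) k)"
    "\<And>i u. i < k \<Longrightarrow> u \<in> graph_ball (graph g) (origin g) i \<Longrightarrow> bij_betw \<phi> (nbrs (graph g) u) (nbrs (graph h) (\<phi> u))"
    using ball_iso_local[OF loc_fin_graph_rooted loc_fin_graph_rooted assms[unfolded root_nbhd_rooted]] by blast
  have "origin g \<in> graph_ball (graph g) (origin g) 0" by (simp add: graph_ball_def)
  from walk_count_local[OF \<phi>(3,2) this, where t = k] show ?thesis by (simp add: root_walks_eq \<phi>(1))
qed

text \<open>The ball of radius \<open>r\<close> in the cover consists of the non-backtracking walks
  of length at most \<open>r\<close>, and these stay in the ball of radius \<open>r\<close> of the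
  base.\<close>

lemma universal_cover_local:
  assumes iso: "marked_isomorphic (root_nbhd r g) (root_nbhd r h)"
  shows "marked_isomorphic (root_nbhd r (universal_cover g)) (root_nbhd r (universal_cover h))"
proof -
  have cover: "marked_isomorphic (graph (universal_cover g), \<lambda>_ :: unit. origin (universal_cover g)) 
      (nb_tree (nbrs (graph g)) (origin g), \<lambda>_. [origin g])" for g
    using universal_cover_covers[of g] tree_cover_iso_nb_tree[OF loc_fin_graph_rooted loc_fin_graph_rooted] by blast
  have tree: "loc_fin_graph (nb_tree (nbrs (graph g)) (origin g)) [origin g]" for g
  proof -
    interpret loc_fin_graph "graph g" "origin g" by (rule loc_fin_graph_rooted)
    show ?thesis by unfold_locales (use simple_T locally_finite_T connected_T nb_tree_root in auto)
  qed
  define B where "B g = (induced_subgraph (nb_tree (nbrs (graph g)) (origin g)) 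
      (\<Union>n\<in>{..r}. nb_walks (nbrs (graph g)) (origin g) n), \<lambda>_ :: unit. [origin g])" for g
  have ball: "graph_ball (nb_tree (nbrs (graph g)) (origin g)) [origin g] r = (\<Union>n\<in>{..r}. nb_walks (nbrs (graph g)) (origin g) n)" for g
    using loc_fin_graph.graph_ball_T[OF loc_fin_graph_rooted] by auto
  have 1: "marked_isomorphic (root_nbhd r (universal_cover g)) (B g)" for g
    using marked_isomorphic_balls[OF loc_fin_graph_rooted tree cover[of g], where r = r] 
    by (simp only: root_nbhd_rooted B_def ball)
  have 2: "marked_isomorphic (B g) (root_nbhd r (universal_cover g))" for g
  proof -
    have "marked_isomorphic (nb_tree (nbrs (graph g)) (origin g), \<lambda>_ :: unit. [origin g])
       (graph (universal_cover g), \<lambda>_. origin (universal_cover g))"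
      by (rule marked_isomorphic_sym[OF valid_rooted cover])
    from marked_isomorphic_balls[OF tree loc_fin_graph_rooted this, where r = r] show ?thesis
      by (simp only: root_nbhd_rooted B_def ball)
  qed
  interpret G: loc_fin_graph "graph g" "origin g" by (rule loc_fin_graph_rooted)
  obtain \<phi> where \<phi>: "\<phi> (origin g) = origin h" "inj_on \<phi> (graph_ball (graph g) (origin g) r)"
    "\<And>i u. i < r \<Longrightarrow> u \<in> graph_ball (graph g) (origin g) i \<Longrightarrow> bij_betw \<phi> (nbrs (graph g) u) (nbrs (graph h) (\<phi> u))"
    using ball_iso_local[OF loc_fin_graph_rooted loc_fin_graph_rooted iso[unfolded root_nbhd_rooted]] by blast
  have "bij_betw (map \<phi>) (nb_walks (nbrs (graph g)) (origin g) n) (nb_walks (nbrs (graph h)) (origin h) n)" if "n \<le> r" for n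
    unfolding \<phi>(1)[symmetric] using G.symN \<phi>(3) G.nb_walks_head_ball that by (intro nb_walks_bij[where r = r]) blast+
  then have BB: "marked_isomorphic (B g) (B h)"
    unfolding B_def by (intro nb_tree_iso[where \<phi> = \<phi>]) (auto simp: \<phi>(1))
  show ?thesis by (rule marked_isomorphic_trans[OF marked_isomorphic_trans[OF 1 BB] 2])
qed

lemma open_root_nbhd: "open {h. marked_isomorphic (root_nbhd r h) (root_nbhd r g)}"
  unfolding open_marked_graph_def by (intro generate_topology.Basis) blast

text \<open>A property determined by one neighbourhood of the root is a union of basic open sets. So
  is its negation, which makes such events clopen.\<close>

lemma open_local_property:
  assumes "\<And>g h. marked_isomorphic (root_nbhd r h) (root_nbhd r g) \<Longrightarrow> P g \<Longrightarrow> P h"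
  shows "open {g. P g}"
proof -
  have eq: "{g. P g} = (\<Union>g\<in>{g. P g}. {h. marked_isomorphic (root_nbhd r h) (root_nbhd r g)})"
    using assms marked_isomorphic_refl[of "root_nbhd r g" for g] by auto
  show ?thesis by (subst eq) (intro open_UN ballI open_root_nbhd)
qed

lemma open_root_walks: "open {g. P (root_walks k g)}"
proof (rule open_local_property[where r = k])
  fix g h assume iso: "marked_isomorphic (root_nbhd k h) (root_nbhd k g)" and "P (root_walks k g)"
  then show "P (root_walks k h)" using root_walks_local[OF iso] by simp
qed

lemma continuous_universal_cover: "continuous_on UNIV universal_cover"
proof -
  have "open (universal_cover -` U)" if "open U" for U
    using that unfolding open_marked_graph_def
  proof (induction rule: generate_topology.induct)
    case UNIV
    then show ?case by (simp add: generate_topology.UNIV)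
  next
    case (Int a b)
    then show ?case by (simp add: vimage_Int generate_topology.Int)
  next
    case (UN K)
    then show ?case unfolding vimage_Union by (intro generate_topology.UN) auto
  next
    case (Basis s)
    then obtain r g where s: "s = {h. marked_isomorphic (root_nbhd r h) (root_nbhd r g)}" by blast
    have "open {h. marked_isomorphic (root_nbhd r (universal_cover h)) (root_nbhd r g)}"
      by (rule open_local_property[where r = r]) (rule marked_isomorphic_trans[OF universal_cover_local])
    then show ?case by (simp add: s vimage_def open_marked_graph_def)
  qed
  then show ?thesis by (auto simp: continuous_on_open_vimage)
qed

lemma measurable_universal_cover: "universal_cover \<in> borel \<rightarrow>\<^sub>M borel"
  by (rule borel_measurable_continuous_onI[OF continuous_universal_cover])

lemma measurable_root_walks [measurable]: "root_walks k \<in> borel \<rightarrow>\<^sub>M count_space UNIV"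
proof (rule measurableI)
  fix A :: "nat set"
  have "root_walks k -` A = {g. root_walks k g \<in> A}" by auto
  then show "root_walks k -` A \<inter> space borel \<in> sets borel" using open_root_walks[of "\<lambda>m. m \<in> A" k] by auto
qed auto

section \<open>Unimodular networks\<close>

lemma root_walks_0: "root_walks 0 g = 1"
  by (simp add: root_walks_eq)

text \<open>Cauchy-Schwarz for the numbers of walks of lengths \<open>k\<close> and
  \<open>k + 2\<close> from a vertex \<open>v\<close> to the root, summed over
  \<open>v\<close>.\<close>

lemma root_walks_log_convex: 
  "(root_walks (2 * Suc k) g)\<^sup>2 \<le> root_walks (2 * k) g * root_walks (2 * Suc (Suc k)) g"
proof -
  interpret loc_fin_graph "graph g" "origin g" by (rule loc_fin_graph_rooted)
  let ?x = "origin g" and ?w = "walk_count N"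
  let ?S = "\<Union>i\<le>Suc (Suc k). {v. ?w i v ?x \<noteq> 0}"
  have S: "finite ?S" using walk_count_finite_support[of N, OF finN symN] by auto
  have split: "?w (i + j) ?x ?x = (\<Sum>v\<in>?S. ?w i v ?x * ?w j v ?x)" if "j \<le> Suc (Suc k)" for i j
  proof -
    have "?w (i + j) ?x ?x = (\<Sum>v\<in>?S. ?w i ?x v * ?w j v ?x)"
      using that by (intro walk_count_add finN S) auto
    then show ?thesis by (simp add: walk_count_sym[of N i ?x, OF symN finN])
  qed
  have "(real (?w (k + Suc (Suc k)) ?x ?x))\<^sup>2 = (\<Sum>v\<in>?S. real (?w k v ?x) * real (?w (Suc (Suc k)) v ?x))\<^sup>2"
    using split[of "Suc (Suc k)" k] by simp
  also have "\<dots> \<le> (\<Sum>v\<in>?S. (real (?w k v ?x))\<^sup>2) * (\<Sum>v\<in>?S. (real (?w (Suc (Suc k)) v ?x))\<^sup>2)"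
    by (rule Cauchy_Schwarz_ineq_sum)
  also have "\<dots> = real (?w (k + k) ?x ?x) * real (?w (Suc (Suc k) + Suc (Suc k)) ?x ?x)"
    using split[of k k] split[of "Suc (Suc k)" "Suc (Suc k)"] by (simp only: of_nat_sum of_nat_mult power2_eq_square le_refl le_SucI)
  finally have "real ((?w (k + Suc (Suc k)) ?x ?x)\<^sup>2) \<le> real (?w (k + k) ?x ?x * ?w (Suc (Suc k) + Suc (Suc k)) ?x ?x)"
    by simp
  then have "(?w (k + Suc (Suc k)) ?x ?x)\<^sup>2 \<le> ?w (k + k) ?x ?x * ?w (Suc (Suc k) + Suc (Suc k)) ?x ?x"
    by (simp only: of_nat_le_iff)
  moreover have "k + Suc (Suc k) = 2 * Suc k" "k + k = 2 * k" "Suc (Suc k) + Suc (Suc k) = 2 * Suc (Suc k)" by auto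
  ultimately show ?thesis by (simp only: root_walks_eq)
qed

text \<open>States without roots that the \<open>n\<close>-th root of \<open>r n\<close> increases
  with \<open>n\<close>. Log-convexity and the induction hypothesis bound
  \<open>b ^ (2 * Suc n)\<close> by \<open>b ^ n * c ^ Suc n\<close>, and \<open>b ^ n\<close>
  cancels.\<close>

lemma log_convex_power_le:
  fixes r :: "nat \<Rightarrow> real"
  assumes r: "r 0 = 1" "\<And>i. r i \<ge> 0"
  shows "(\<And>i. i < n \<Longrightarrow> (r (Suc i))\<^sup>2 \<le> r i * r (Suc (Suc i))) \<Longrightarrow> r n ^ Suc n \<le> r (Suc n) ^ n"
proof (induction n)
  case 0
  then show ?case using r by simp
next
  case (Suc n)
  define b where "b = r (Suc n)"
  define c where "c = r (Suc (Suc n))"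
  have bc: "b \<ge> 0" "c \<ge> 0" using r by (auto simp: b_def c_def)
  have IH: "r n ^ Suc n \<le> b ^ n" unfolding b_def using Suc by simp
  have "b\<^sup>2 \<le> r n * c" unfolding b_def c_def using Suc.prems[of n] by simp
  then have "(b\<^sup>2) ^ Suc n \<le> (r n * c) ^ Suc n" by (intro power_mono) auto
  also have "\<dots> = r n ^ Suc n * c ^ Suc n" by (rule power_mult_distrib)
  also have "\<dots> \<le> b ^ n * c ^ Suc n" using IH bc by (intro mult_right_mono) auto
  finally have *: "(b\<^sup>2) ^ Suc n \<le> b ^ n * c ^ Suc n" .
  have "b ^ Suc (Suc n) \<le> c ^ Suc n"
  proof (cases "b = 0")
    case False
    have "(b\<^sup>2) ^ Suc n = b ^ n * b ^ Suc (Suc n)"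
      by (simp add: power_mult[symmetric] power_add[symmetric] mult_2 del: power_Suc)
    then show ?thesis using * False bc by (simp del: power_Suc)
  qed (use bc in auto)
  then show ?case by (simp add: b_def c_def)
qed

text \<open>The counts are integers, so a drop would start from at least 1 and contradict the
  increase of roots. At \<open>k = 0\<close> an isolated root is a counterexample.\<close>

lemma root_walks_mono:
  assumes "k > 0"
  shows "root_walks (2 * k) g \<le> root_walks (2 * Suc k) g"
proof (rule ccontr)
  define r where "r k = real (root_walks (2 * k) g)" for k
  assume "\<not> ?thesis"
  then have lt: "r (Suc k) < r k" "r k \<ge> 1" by (auto simp: r_def)
  have "(r (Suc i))\<^sup>2 \<le> r i * r (Suc (Suc i))" for i
    unfolding r_def using root_walks_log_convex[of i g] by (simp only: of_nat_mult[symmetric] of_nat_power[symmetric] of_nat_le_iff)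
  then have "r k ^ Suc k \<le> r (Suc k) ^ k"
    by (intro log_convex_power_le) (auto simp: r_def root_walks_0)
  also have "\<dots> < r k ^ k" using lt assms by (intro power_strict_mono) (auto simp: r_def)
  also have "\<dots> \<le> r k ^ Suc k" using lt by (intro power_increasing) auto
  finally show False by simp
qed

lemma expected_closed_walks_eq: "expected_closed_walks M k = (\<integral>\<^sup>+g. of_nat (root_walks k g) \<partial>M)"
  by (simp add: expected_closed_walks_def root_walks_def)

text \<open>Cauchy-Schwarz once more, now under the expectation, for the square roots of the two
  outer counts.\<close>

lemma expected_closed_walks_log_convex:
  assumes [measurable_cong]: "sets M = sets borel"
  shows "(expected_closed_walks M (2 * Suc k))\<^sup>2 \<le> 
    expected_closed_walks M (2 * k) * expected_closed_walks M (2 * Suc (Suc k))"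
proof -
  define s where "s k g = ennreal (sqrt (root_walks (2 * k) g))" for k g
  have [measurable]: "s k \<in> borel_measurable M" for k unfolding s_def by measurable
  have sq: "(s k g)\<^sup>2 = of_nat (root_walks (2 * k) g)" for k g
    by (simp add: s_def ennreal_power ennreal_of_nat_eq_real_of_nat)
  have "of_nat (root_walks (2 * Suc k) g) \<le> s k g * s (Suc (Suc k)) g" for g
  proof -
    have "real ((root_walks (2 * Suc k) g)\<^sup>2) \<le> real (root_walks (2 * k) g * root_walks (2 * Suc (Suc k)) g)"
      using root_walks_log_convex[of k g] by (simp only: of_nat_le_iff)
    then have "real (root_walks (2 * Suc k) g) \<le> sqrt (real (root_walks (2 * k) g) * real (root_walks (2 * Suc (Suc k)) g))"
      by (intro real_le_rsqrt) simp
    then show ?thesis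
      by (simp only: s_def ennreal_mult[symmetric] real_sqrt_ge_zero of_nat_0_le_iff real_sqrt_mult 
          ennreal_of_nat_eq_real_of_nat ennreal_leI)
  qed
  then have "expected_closed_walks M (2 * Suc k) \<le> (\<integral>\<^sup>+g. s k g * s (Suc (Suc k)) g \<partial>M)"
    unfolding expected_closed_walks_eq by (intro nn_integral_mono)
  then have "(expected_closed_walks M (2 * Suc k))\<^sup>2 \<le> (\<integral>\<^sup>+g. s k g * s (Suc (Suc k)) g \<partial>M)\<^sup>2"
    by (intro power_mono) auto
  also have "\<dots> \<le> (\<integral>\<^sup>+g. (s k g)\<^sup>2 \<partial>M) * (\<integral>\<^sup>+g. (s (Suc (Suc k)) g)\<^sup>2 \<partial>M)"
    by (rule Cauchy_Schwarz_nn_integral) auto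
  finally show ?thesis by (simp only: sq expected_closed_walks_eq)
qed

definition walk_growth :: "rooted_graph measure \<Rightarrow> nat \<Rightarrow> ereal" where
  "walk_growth M k = (if expected_closed_walks M (2 * k) = \<infinity> then \<infinity>
     else ereal (root (2 * k) (enn2real (expected_closed_walks M (2 * k)))))"

text \<open>Makes the \<open>lim\<close> in \<open>spectral_radius\<close> a supremum, so that every
  number below the radius is exceeded at a single \<open>k\<close>.\<close>

lemma incseq_walk_growth:
  assumes M: "random_rooted_graph M"
  shows "incseq (walk_growth M)"
proof (rule incseq_SucI)
  fix n
  let ?a = "\<lambda>k. expected_closed_walks M (2 * k)"
  interpret prob_space M using M by (simp add: random_rooted_graph_def)
  have sets: "sets M = sets borel" using M by (simp add: random_rooted_graph_def)
  have mono: "?a k \<le> ?a (Suc k)" if "k > 0" for k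
    unfolding expected_closed_walks_eq by (intro nn_integral_mono) (use root_walks_mono[OF that] in auto)
  have a0: "?a 0 = 1" by (simp add: expected_closed_walks_eq root_walks_0 emeasure_space_1)
  show "walk_growth M n \<le> walk_growth M (Suc n)"
  proof (cases "?a (Suc n) = \<infinity>")
    case True
    then show ?thesis by (simp add: walk_growth_def)
  next
    case False
    \<comment> \<open>Finiteness descends by monotonicity from \<open>Suc n\<close>; at 0, where
      monotonicity may fail, the expectation is 1.\<close>
    have fin: "?a k < \<infinity>" if "k \<le> Suc n" for k
      using that
    proof (induction rule: inc_induct)
      case (step k)
      then show ?case using mono[of k] a0 by (cases "k = 0") auto
    qed (use False in \<open>simp add: less_top\<close>)
    define r where "r k = enn2real (?a k)" for k
    have r: "ennreal (r k) = ?a k" if "k \<le> Suc n" for k using fin[OF that] by (simp add: r_def)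
    have "r n ^ Suc n \<le> r (Suc n) ^ n"
    proof (rule log_convex_power_le)
      fix i assume i: "i < n"
      have "ennreal ((r (Suc i))\<^sup>2) \<le> ennreal (r i * r (Suc (Suc i)))"
        using expected_closed_walks_log_convex[OF sets, of i] r[of i] r[of "Suc i"] r[of "Suc (Suc i)"] i
        by (simp add: r_def ennreal_mult flip: ennreal_power)
      then show "(r (Suc i))\<^sup>2 \<le> r i * r (Suc (Suc i))" by (simp add: r_def ennreal_le_iff)
    qed (use a0 in \<open>auto simp: r_def\<close>)
    moreover have "root (2 * n) (r n) \<le> root (2 * Suc n) (r (Suc n))" if n: "n > 0"
    proof -
      define x where "x = root (2 * n) (r n)"
      define y where "y = root (2 * Suc n) (r (Suc n))"
      have r0: "r k \<ge> 0" for k by (simp add: r_def)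
      have xy: "x \<ge> 0" "y \<ge> 0" using r0 by (simp_all add: x_def y_def real_root_ge_zero)
      have xr: "x ^ (2 * n) = r n" unfolding x_def using n r0 by (intro real_root_pow_pos2) auto
      have yr: "y ^ (2 * Suc n) = r (Suc n)" unfolding y_def using r0 by (intro real_root_pow_pos2) auto
      have "x ^ (2 * n * Suc n) \<le> y ^ (2 * Suc n * n)"
        using \<open>r n ^ Suc n \<le> r (Suc n) ^ n\<close> power_mult[of x "2 * n" "Suc n"] power_mult[of y "2 * Suc n" n]
        by (simp only: xr yr)
      moreover have "2 * Suc n * n = 2 * n * Suc n" by simp
      ultimately have "x ^ (2 * n * Suc n) \<le> y ^ (2 * n * Suc n)" by metis
      then have "x \<le> y" by (subst (asm) power_mono_iff) (use xy n in auto)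
      then show ?thesis by (simp add: x_def y_def)
    qed
    \<comment> \<open>At \<open>n = 0\<close> the value is 0 by the convention for
      \<open>root 0\<close>.\<close>
    ultimately show ?thesis using False fin[of n] 
      by (cases "n = 0") (auto simp: walk_growth_def r_def)
  qed
qed

lemma spectral_radius_eq_SUP:
  assumes "random_rooted_graph M"
  shows "spectral_radius M = (SUP k. walk_growth M k)"
proof -
  have "walk_growth M \<longlonglongrightarrow> (SUP k. walk_growth M k)"
    by (rule LIMSEQ_SUP[OF incseq_walk_growth[OF assms]])
  moreover have "spectral_radius M = lim (walk_growth M)"
    by (simp add: spectral_radius_def walk_growth_def[abs_def])
  ultimately show ?thesis by (simp add: limI)
qed

lemma random_rooted_graph_universal_cover:
  assumes "random_rooted_graph M"
  shows "random_rooted_graph (universal_cover_network M)"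
proof -
  interpret prob_space M using assms by (simp add: random_rooted_graph_def)
  have "universal_cover \<in> M \<rightarrow>\<^sub>M borel"
    using assms measurable_universal_cover measurable_cong_sets[of M borel] by (auto simp: random_rooted_graph_def)
  then show ?thesis by (auto simp: random_rooted_graph_def universal_cover_network_def intro: prob_space_distr)
qed

lemma expected_closed_walks_universal_cover_le:
  assumes M: "random_rooted_graph M"
  shows "expected_closed_walks (universal_cover_network M) k \<le> expected_closed_walks M k"
proof -
  have "universal_cover \<in> M \<rightarrow>\<^sub>M borel"
    using assms measurable_universal_cover measurable_cong_sets[of M borel] by (auto simp: random_rooted_graph_def)
  moreover have "(\<lambda>g. of_nat (root_walks k g) :: ennreal) \<in> borel_measurable borel" by measurable
  ultimately have "expected_closed_walks (universal_cover_network M) k = (\<integral>\<^sup>+g. of_nat (root_walks k (universal_cover g)) \<partial>M)"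
    unfolding expected_closed_walks_eq universal_cover_network_def by (intro nn_integral_distr) simp_all
  also have "\<dots> \<le> expected_closed_walks M k"
    unfolding expected_closed_walks_eq by (intro nn_integral_mono) (simp add: root_walks_universal_cover)
  finally show ?thesis .
qed

section \<open>From moments to spectral mass\<close>

text \<open>The part of the moment \<open>a\<close> inside \<open>\<bar>x\<bar> \<le> t\<close> is
  at most \<open>t ^ (2 * k)\<close>; Cauchy-Schwarz bounds the square of the remaining part by
  \<open>b\<close> times the mass outside.\<close>

lemma paley_zygmund_even_power:
  fixes \<kappa> :: "real measure"
  assumes \<kappa>: "prob_space \<kappa>" "sets \<kappa> = sets borel"
    and m: "(\<integral>\<^sup>+x. ennreal (x ^ (2 * k)) \<partial>\<kappa>) = ennreal a" "(\<integral>\<^sup>+x. ennreal (x ^ (2 * (2 * k))) \<partial>\<kappa>) = ennreal b"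
    and t: "0 \<le> t" "t ^ (2 * k) \<le> a" "0 \<le> b"
  shows "(a - t ^ (2 * k))\<^sup>2 \<le> b * measure \<kappa> {x. \<bar>x\<bar> > t}"
proof -
  interpret prob_space \<kappa> by fact
  note [measurable_cong] = \<kappa>(2)
  let ?B = "{x. \<bar>x\<bar> > t}"
  have B [measurable]: "?B \<in> sets \<kappa>" unfolding \<kappa>(2) by measurable
  have space: "space \<kappa> = UNIV" using sets_eq_imp_space_eq[OF \<kappa>(2)] by simp
  let ?I = "\<integral>\<^sup>+x. ennreal (x ^ (2 * k)) * indicator ?B x \<partial>\<kappa>"
  have "ennreal a \<le> (\<integral>\<^sup>+x. ennreal (t ^ (2 * k)) + ennreal (x ^ (2 * k)) * indicator ?B x \<partial>\<kappa>)"
    unfolding m(1)[symmetric]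
  proof (intro nn_integral_mono)
    fix x
    show "ennreal (x ^ (2 * k)) \<le> ennreal (t ^ (2 * k)) + ennreal (x ^ (2 * k)) * indicator ?B x"
    proof (cases "\<bar>x\<bar> > t")
      case False
      then have "\<bar>x\<bar> ^ (2 * k) \<le> t ^ (2 * k)" by (intro power_mono) auto
      then show ?thesis using False by (simp add: power_even_abs ennreal_leI)
    qed simp
  qed
  also have "\<dots> = ennreal (t ^ (2 * k)) + ?I" by (subst nn_integral_add) (auto simp: emeasure_space_1)
  finally have 1: "ennreal a \<le> ennreal (t ^ (2 * k)) + ?I" .
  have "?I\<^sup>2 \<le> (\<integral>\<^sup>+x. (ennreal (x ^ (2 * k)))\<^sup>2 \<partial>\<kappa>) * (\<integral>\<^sup>+x. (indicator ?B x)\<^sup>2 \<partial>\<kappa>)"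
    by (rule Cauchy_Schwarz_nn_integral) measurable
  also have "(\<integral>\<^sup>+x. (ennreal (x ^ (2 * k)))\<^sup>2 \<partial>\<kappa>) = ennreal b"
    unfolding m(2)[symmetric]
  proof (intro nn_integral_cong)
    fix x :: real
    have "(x ^ (2 * k))\<^sup>2 = x ^ (2 * (2 * k))" by (simp only: power_mult[symmetric] mult.commute)
    moreover have "0 \<le> x ^ (2 * k)" by (rule zero_le_even_power) simp
    ultimately show "(ennreal (x ^ (2 * k)))\<^sup>2 = ennreal (x ^ (2 * (2 * k)))" by (simp only: ennreal_power)
  qed
  also have "(\<integral>\<^sup>+x. (indicator ?B x)\<^sup>2 \<partial>\<kappa>) = (\<integral>\<^sup>+x. indicator ?B x \<partial>\<kappa>)"
    by (intro nn_integral_cong) (auto simp: indicator_def)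
  also have "\<dots> = ennreal (measure \<kappa> ?B)" using B by (simp add: emeasure_eq_measure)
  finally have 2: "?I\<^sup>2 \<le> ennreal (b * measure \<kappa> ?B)" using t by (simp add: ennreal_mult)
  have "ennreal (a - t ^ (2 * k)) \<le> ?I"
    using 1 t by (simp add: ennreal_minus[symmetric] ennreal_minus_le_iff)
  then have "(ennreal (a - t ^ (2 * k)))\<^sup>2 \<le> ?I\<^sup>2" by (intro power_mono) auto
  from order_trans[OF this 2] have "ennreal ((a - t ^ (2 * k))\<^sup>2) \<le> ennreal (b * measure \<kappa> ?B)"
    using t by (simp only: ennreal_power diff_ge_0_iff_ge)
  then show ?thesis using t by (simp add: ennreal_le_iff)
qed

lemma network_spectral_measure_UNIV:
  assumes M: "random_rooted_graph M" and \<mu>: "network_spectral_measure M \<mu>"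
  shows "emeasure \<mu> UNIV = 1"
proof -
  interpret prob_space M using M by (simp add: random_rooted_graph_def)
  obtain \<kappa> where \<kappa>: "\<kappa> \<in> M \<rightarrow>\<^sub>M prob_algebra borel"
    "\<And>B. B \<in> sets borel \<Longrightarrow> emeasure \<mu> B = (\<integral>\<^sup>+ g. emeasure (\<kappa> g) B \<partial>M)"
    using \<mu> unfolding network_spectral_measure_def by blast
  have "emeasure (\<kappa> g) UNIV = 1" if "g \<in> space M" for g
  proof -
    have k: "\<kappa> g \<in> space (prob_algebra borel)" using measurable_space[OF \<kappa>(1) that] .
    then have s: "sets (\<kappa> g) = sets borel" and p: "prob_space (\<kappa> g)" by (auto simp: space_prob_algebra)
    then show ?thesis using prob_space.emeasure_space_1[OF p] sets_eq_imp_space_eq[OF s] by simp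
  qed
  then have "emeasure \<mu> UNIV = (\<integral>\<^sup>+ g. 1 \<partial>M)" using \<kappa>(2)[of UNIV] by (simp cong: nn_integral_cong)
  then show ?thesis by (simp add: emeasure_space_1)
qed

text \<open>On the event the spectral measure at the root has moments \<open>a\<close> and
  \<open>b\<close>, so the mass bound holds sample by sample and is integrated.\<close>

lemma network_spectral_measure_lower_bound:
  assumes M: "random_rooted_graph M" and \<mu>: "network_spectral_measure M \<mu>"
    and t: "0 \<le> t" "t ^ (2 * k) \<le> real a"
  shows "(real a - t ^ (2 * k))\<^sup>2 / (real b + 1) * measure M {g. root_walks (2 * k) g = a \<and> root_walks (2 * (2 * k)) g = b}
    \<le> measure \<mu> {x. \<bar>x\<bar> > t}"
proof -
  interpret prob_space M using M by (simp add: random_rooted_graph_def)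
  have setsM [measurable_cong]: "sets M = sets borel" using M by (simp add: random_rooted_graph_def)
  let ?U = "{g. root_walks (2 * k) g = a \<and> root_walks (2 * (2 * k)) g = b}" and ?B = "{x. \<bar>x\<bar> > t}"
  \<comment> \<open>The \<open>+ 1\<close> keeps the denominator positive without a separate
    argument for \<open>b\<close>.\<close>
  define c where "c = (real a - t ^ (2 * k))\<^sup>2 / (real b + 1)"
  have c: "c \<ge> 0" by (simp add: c_def)
  obtain \<kappa> where \<kappa>: "\<kappa> \<in> M \<rightarrow>\<^sub>M prob_algebra borel"
    "AE g in M. spectral_measure_at (graph g) (indicator {origin g}) (\<kappa> g)"
    "\<And>B. B \<in> sets borel \<Longrightarrow> emeasure \<mu> B = (\<integral>\<^sup>+ g. emeasure (\<kappa> g) B \<partial>M)"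
    and sets\<mu>: "sets \<mu> = sets borel"
    using \<mu> unfolding network_spectral_measure_def by blast
  have U: "?U \<in> sets M"
  proof -
    have "?U = (root_walks (2 * k) -` {a} \<inter> space borel) \<inter> (root_walks (2 * (2 * k)) -` {b} \<inter> space borel)" by auto
    also have "\<dots> \<in> sets borel" by (intro sets.Int measurable_sets[OF measurable_root_walks]) auto
    finally show ?thesis by (simp add: setsM)
  qed
  have B: "?B \<in> sets borel" by measurable
  have "AE g in M. ennreal c * indicator ?U g \<le> emeasure (\<kappa> g) ?B"
    using \<kappa>(2) AE_space
  proof eventually_elim
    case (elim g)
    show ?case
    proof (cases "g \<in> ?U")
      case True
      interpret G: loc_fin_graph "graph g" "origin g" by (rule loc_fin_graph_rooted)
      have "\<kappa> g \<in> space (prob_algebra borel)" using measurable_space[OF \<kappa>(1) elim(2)] .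
      then have kg: "sets (\<kappa> g) = sets borel" "prob_space (\<kappa> g)" by (auto simp: space_prob_algebra)
      note mom = spectral_measure_moments[OF G.G(1,2) G.x elim(1)]
      have "(real a - t ^ (2 * k))\<^sup>2 \<le> real b * measure (\<kappa> g) ?B"
        using True mom[of k] mom[of "2 * k"] t
        by (intro paley_zygmund_even_power kg) (auto simp: root_walks_eq ennreal_of_nat_eq_real_of_nat)
      also have "\<dots> \<le> (real b + 1) * measure (\<kappa> g) ?B" by (intro mult_right_mono) auto
      finally have le: "c \<le> measure (\<kappa> g) ?B" by (simp add: c_def divide_le_eq mult.commute)
      interpret k: prob_space "\<kappa> g" by fact
      show ?thesis using True le by (simp add: k.emeasure_eq_measure ennreal_leI)
    qed simp
  qed
  then have "(\<integral>\<^sup>+g. ennreal c * indicator ?U g \<partial>M) \<le> emeasure \<mu> ?B"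
    unfolding \<kappa>(3)[OF B] by (rule nn_integral_mono_AE)
  moreover have "(\<integral>\<^sup>+g. ennreal c * indicator ?U g \<partial>M) = ennreal (c * measure M ?U)"
    using U c by (simp add: nn_integral_cmult_indicator emeasure_eq_measure ennreal_mult)
  moreover have "emeasure \<mu> ?B = ennreal (measure \<mu> ?B)"
  proof -
    have "emeasure \<mu> ?B \<le> emeasure \<mu> UNIV" by (intro emeasure_mono) (auto simp: sets\<mu>)
    then have "emeasure \<mu> ?B \<le> 1" using network_spectral_measure_UNIV[OF M \<mu>] by simp
    then show ?thesis using emeasure_eq_ennreal_measure[of \<mu> ?B] by (metis ennreal_one_less_top leD)
  qed
  ultimately show ?thesis by (simp add: c_def ennreal_le_iff)
qed

section \<open>Passing to the local limit\<close>

lemma continuous_on_indicator_clopen: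
  assumes "open U" "open (- U)"
  shows "continuous_on UNIV (indicator U :: 'a :: topological_space \<Rightarrow> real)"
proof -
  have "indicator U -` S = (if 1 \<in> S then U else {}) \<union> (if 0 \<in> S then - U else {})" for S :: "real set"
    by (auto simp: indicator_def of_bool_def split: if_splits)
  then have "open (indicator U -` S)" for S :: "real set" using assms by auto
  then show ?thesis by (simp add: continuous_on_open_vimage)
qed

text \<open>The event depends on a finite ball and is clopen, so its indicator is itself an
  admissible test function.\<close>

lemma local_convergence_root_walks:
  assumes conv: "local_convergence Mn M" and M: "random_rooted_graph M" "\<And>n. random_rooted_graph (Mn n)"
  shows "(\<lambda>n. measure (Mn n) {g. root_walks k g = a \<and> root_walks l g = b}) 
    \<longlonglongrightarrow> measure M {g. root_walks k g = a \<and> root_walks l g = b}"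
proof -
  let ?U = "{g. root_walks k g = a \<and> root_walks l g = b}"
  have o1: "open ?U" 
    using open_root_walks[of "\<lambda>m. m = a" k] open_root_walks[of "\<lambda>m. m = b" l] by (simp add: open_Int Collect_conj_eq)
  have o2: "open (- ?U)"
  proof -
    have "- ?U = {g. root_walks k g \<noteq> a} \<union> {g. root_walks l g \<noteq> b}" by auto
    then show ?thesis using open_root_walks[of "\<lambda>m. m \<noteq> a" k] open_root_walks[of "\<lambda>m. m \<noteq> b" l] by auto
  qed
  have "continuous_on UNIV (indicator ?U :: rooted_graph \<Rightarrow> real)"
    by (rule continuous_on_indicator_clopen[OF o1 o2])
  moreover have "bounded (range (indicator ?U :: rooted_graph \<Rightarrow> real))"
    by (rule boundedI[of _ 1]) (auto simp: indicator_def)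
  ultimately have "(\<lambda>n. \<integral>g. indicator ?U g \<partial>Mn n) \<longlonglongrightarrow> (\<integral>g. indicator ?U g \<partial>M :: real)"
    using conv by (auto simp: local_convergence_def)
  moreover have "(\<integral>g. indicator ?U g \<partial>N) = measure N ?U" if "random_rooted_graph N" for N
    using that o1 sets_eq_imp_space_eq[of N borel] by (simp add: random_rooted_graph_def)
  ultimately show ?thesis using M by simp
qed

text \<open>There are only countably many pairs \<open>(a, b)\<close>. If all events with
  \<open>a > s\<close> were null, the count would be at most \<open>s\<close> almost surely, and so
  would its expectation.\<close>

lemma exists_root_walks_event:
  assumes M: "random_rooted_graph M" and gt: "expected_closed_walks M k > ennreal s" and s: "s \<ge> 0"
  obtains a b where "real a > s" "measure M {g. root_walks k g = a \<and> root_walks l g = b} > 0"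
proof -
  interpret prob_space M using M by (simp add: random_rooted_graph_def)
  have setsM [measurable_cong]: "sets M = sets borel" using M by (simp add: random_rooted_graph_def)
  have space: "space M = UNIV" using sets_eq_imp_space_eq[OF setsM] by simp
  let ?U = "\<lambda>(a, b). {g. root_walks k g = a \<and> root_walks l g = b}"
  have U: "?U p \<in> sets M" for p
  proof -
    have "?U p = (root_walks k -` {fst p} \<inter> space borel) \<inter> (root_walks l -` {snd p} \<inter> space borel)" 
      by (auto split: prod.splits)
    also have "\<dots> \<in> sets borel" by (intro sets.Int measurable_sets[OF measurable_root_walks]) auto
    finally show ?thesis by (simp add: setsM)
  qed
  have "\<exists>a b. real a > s \<and> measure M (?U (a, b)) > 0"
  proof (rule ccontr)
    assume "\<not> ?thesis"
    then have "\<not> measure M (?U (a, b)) > 0" if "real a > s" for a b using that by blast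
    then have "measure M (?U (a, b)) = 0" if "real a > s" for a b
      using that measure_nonneg[of M "?U (a, b)"] by (simp only: not_less order.antisym)
    then have "?U p \<in> null_sets M" if "p \<in> {(a, b). real a > s}" for p
      using that U[of p] by (auto simp: null_sets_def emeasure_eq_measure)
    then have "(\<Union>p\<in>{(a, b). real a > s}. ?U p) \<in> null_sets M"
      by (intro null_sets_UN') auto
    then have "AE g in M. g \<notin> (\<Union>p\<in>{(a, b). real a > s}. ?U p)" by (rule AE_not_in)
    then have "AE g in M. (of_nat (root_walks k g) :: ennreal) \<le> ennreal s"
    proof eventually_elim
      case (elim g)
      then have "real (root_walks k g) \<le> s" by (auto simp: not_less)
      then show ?case by (simp add: ennreal_of_nat_eq_real_of_nat ennreal_leI)
    qed
    then have "expected_closed_walks M k \<le> (\<integral>\<^sup>+g. ennreal s \<partial>M)"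
      unfolding expected_closed_walks_eq by (rule nn_integral_mono_AE)
    then show False using gt by (simp add: emeasure_space_1)
  qed
  then show ?thesis using that by auto
qed

text \<open>The constant is built from \<open>k\<close>, \<open>a\<close>, \<open>b\<close> and the
  law \<open>M\<close> alone, before any approximating sequence is given.\<close>

lemma liminf_spectral_measure_ge:
  fixes M :: "rooted_graph measure" and \<epsilon> :: real
  assumes M: "random_rooted_graph M" and \<epsilon>: "\<epsilon> > 0"
  obtains c where "c > 0" "\<And>Mn \<mu>. (\<And>n. random_rooted_graph (Mn n)) \<Longrightarrow> local_convergence Mn M \<Longrightarrow>
    (\<And>n. network_spectral_measure (Mn n) (\<mu> n)) \<Longrightarrow>
    ereal c \<le> liminf (\<lambda>n. ereal (measure (\<mu> n)
      {x. \<bar>x\<bar> > real_of_ereal (spectral_radius (universal_cover_network M)) - \<epsilon>}))"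
proof -
  let ?T = "universal_cover_network M"
  define t where "t = real_of_ereal (spectral_radius ?T) - \<epsilon>"
  have T: "random_rooted_graph ?T" by (rule random_rooted_graph_universal_cover[OF M])
  show ?thesis
  proof (cases "t < 0")
    \<comment> \<open>The set is the whole line, so the constant 1 serves.\<close>
    case True
    show ?thesis
    proof (rule that[of 1], unfold t_def[symmetric])
      fix Mn and \<mu> :: "nat \<Rightarrow> real measure"
      assume "\<And>n. random_rooted_graph (Mn n)" "\<And>n. network_spectral_measure (Mn n) (\<mu> n)"
      moreover have "{x. \<bar>x\<bar> > t} = UNIV" using True by (auto intro: less_le_trans)
      ultimately have "measure (\<mu> n) {x. \<bar>x\<bar> > t} = 1" for n
        using network_spectral_measure_UNIV[of "Mn n" "\<mu> n"] by (simp add: measure_def)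
      then show "ereal 1 \<le> liminf (\<lambda>n. ereal (measure (\<mu> n) {x. \<bar>x\<bar> > t}))" by (simp add: Liminf_const)
    qed simp
  next
    case False
    then have t: "t \<ge> 0" by simp
    \<comment> \<open>\<open>real_of_ereal\<close> sends both infinities to 0, which would make
      \<open>t\<close> equal to \<open>- \<epsilon>\<close>.\<close>
    have "spectral_radius ?T \<noteq> \<infinity>" "spectral_radius ?T \<noteq> -\<infinity>" using t \<epsilon> by (auto simp: t_def)
    then have "ereal t < spectral_radius ?T" using \<epsilon> by (cases "spectral_radius ?T") (auto simp: t_def)
    then obtain k where k: "ereal t < walk_growth ?T k"
      unfolding spectral_radius_eq_SUP[OF T] by (auto simp: less_SUP_iff)
    interpret T: prob_space ?T using T by (simp add: random_rooted_graph_def)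
    have "k > 0"
    proof (rule ccontr)
      assume "\<not> k > 0"
      then have "walk_growth ?T k = 0"
        by (simp add: walk_growth_def expected_closed_walks_eq root_walks_0 T.emeasure_space_1)
      then show False using k t by simp
    qed
    have "ennreal (t ^ (2 * k)) < expected_closed_walks ?T (2 * k)"
    proof (cases "expected_closed_walks ?T (2 * k) = \<infinity>")
      case fin: False
      define r where "r = enn2real (expected_closed_walks ?T (2 * k))"
      have r: "expected_closed_walks ?T (2 * k) = ennreal r" "r \<ge> 0" using fin by (auto simp: r_def less_top)
      have "t < root (2 * k) r" using k fin by (simp add: walk_growth_def r_def)
      then have "t ^ (2 * k) < root (2 * k) r ^ (2 * k)" using t \<open>k > 0\<close> by (intro power_strict_mono) auto
      also have "\<dots> = r" using r \<open>k > 0\<close> by (intro real_root_pow_pos2) auto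
      finally show ?thesis unfolding r(1) using t by (intro ennreal_lessI) (auto intro: le_less_trans zero_le_power)
    qed auto
    also have "\<dots> \<le> expected_closed_walks M (2 * k)" by (rule expected_closed_walks_universal_cover_le[OF M])
    finally have gt: "expected_closed_walks M (2 * k) > ennreal (t ^ (2 * k))" .
    have t2: "0 \<le> t ^ (2 * k)" using t by simp
    obtain a b where ab: "real a > t ^ (2 * k)" 
      "measure M {g. root_walks (2 * k) g = a \<and> root_walks (2 * (2 * k)) g = b} > 0"
      using exists_root_walks_event[OF M gt t2] by blast
    let ?U = "{g. root_walks (2 * k) g = a \<and> root_walks (2 * (2 * k)) g = b}"
    define d where "d = (real a - t ^ (2 * k))\<^sup>2 / (real b + 1)"
    have d: "d > 0" using ab by (simp add: d_def add_nonneg_pos)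
    show ?thesis
    proof (rule that[of "d * measure M ?U"], unfold t_def[symmetric])
      show "d * measure M ?U > 0" using d ab by simp
      fix Mn and \<mu> :: "nat \<Rightarrow> real measure"
      assume Mn: "\<And>n. random_rooted_graph (Mn n)" and conv: "local_convergence Mn M"
        and \<mu>: "\<And>n. network_spectral_measure (Mn n) (\<mu> n)"
      have "(\<lambda>n. ereal (d * measure (Mn n) ?U)) \<longlonglongrightarrow> ereal (d * measure M ?U)"
        using local_convergence_root_walks[OF conv M] Mn by (intro tendsto_ereal tendsto_mult_left) auto
      then have "ereal (d * measure M ?U) = liminf (\<lambda>n. ereal (d * measure (Mn n) ?U))"
        by (rule lim_imp_Liminf[symmetric, rotated]) simp
      also have "\<dots> \<le> liminf (\<lambda>n. ereal (measure (\<mu> n) {x. \<bar>x\<bar> > t}))"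
      proof (intro Liminf_mono always_eventually allI)
        fix n
        show "ereal (d * measure (Mn n) ?U) \<le> ereal (measure (\<mu> n) {x. \<bar>x\<bar> > t})"
          using network_spectral_measure_lower_bound[of "Mn n" "\<mu> n" t k a b] Mn \<mu> t ab(1) by (simp add: d_def)
      qed
      finally show "ereal (d * measure M ?U) \<le> liminf (\<lambda>n. ereal (measure (\<mu> n) {x. \<bar>x\<bar> > t}))" .
    qed
  qed
qed

theorem theorem2:
  shows "(\<forall>G :: rooted_graph measure. unimodular_network G \<longrightarrow> spectral_radius G < \<infinity> \<longrightarrow>
      (\<forall>\<epsilon> :: real. \<epsilon> > 0 \<longrightarrow> (\<exists>c :: real. c > 0 \<and>
         (\<forall>(Gn :: nat \<Rightarrow> rooted_graph measure) (\<mu> :: nat \<Rightarrow> real measure).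
            (\<forall>n. unimodular_network (Gn n)) \<longrightarrow> local_convergence Gn G \<longrightarrow>
            (\<forall>n. network_spectral_measure (Gn n) (\<mu> n)) \<longrightarrow>
            liminf (\<lambda>n. ereal (measure (\<mu> n)
              {x. \<bar>x\<bar> > real_of_ereal (spectral_radius (universal_cover_network G)) - \<epsilon>}))
            \<ge> ereal c)))) \<and>
    (\<forall>(Gn :: nat \<Rightarrow> 'v ugraph) (\<Delta> :: nat).
       (\<forall>n. simple_graph (Gn n) \<and> finite (verts (Gn n)) \<and> connected_graph (Gn n)) \<longrightarrow>
       (\<forall>n. \<forall>v\<in>verts (Gn n). card (nbrs (Gn n) v) \<le> \<Delta>) \<longrightarrow>
       filterlim (\<lambda>n. card (verts (Gn n))) at_top sequentially \<longrightarrow>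
       (\<forall>j\<ge>1. liminf (\<lambda>n. ereal (graph_singular_value j (Gn n))) \<ge>
          liminf (\<lambda>n. ereal (2 * sqrt (average_degree (Gn n) - 1)))))"
proof (intro conjI allI impI)
  fix G :: "rooted_graph measure" and \<epsilon> :: real
  assume "unimodular_network G" "\<epsilon> > 0"
  have "random_rooted_graph M" if "unimodular_network M" for M
    using that by (simp add: unimodular_network_def)
  with liminf_spectral_measure_ge[of G \<epsilon>] \<open>unimodular_network G\<close> \<open>\<epsilon> > 0\<close>
  show "\<exists>c :: real. c > 0 \<and>
         (\<forall>(Gn :: nat \<Rightarrow> rooted_graph measure) (\<mu> :: nat \<Rightarrow> real measure).
            (\<forall>n. unimodular_network (Gn n)) \<longrightarrow> local_convergence Gn G \<longrightarrow>
            (\<forall>n. network_spectral_measure (Gn n) (\<mu> n)) \<longrightarrow>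
            liminf (\<lambda>n. ereal (measure (\<mu> n)
              {x. \<bar>x\<bar> > real_of_ereal (spectral_radius (universal_cover_network G)) - \<epsilon>}))
            \<ge> ereal c)"
    by metis
next
  fix Gn :: "nat \<Rightarrow> 'v ugraph" and \<Delta> j :: nat
  assume G: "\<forall>n. simple_graph (Gn n) \<and> finite (verts (Gn n)) \<and> connected_graph (Gn n)"
    and deg: "\<forall>n. \<forall>v\<in>verts (Gn n). card (nbrs (Gn n) v) \<le> \<Delta>"
    and size: "filterlim (\<lambda>n. card (verts (Gn n))) at_top sequentially" and j: "1 \<le> j"
  show "liminf (\<lambda>n. ereal (2 * sqrt (average_degree (Gn n) - 1)))
      \<le> liminf (\<lambda>n. ereal (graph_singular_value j (Gn n)))"
    by (rule liminf_graph_singular_value_ge[where \<Delta> = \<Delta>, OF _ _ size j]) (simp_all add: G deg)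
qed

end
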